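(* Let $d\ge 0$ be a fixed integer. Let $\Gamma$ be a constraint language over the Boolean domain $D=\{0,1\}$ such that every relation in $\Gamma$ is closed under the minority polymorphism. Given an instance $\mathcal{C}=(X=\{x_1,\dots,x_n\},\{0,1\},C)$ of $\textsc{CSP}(\Gamma)$, the $d$-truncated reduced Gröbner basis of the combinatorial ideal $\mathbf{I}(Sol(\mathcal{C}))\subseteq\mathbb{R}[x_1,\dots,x_n]$ with respect to the graded lexicographic monomial ordering can be computed in $n^{O(d)}$ time.
   Context: A $k$-ary relation on $D$ is a subset of $D^k$; a constraint language $\Gamma$ is a set of relations over $D$. A constraint over $\Gamma$ is an expression $R(x_{i_1},\dots,x_{i_k})$ with $R\in\Gamma$ of arity $k$; it is satisfied by an assignment $\phi$ if $(\phi(x_{i_1}),\dots,\phi(x_{i_k}))\in R$. An instance $\mathcal{C}=(X,D,C)$ of $\textsc{CSP}(\Gamma)$ consists of variables $X$ and a set $C$ of constraints over $\Gamma$ on variables from $X$; $Sol(\mathcal{C})\subseteq\{0,1\}^n$ is the set of assignments satisfying all constraints. An operation $f:D^m\to D$ is a polymorphism of (preserves) $R\subseteq D^k$ if applying $f$ coordinatewise to any $m$ tuples of $R$ (repetitions allowed) yields a tuple of $R$. The minority polymorphism is the ternary operation $f$ with $f(a,a,b)=f(a,b,a)=f(b,a,a)=b$ for all $a,b\in D$. The combinatorial ideal $\mathbf{I}(Sol(\mathcal{C}))$ is the vanishing ideal $\{p\in\mathbb{R}[x_1,\dots,x_n]: p(a)=0\ \forall a\in Sol(\mathcal{C})\}$.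 The graded lexicographic order (with $x_1>x_2>\dots>x_n$) compares monomials first by total degree, then lexicographically. A reduced Gröbner basis is a Gröbner basis $G$ in which every element has leading coefficient $1$ and no monomial of any $g\in G$ is divisible by the leading monomial of another element of $G$. If $G$ is a Gröbner basis, its $d$-truncated version is $G\cap\mathbb{R}[x_1,\dots,x_n]_d$, where $\mathbb{R}[x_1,\dots,x_n]_d$ is the set of polynomials of degree at most $d$.
   Formalization: The bound in n alone is proved for finite Γ; for infinite Γ, where it fails since arities are unbounded, the time is bounded in the size of the instance with explicitly listed relations. For d = 0 the exponent O(d) is read as O(1), and for n ≤ 1 the base n is replaced by 2. *)

theory Defs
  imports Complex_Main "HOL-Library.Poly_Mapping"
begin

section \<open>Constraint satisfaction\<close>

text \<open>A relation carries its arity explicitly, so that empty relations of different arities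
  are different. The Boolean domain \<open>{0,1}\<close> is the type \<^typ>\<open>bool\<close>; assignments of
  \<open>n\<close> variables are lists of length \<open>n\<close>, and the variable \<open>x\<^sub>i\<^sub>+\<^sub>1\<close> has index \<open>i\<close>.\<close>

type_synonym 'a rel = "nat \<times> 'a list set"

definition is_relation :: "'a rel \<Rightarrow> bool" where
  "is_relation R \<longleftrightarrow> (\<forall>t \<in> snd R. length t = fst R)"

definition polymorphism :: "nat \<Rightarrow> ('a list \<Rightarrow> 'a) \<Rightarrow> 'a rel \<Rightarrow> bool" where
  "polymorphism m f R \<longleftrightarrow>
     (\<forall>ts. length ts = m \<and> set ts \<subseteq> snd R \<longrightarrow>
        map (\<lambda>j. f (map (\<lambda>t. t ! j) ts)) [0..<fst R] \<in> snd R)"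

definition minority_operation :: "('a list \<Rightarrow> 'a) \<Rightarrow> bool" where
  "minority_operation f \<longleftrightarrow>
     (\<forall>a b. f [a, a, b] = b \<and> f [a, b, a] = b \<and> f [b, a, a] = b)"

type_synonym 'a cstr = "'a rel \<times> nat list"

definition csp_instance :: "'a rel set \<Rightarrow> nat \<Rightarrow> 'a cstr set \<Rightarrow> bool" where
  "csp_instance \<Gamma> n C \<longleftrightarrow> finite C \<and>
     (\<forall>(R, xs) \<in> C. R \<in> \<Gamma> \<and> length xs = fst R \<and> set xs \<subseteq> {..<n})"

definition Sol :: "nat \<Rightarrow> 'a cstr set \<Rightarrow> 'a list set" where
  "Sol n C = {\<phi>. length \<phi> = n \<and> (\<forall>(R, xs) \<in> C. map (\<lambda>i. \<phi> ! i) xs \<in> snd R)}"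


section \<open>Polynomials and Groebner bases\<close>

type_synonym monom = "nat \<Rightarrow>\<^sub>0 nat"
type_synonym mpoly = "monom \<Rightarrow>\<^sub>0 real"

definition polys :: "nat \<Rightarrow> mpoly set" where
  "polys n = {p. \<forall>m \<in> Poly_Mapping.keys p. Poly_Mapping.keys m \<subseteq> {..<n}}"

definition eval_monom :: "(nat \<Rightarrow> real) \<Rightarrow> monom \<Rightarrow> real" where
  "eval_monom a m = (\<Prod>i \<in> Poly_Mapping.keys m. a i ^ Poly_Mapping.lookup m i)"

definition eval_poly :: "(nat \<Rightarrow> real) \<Rightarrow> mpoly \<Rightarrow> real" where
  "eval_poly a p = (\<Sum>m \<in> Poly_Mapping.keys p. Poly_Mapping.lookup p m * eval_monom a m)"

definition combinatorial_ideal :: "nat \<Rightarrow> bool list set \<Rightarrow> mpoly set" where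
  "combinatorial_ideal n S =
     {p \<in> polys n. \<forall>a \<in> S. eval_poly (\<lambda>i. of_bool (a ! i)) p = 0}"

definition monom_degree :: "monom \<Rightarrow> nat" where
  "monom_degree m = (\<Sum>i \<in> Poly_Mapping.keys m. Poly_Mapping.lookup m i)"

definition lex_less :: "monom \<Rightarrow> monom \<Rightarrow> bool" where
  "lex_less m m' \<longleftrightarrow>
     (\<exists>i. Poly_Mapping.lookup m i < Poly_Mapping.lookup m' i \<and>
          (\<forall>j<i. Poly_Mapping.lookup m j = Poly_Mapping.lookup m' j))"

definition grlex_less :: "monom \<Rightarrow> monom \<Rightarrow> bool" where
  "grlex_less m m' \<longleftrightarrow> monom_degree m < monom_degree m' \<or>
     monom_degree m = monom_degree m' \<and> lex_less m m'"

text \<open>The leading monomial is only meaningful for nonzero polynomials.\<close>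

definition lead_monom :: "mpoly \<Rightarrow> monom" where
  "lead_monom p = (THE m. m \<in> Poly_Mapping.keys p \<and>
     (\<forall>m' \<in> Poly_Mapping.keys p. m' \<noteq> m \<longrightarrow> grlex_less m' m))"

definition lead_coef :: "mpoly \<Rightarrow> real" where
  "lead_coef p = Poly_Mapping.lookup p (lead_monom p)"

definition lead_term :: "mpoly \<Rightarrow> mpoly" where
  "lead_term p = Poly_Mapping.single (lead_monom p) (lead_coef p)"

definition is_ideal :: "nat \<Rightarrow> mpoly set \<Rightarrow> bool" where
  "is_ideal n J \<longleftrightarrow> J \<subseteq> polys n \<and> 0 \<in> J \<and>
     (\<forall>p \<in> J. \<forall>q \<in> J. p + q \<in> J) \<and> (\<forall>h \<in> polys n. \<forall>p \<in> J. h * p \<in> J)"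

definition ideal_generated :: "nat \<Rightarrow> mpoly set \<Rightarrow> mpoly set" where
  "ideal_generated n S = is_ideal n hull S"

definition groebner_basis :: "nat \<Rightarrow> mpoly set \<Rightarrow> mpoly set \<Rightarrow> bool" where
  "groebner_basis n I G \<longleftrightarrow> finite G \<and> G \<subseteq> I \<and>
     ideal_generated n (lead_term ` (G - {0})) = ideal_generated n (lead_term ` (I - {0}))"

definition monom_dvd :: "monom \<Rightarrow> monom \<Rightarrow> bool" where
  "monom_dvd m m' \<longleftrightarrow> (\<exists>k. m' = m + k)"

definition reduced_groebner_basis :: "nat \<Rightarrow> mpoly set \<Rightarrow> mpoly set \<Rightarrow> bool" where
  "reduced_groebner_basis n I G \<longleftrightarrow> groebner_basis n I G \<and>
     (\<forall>g \<in> G. lead_coef g = 1 \<and>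
        (\<forall>g' \<in> G - {g}. \<forall>m \<in> Poly_Mapping.keys g. \<not> monom_dvd (lead_monom g') m))"

definition polys_upto :: "nat \<Rightarrow> nat \<Rightarrow> mpoly set" where
  "polys_upto n d = {p \<in> polys n. \<forall>m \<in> Poly_Mapping.keys p. monom_degree m \<le> d}"

definition truncation :: "nat \<Rightarrow> nat \<Rightarrow> mpoly set \<Rightarrow> mpoly set" where
  "truncation n d G = G \<inter> polys_upto n d"


section \<open>Model of computation\<close>

text \<open>Programs are finite systems of mutually recursive first-order functions over binary trees
  with a single atom (pure Lisp, in the style of the languages WHILE and F of N. D. Jones).
  Every elementary step (variable access, atom, pairing, projection, test for the atom, local
  binding, call) has unit cost; trees are handled by reference. Variables are de Bruijn indices
  into the environment, and function 0 is the main function.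

  Representing trees by shared cells, Turing machines and these programs simulate each
  other with polynomial overhead. Since the unfolding of a shared
  structure can be larger than the number of steps that built it, the time bounds below also
  charge for the full size of the output tree.\<close>

datatype tree = Atom | Pair tree tree

fun head :: "tree \<Rightarrow> tree" where
  "head Atom = Atom"
| "head (Pair s t) = s"

fun tail :: "tree \<Rightarrow> tree" where
  "tail Atom = Atom"
| "tail (Pair s t) = t"

fun tree_size :: "tree \<Rightarrow> nat" where
  "tree_size Atom = 1"
| "tree_size (Pair s t) = 1 + tree_size s + tree_size t"

datatype expr =
    EVar nat
  | EAtom
  | EPair expr expr
  | EHead expr
  | ETail expr
  | EIf expr expr expr  \<comment> \<open>first branch iff the condition is not the atom\<close>
  | ELet expr expr
  | ECall nat "expr list"

type_synonym program = "expr list"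

text \<open>\<open>eval P env e v k\<close>: evaluating \<open>e\<close> terminates with value \<open>v\<close> after \<open>k\<close> steps.\<close>

inductive eval :: "program \<Rightarrow> tree list \<Rightarrow> expr \<Rightarrow> tree \<Rightarrow> nat \<Rightarrow> bool"
  and eval_args :: "program \<Rightarrow> tree list \<Rightarrow> expr list \<Rightarrow> tree list \<Rightarrow> nat \<Rightarrow> bool"
  for P :: program
where
  eval_Var: "i < length env \<Longrightarrow> eval P env (EVar i) (env ! i) 1"
| eval_Atom: "eval P env EAtom Atom 1"
| eval_Pair: "eval P env e1 v1 k1 \<Longrightarrow> eval P env e2 v2 k2 \<Longrightarrow>
    eval P env (EPair e1 e2) (Pair v1 v2) (1 + k1 + k2)"
| eval_Head: "eval P env e v k \<Longrightarrow> eval P env (EHead e) (head v) (1 + k)"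
| eval_Tail: "eval P env e v k \<Longrightarrow> eval P env (ETail e) (tail v) (1 + k)"
| eval_If_Pair: "eval P env e v k \<Longrightarrow> v \<noteq> Atom \<Longrightarrow> eval P env e1 v1 k1 \<Longrightarrow>
    eval P env (EIf e e1 e2) v1 (1 + k + k1)"
| eval_If_Atom: "eval P env e Atom k \<Longrightarrow> eval P env e2 v2 k2 \<Longrightarrow>
    eval P env (EIf e e1 e2) v2 (1 + k + k2)"
| eval_Let: "eval P env e1 v1 k1 \<Longrightarrow> eval P (v1 # env) e2 v2 k2 \<Longrightarrow>
    eval P env (ELet e1 e2) v2 (1 + k1 + k2)"
| eval_Call: "f < length P \<Longrightarrow> eval_args P env es vs k \<Longrightarrow> eval P vs (P ! f) v k' \<Longrightarrow>
    eval P env (ECall f es) v (1 + k + k')"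
| eval_args_Nil: "eval_args P env [] [] 0"
| eval_args_Cons: "eval P env e v k \<Longrightarrow> eval_args P env es vs k' \<Longrightarrow>
    eval_args P env (e # es) (v # vs) (k + k')"

lemma
  shows eval_deterministic:
      "eval P env e v k \<Longrightarrow> eval P env e v' k' \<Longrightarrow> v' = v \<and> k' = k"
    and eval_args_deterministic:
      "eval_args P env es vs k \<Longrightarrow> eval_args P env es vs' k' \<Longrightarrow> vs' = vs \<and> k' = k"
proof (induction arbitrary: v' k' and vs' k' rule: eval_eval_args.inducts)
  case eval_Var
  then show ?case by (auto elim: eval.cases)
next
  case eval_Atom
  then show ?case by (auto elim: eval.cases)
next
  case eval_Pair
  from eval_Pair.prems show ?case by cases (use eval_Pair.IH in blast)+
next
  case eval_Head
  from eval_Head.prems show ?case by cases (use eval_Head.IH in blast)+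
next
  case eval_Tail
  from eval_Tail.prems show ?case by cases (use eval_Tail.IH in blast)+
next
  case eval_If_Pair
  from eval_If_Pair.prems show ?case
    by cases (use eval_If_Pair.IH eval_If_Pair.hyps in blast)+
next
  case eval_If_Atom
  from eval_If_Atom.prems show ?case by cases (use eval_If_Atom.IH in blast)+
next
  case eval_Let
  from eval_Let.prems show ?case by cases (use eval_Let.IH in blast)+
next
  case eval_Call
  from eval_Call.prems show ?case by cases (use eval_Call.IH in blast)+
next
  case eval_args_Nil
  then show ?case by (auto elim: eval_args.cases)
next
  case eval_args_Cons
  from eval_args_Cons.prems show ?case by cases (use eval_args_Cons.IH in blast)+
qed

definition computes_in :: "program \<Rightarrow> tree \<Rightarrow> tree \<Rightarrow> nat \<Rightarrow> bool" where
  "computes_in P input output k \<longleftrightarrow> eval P [input] (ECall 0 [EVar 0]) output k"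


section \<open>Encodings\<close>

text \<open>The number of variables, variable indices and exponents are written in unary; numerators
  and denominators of coefficients are written in binary, least significant bit first.\<close>

fun enc_list :: "('a \<Rightarrow> tree) \<Rightarrow> 'a list \<Rightarrow> tree" where
  "enc_list f [] = Atom"
| "enc_list f (x # xs) = Pair (f x) (enc_list f xs)"

definition enc_bool :: "bool \<Rightarrow> tree" where
  "enc_bool b = (if b then Pair Atom Atom else Atom)"

definition enc_unary :: "nat \<Rightarrow> tree" where
  "enc_unary n = enc_list (\<lambda>_. Atom) [0..<n]"

fun bits :: "nat \<Rightarrow> bool list" where
  "bits n = (if n = 0 then [] else odd n # bits (n div 2))"

declare bits.simps [simp del]

definition enc_binary :: "nat \<Rightarrow> tree" where
  "enc_binary n = enc_list enc_bool (bits n)"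

definition enc_rat :: "rat \<Rightarrow> tree" where
  "enc_rat r = (case quotient_of r of (a, b) \<Rightarrow>
     Pair (enc_bool (a < 0)) (Pair (enc_binary (nat \<bar>a\<bar>)) (enc_binary (nat b))))"

text \<open>An instance is given by listing its constraints without repetition, each one with an
  explicit repetition-free list of the tuples of its relation; the order is arbitrary.\<close>

definition encodes_cstr :: "bool cstr \<Rightarrow> tree \<Rightarrow> bool" where
  "encodes_cstr c t \<longleftrightarrow> (\<exists>ts. distinct ts \<and> set ts = snd (fst c) \<and>
     t = Pair (enc_list (enc_list enc_bool) ts) (enc_list enc_unary (snd c)))"

definition encodes_instance :: "nat \<Rightarrow> bool cstr set \<Rightarrow> tree \<Rightarrow> bool" where
  "encodes_instance n C t \<longleftrightarrow> (\<exists>cs us. distinct cs \<and> set cs = C \<and>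
     list_all2 encodes_cstr cs us \<and> t = Pair (enc_unary n) (enc_list id us))"

text \<open>A polynomial in \<open>n\<close> variables is a list of its nonzero terms, in arbitrary order; a term
  is a nonzero rational coefficient with the vector of the \<open>n\<close> exponents.\<close>

type_synonym term_list = "(rat \<times> nat list) list"

definition valid_terms :: "nat \<Rightarrow> term_list \<Rightarrow> bool" where
  "valid_terms n ts \<longleftrightarrow>
     distinct (map snd ts) \<and> (\<forall>(c, e) \<in> set ts. c \<noteq> 0 \<and> length e = n)"

definition poly_of_terms :: "term_list \<Rightarrow> mpoly" where
  "poly_of_terms ts =
     (\<Sum>(c, e) \<leftarrow> ts. Poly_Mapping.single (Poly_Mapping.nth e) (of_rat c))"

definition enc_terms :: "term_list \<Rightarrow> tree" where
  "enc_terms = enc_list (\<lambda>(c, e). Pair (enc_rat c) (enc_list enc_unary e))"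

definition encodes_polys :: "nat \<Rightarrow> mpoly set \<Rightarrow> tree \<Rightarrow> bool" where
  "encodes_polys n S t \<longleftrightarrow> (\<exists>ps. (\<forall>ts \<in> set ps. valid_terms n ts) \<and>
     distinct (map poly_of_terms ps) \<and> set (map poly_of_terms ps) = S \<and>
     t = enc_list enc_terms ps)"


section \<open>Computing truncated reduced Groebner bases\<close>

text \<open>The time bound \<open>T\<close> may depend on the number \<open>n\<close> of variables and the size of the encoded
  instance. For a finite language that size is itself polynomial in \<open>n\<close>; for an infinite language
  it is not bounded by any function of \<open>n\<close>, and running times are measured in it instead. A bound
  \<open>n\<close> to the power \<open>O(d)\<close> for fixed \<open>d\<close> is written \<open>max 2 n ^ (c * max 1 d)\<close> with \<open>c\<close> independent
  of \<open>d\<close>: the maxima only matter in the degenerate cases \<open>n \<le> 1\<close> and \<open>d = 0\<close>, where the literal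
  bound would be 0 or 1 steps.\<close>

definition computes_truncated_basis ::
    "program \<Rightarrow> bool rel set \<Rightarrow> nat \<Rightarrow> (nat \<Rightarrow> nat \<Rightarrow> nat) \<Rightarrow> bool" where
  "computes_truncated_basis P \<Gamma> d T \<longleftrightarrow>
     (\<forall>n C input. csp_instance \<Gamma> n C \<and> encodes_instance n C input \<longrightarrow>
        (\<exists>G output k.
           reduced_groebner_basis n (combinatorial_ideal n (Sol n C)) G \<and>
           encodes_polys n (truncation n d G) output \<and>
           computes_in P input output k \<and>
           k + tree_size output \<le> T n (tree_size input)))"

end

theory Submission
  imports Defs
begin

text \<open>The set \<open>V\<close> of solutions is an affine subspace of the Boolean cube. In the variables
  \<open>y\<^sub>i = 1 - 2 x\<^sub>i\<close> every squarefree monomial restricts to a character of \<open>V\<close> up to sign: two of them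
  are equal up to sign on \<open>V\<close> if the sum of their parities is constant on \<open>V\<close>, and orthogonal
  otherwise. Since the substitution is triangular, leading monomials are the same in both systems
  of variables, so the standard monomials are the least elements of the classes of equal
  characters. If \<open>S\<close> is a minimal nonstandard set and \<open>T\<close> the least element of its class, the
  element of the reduced basis with leading monomial \<open>x\<^sup>S\<close> is a multiple of \<open>y\<^sup>S \<minusplus> y\<^sup>T\<close>; the others
  are \<open>x\<^sub>i\<^sup>2 - x\<^sub>i\<close> for the standard \<open>x\<^sub>i\<close>. Both the comparison of two monomials and the coefficients
  are thus computed directly, without linear algebra over the rationals, from a list of points
  that spans \<open>V\<close> affinely; such a list is maintained while the constraints are added one by one.\<close>

text \<open>The obstacle is the cost model: elimination over the rationals would need exact
  arithmetic, with control of the size of numbers, in a first-order language of trees. Here each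
  nonzero coefficient is plus or minus a power of 1/2, fixed by two inclusions, a difference of
  cardinalities and a sign, so it can be written down bit by bit. Reducedness comes for free because
  standardness passes to subsets: toggling i in a smaller partner of S gives a smaller partner of S
  with i added. So every monomial of y^S and y^T other than x^S is standard. That the order is
  graded enters twice. The least element of the class of a set of size at most d has size at most d,
  so only those sets are compared; and an element belongs to the truncation exactly if its leading
  monomial has degree at most d. The list of points is never thinned out to an affine basis. Each
  constraint adds at most as many points as its relation has tuples, so the length stays within a
  multiple of the input size. Empty V is a case apart: all sets match, although 1 lies in the
  ideal.\<close>

abbreviation (input) "lookup \<equiv> Poly_Mapping.lookup"
abbreviation (input) "keys \<equiv> Poly_Mapping.keys"

section \<open>Parities on affine subspaces of the Boolean cube\<close>

text \<open>Coordinatewise addition modulo 2, which is what a minority operation is on the Boolean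
  domain. The nonempty sets of vectors of one length that are closed under it are the affine
  subspaces over GF(2).\<close>

fun xor3 :: "bool list \<Rightarrow> bool list \<Rightarrow> bool list \<Rightarrow> bool list" where
  "xor3 (a # u) (b # v) (c # w) = (a \<noteq> (b \<noteq> c)) # xor3 u v w"
| "xor3 _ _ _ = []"

lemma length_xor3 [simp]:
  "length v = length u \<Longrightarrow> length w = length u \<Longrightarrow> length (xor3 u v w) = length u"
  by (induction u v w rule: xor3.induct) auto

lemma nth_xor3:
  "length v = length u \<Longrightarrow> length w = length u \<Longrightarrow> i < length u \<Longrightarrow>
    xor3 u v w ! i = (u ! i \<noteq> (v ! i \<noteq> w ! i))"
  by (induction u v w arbitrary: i rule: xor3.induct) (auto simp: nth_Cons split: nat.splits)

text \<open>The inner product modulo 2 of the indicator list \<open>S\<close> with \<open>v\<close>,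
  that is, the linear form whose sign is the character of \<open>S\<close>.\<close>

fun parity :: "bool list \<Rightarrow> bool list \<Rightarrow> bool" where
  "parity (s # S) (a # v) = ((s \<and> a) \<noteq> parity S v)"
| "parity _ _ = False"

lemma parity_xor3:
  "length v = length u \<Longrightarrow> length w = length u \<Longrightarrow> length S = length u \<Longrightarrow>
    parity S (xor3 u v w) = (parity S u \<noteq> (parity S v \<noteq> parity S w))"
  by (induction u v w arbitrary: S rule: xor3.induct) (auto simp: length_Suc_conv)

lemma parity_update:
  "i < length S \<Longrightarrow> length p = length S \<Longrightarrow>
    parity (S[i := b]) p = (parity S p \<noteq> ((S ! i \<noteq> b) \<and> p ! i))"
proof (induction S p arbitrary: i rule: parity.induct)
  case (1 s S a v)
  then show ?case by (cases i) auto
qed auto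

section \<open>Affine spans with respect to a ternary operation\<close>

inductive_set affine_span :: "('a \<Rightarrow> 'a \<Rightarrow> 'a \<Rightarrow> 'a) \<Rightarrow> 'a set \<Rightarrow> 'a set"
  for f :: "'a \<Rightarrow> 'a \<Rightarrow> 'a \<Rightarrow> 'a" and A :: "'a set" where
  base: "p \<in> A \<Longrightarrow> p \<in> affine_span f A"
| closed: "p \<in> affine_span f A \<Longrightarrow> q \<in> affine_span f A \<Longrightarrow> r \<in> affine_span f A \<Longrightarrow>
    f p q r \<in> affine_span f A"

lemma affine_span_invariant:
  assumes "p \<in> affine_span f A" "\<And>q. q \<in> A \<Longrightarrow> Q q"
    and "\<And>q r s. Q q \<Longrightarrow> Q r \<Longrightarrow> Q s \<Longrightarrow> Q (f q r s)"
  shows "Q p"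
  using assms(1) by induction (use assms(2-) in auto)

text \<open>The homomorphism property is demanded on the span only, because maps such as
  \<open>correct\<close> and \<open>drop_pair\<close> respect the operation only on points whose
  components have the expected lengths.\<close>

lemma affine_span_image:
  assumes hom: "\<And>p q r. p \<in> affine_span f A \<Longrightarrow> q \<in> affine_span f A \<Longrightarrow> r \<in> affine_span f A \<Longrightarrow>
    h (f p q r) = g (h p) (h q) (h r)"
  shows "affine_span g (h ` A) = h ` affine_span f A"
proof (intro equalityI subsetI)
  fix x assume "x \<in> affine_span g (h ` A)"
  then show "x \<in> h ` affine_span f A"
  proof induction
    case (base x)
    then show ?case by (auto intro: affine_span.base)
  next
    case (closed p q r)
    then obtain p' q' r' where *: "p' \<in> affine_span f A" "q' \<in> affine_span f A" "r' \<in> affine_span f A"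
      "p = h p'" "q = h q'" "r = h r'" by auto
    then have "g p q r = h (f p' q' r')" by (simp add: hom)
    then show ?case using * by (simp add: affine_span.closed)
  qed
next
  fix x assume "x \<in> h ` affine_span f A"
  then obtain p where "p \<in> affine_span f A" "x = h p" by auto
  moreover have "p \<in> affine_span f A \<Longrightarrow> h p \<in> affine_span g (h ` A)" for p
  proof (induction rule: affine_span.induct)
    case (closed p q r)
    then show ?case using hom by (metis affine_span.closed)
  qed (auto intro: affine_span.base)
  ultimately show "x \<in> affine_span g (h ` A)" by simp
qed

lemma affine_span_vecs:
  assumes "\<forall>p \<in> A. length p = n" "p \<in> affine_span xor3 A"
  shows "length p = n"
  by (rule affine_span_invariant[OF assms(2)]) (use assms(1) in auto)

section \<open>Equality of characters up to sign, and their orthogonality\<close>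

definition matches :: "bool list set \<Rightarrow> bool list \<Rightarrow> bool list \<Rightarrow> bool" where
  "matches V S T \<longleftrightarrow> (\<exists>c. \<forall>p \<in> V. (parity S p \<noteq> parity T p) = c)"

lemma matches_refl: "matches V S S"
  by (auto simp: matches_def)

lemma matches_sym: "matches V S T \<Longrightarrow> matches V T S"
  unfolding matches_def by (metis (full_types))

lemma matches_trans: "matches V S T \<Longrightarrow> matches V T U \<Longrightarrow> matches V S U"
  unfolding matches_def by (metis (full_types))

lemma parity_const_affine_span:
  assumes "\<forall>p \<in> A. length p = n" "length S = n" "length T = n"
    and "\<forall>p \<in> A. (parity S p \<noteq> parity T p) = c" and "p \<in> affine_span xor3 A"
  shows "(parity S p \<noteq> parity T p) = c"
proof -
  have "length p = n \<and> (parity S p \<noteq> parity T p) = c"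
    by (rule affine_span_invariant[OF assms(5)]) (use assms(1-4) in \<open>auto simp: parity_xor3\<close>)
  then show ?thesis by simp
qed

text \<open>A constant sum of parities passes from the generators to the span because c + c + c = c
  modulo 2. Characters on the whole solution set can therefore be compared on the generators alone,
  which is the test that the program performs.\<close>

lemma matches_affine_span:
  assumes "\<forall>p \<in> A. length p = n" "length S = n" "length T = n"
  shows "matches (affine_span xor3 A) S T \<longleftrightarrow> matches A S T"
  using parity_const_affine_span[OF assms] unfolding matches_def
  by (metis affine_span.base)

definition affine_set :: "nat \<Rightarrow> bool list set \<Rightarrow> bool" where
  "affine_set n V \<longleftrightarrow> (\<forall>p \<in> V. length p = n) \<and>
     (\<forall>p \<in> V. \<forall>q \<in> V. \<forall>r \<in> V. xor3 p q r \<in> V)"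

text \<open>The value at \<open>p\<close> of the monomial y^S, where y_i = 1 - 2 x_i turns the bits
  0 and 1 into the signs 1 and -1.\<close>

definition character :: "bool list \<Rightarrow> bool list \<Rightarrow> real" where
  "character S p = (if parity S p then -1 else 1)"

definition vecs :: "nat \<Rightarrow> bool list set" where
  "vecs n = {v. length v = n}"

lemma finite_vecs [simp]: "finite (vecs n)"
  using finite_lists_length_eq[of "UNIV :: bool set" n] by (simp add: vecs_def)

lemma in_vecs [simp]: "v \<in> vecs n \<longleftrightarrow> length v = n"
  by (simp add: vecs_def)

lemma finite_affine_set: "affine_set n V \<Longrightarrow> finite V"
  by (rule finite_subset[OF _ finite_vecs[of n]]) (auto simp: affine_set_def)

text \<open>Translation by \<open>p + q\<close> is an involution of \<open>V\<close> that changes the sign of the product.\<close>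

lemma character_orthogonal:
  assumes "affine_set n V" "length S = n" "length T = n" "\<not> matches V S T"
  shows "(\<Sum>a\<in>V. character S a * character T a) = 0"
proof -
  from assms(4) obtain p q where pq: "p \<in> V" "q \<in> V"
      "(parity S p \<noteq> parity T p) \<noteq> (parity S q \<noteq> parity T q)"
    unfolding matches_def by (metis (full_types))
  have len: "length a = n" if "a \<in> V" for a using that assms(1) by (simp add: affine_set_def)
  have inv: "xor3 (xor3 a p q) p q = a" if "a \<in> V" for a
    using that pq by (intro nth_equalityI) (auto simp: len nth_xor3)
  have bij: "bij_betw (\<lambda>a. xor3 a p q) V V"
    by (rule bij_betw_byWitness[where f' = "\<lambda>a. xor3 a p q"])
      (use inv pq assms(1) in \<open>auto simp: affine_set_def\<close>)
  have "(\<Sum>a\<in>V. character S a * character T a) =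
      (\<Sum>a\<in>V. character S (xor3 a p q) * character T (xor3 a p q))"
    by (rule sum.reindex_bij_betw[OF bij, symmetric])
  also have "\<dots> = (\<Sum>a\<in>V. - (character S a * character T a))"
    using pq assms(2,3) by (intro sum.cong) (auto simp: character_def parity_xor3 len)
  finally show ?thesis by (simp add: sum_negf)
qed

section \<open>Squarefree monomials\<close>

fun weight :: "bool list \<Rightarrow> nat" where
  "weight [] = 0"
| "weight (b # S) = of_bool b + weight S"

definition sub :: "bool list \<Rightarrow> bool list \<Rightarrow> bool" where
  "sub = list_all2 (\<longrightarrow>)"

lemma sub_simps [simp]:
  "sub [] []" "sub (a # u) (b # v) \<longleftrightarrow> (a \<longrightarrow> b) \<and> sub u v" "\<not> sub [] (b # v)" "\<not> sub (a # u) []"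
  by (auto simp: sub_def)

lemma sub_conv_nth: "sub u v \<longleftrightarrow> length u = length v \<and> (\<forall>i<length v. u ! i \<longrightarrow> v ! i)"
  by (simp add: sub_def list_all2_conv_all_nth) (auto)

lemma sub_refl [simp]: "sub u u"
  by (simp add: sub_conv_nth)

lemma sub_length: "sub u v \<Longrightarrow> length u = length v"
  by (simp add: sub_conv_nth)

lemma sub_trans: "sub u v \<Longrightarrow> sub v w \<Longrightarrow> sub u w"
  by (auto simp: sub_conv_nth)

lemma sub_weight: "sub u v \<Longrightarrow> weight u \<le> weight v \<and> (weight u = weight v \<longrightarrow> u = v)"
  unfolding sub_def by (induction rule: list_all2_induct) auto

lemma weight_update:
  "i < length S \<Longrightarrow> weight (S[i := b]) + of_bool (S ! i) = weight S + of_bool b"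
proof (induction S arbitrary: i)
  case (Cons a S)
  show ?case
  proof (cases i)
    case (Suc j)
    then show ?thesis using Cons.IH[of j] Cons.prems by simp
  qed simp
qed simp

definition sqfree_monom :: "bool list \<Rightarrow> monom" where
  "sqfree_monom S = Poly_Mapping.nth (map of_bool S)"

lemma lookup_sqfree_monom:
  "lookup (sqfree_monom S) i = of_bool (i < length S \<and> S ! i)"
  by (simp add: sqfree_monom_def nth_default_def)

lemma keys_sqfree_monom: "keys (sqfree_monom S) = {i. i < length S \<and> S ! i}"
  by (auto simp: in_keys_iff lookup_sqfree_monom)

lemma sqfree_monom_inj:
  assumes "sqfree_monom S = sqfree_monom T" "length S = length T"
  shows "S = T"
proof (rule nth_equalityI)
  fix i assume "i < length S"
  then show "S ! i = T ! i"
    using arg_cong[OF assms(1), of "\<lambda>m. lookup m i"] assms(2)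
    by (auto simp: lookup_sqfree_monom of_bool_def split: if_splits)
qed (fact assms(2))

lemma weight_eq_card: "weight S = card {i. i < length S \<and> S ! i}"
proof (induction S)
  case (Cons b S)
  have "{i. i < length (b # S) \<and> (b # S) ! i} = (if b then {0} else {}) \<union> Suc ` {i. i < length S \<and> S ! i}"
    (is "?l = ?r")
  proof (rule set_eqI)
    show "i \<in> ?l \<longleftrightarrow> i \<in> ?r" for i by (cases i) auto
  qed
  then show ?case using Cons by (simp add: card_image)
qed simp

lemma weight_1_nth: "weight u = 1 \<Longrightarrow> \<exists>i < length u. u ! i"
  unfolding weight_eq_card by (metis (mono_tags, lifting) card.empty empty_Collect_eq zero_neq_one)

lemma monom_degree_sqfree [simp]: "monom_degree (sqfree_monom S) = weight S"
  by (simp add: monom_degree_def keys_sqfree_monom lookup_sqfree_monom weight_eq_card)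

subsection \<open>The graded lexicographic order\<close>

text \<open>The library orders finitely supported functions by the first index at which they differ,
  so transitivity, totality and compatibility with addition are inherited from the type
  class.\<close>

lemma lex_less_conv: "lex_less m m' \<longleftrightarrow> m < m'"
  by (simp add: lex_less_def less_poly_mapping.rep_eq less_fun_def)

lemma grlex_less_conv:
  "grlex_less m m' \<longleftrightarrow> monom_degree m < monom_degree m' \<or> monom_degree m = monom_degree m' \<and> m < m'"
  by (simp add: grlex_less_def lex_less_conv)

lemma grlex_less_irrefl [simp]: "\<not> grlex_less m m"
  by (simp add: grlex_less_conv)

lemma grlex_less_trans: "grlex_less a b \<Longrightarrow> grlex_less b c \<Longrightarrow> grlex_less a c"
  by (auto simp: grlex_less_conv)

lemma grlex_less_total: "grlex_less a b \<or> a = b \<or> grlex_less b a"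
  by (auto simp: grlex_less_conv)

lemma grlex_less_asym: "grlex_less a b \<Longrightarrow> \<not> grlex_less b a"
  by (auto simp: grlex_less_conv)

abbreviation grlex_less_sqfree :: "bool list \<Rightarrow> bool list \<Rightarrow> bool"  (infix "\<prec>" 50) where
  "S \<prec> T \<equiv> grlex_less (sqfree_monom S) (sqfree_monom T)"

lemma monom_degree_superset:
  assumes "finite A" "keys m \<subseteq> A"
  shows "monom_degree m = (\<Sum>i\<in>A. lookup m i)"
  unfolding monom_degree_def using assms by (intro sum.mono_neutral_left) (auto simp: in_keys_iff)

lemma monom_degree_add: "monom_degree (m + m') = monom_degree m + monom_degree m'"
proof -
  let ?A = "keys m \<union> keys m'"
  have "keys (m + m') \<subseteq> ?A" by (rule keys_add)
  then show ?thesis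
    by (simp add: monom_degree_superset[of ?A] lookup_add sum.distrib)
qed

lemma keys_empty_iff: "keys p = {} \<longleftrightarrow> p = 0"
proof
  assume *: "keys p = {}"
  show "p = 0"
  proof (rule poly_mapping_eqI)
    fix k
    have "k \<notin> keys p" using * by simp
    then show "lookup p k = lookup 0 k" by (simp add: in_keys_iff)
  qed
qed simp

lemma monom_degree_eq_0: "monom_degree m = 0 \<longleftrightarrow> m = 0"
proof -
  have "monom_degree m = 0 \<longleftrightarrow> keys m = {}"
    by (simp only: monom_degree_def sum_eq_0_iff[OF finite_keys]) blast
  then show ?thesis by (simp add: keys_empty_iff)
qed

lemma grlex_less_add: "grlex_less a b \<Longrightarrow> grlex_less (a + k) (b + k)"
  by (auto simp: grlex_less_conv monom_degree_add)

lemma monom_dvd_conv: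
  "monom_dvd k m \<longleftrightarrow> (\<forall>i. lookup k i \<le> lookup m i)"
proof
  assume *: "\<forall>i. lookup k i \<le> lookup m i"
  have "m = k + (m - k)"
    by (rule poly_mapping_eqI) (use * in \<open>simp add: lookup_add lookup_minus\<close>)
  then show "monom_dvd k m" unfolding monom_dvd_def ..
qed (auto simp: monom_dvd_def lookup_add)

lemma monom_dvd_grlex: "monom_dvd k m \<Longrightarrow> k = m \<or> grlex_less k m"
  by (auto simp: monom_dvd_def grlex_less_conv monom_degree_add monom_degree_eq_0)

lemma monom_dvd_sqfree: "length u = length v \<Longrightarrow> monom_dvd (sqfree_monom u) (sqfree_monom v) \<longleftrightarrow> sub u v"
  by (auto simp: monom_dvd_conv lookup_sqfree_monom sub_conv_nth)

lemma sub_grlex: "sub u v \<Longrightarrow> u = v \<or> u \<prec> v"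
  by (metis monom_dvd_grlex monom_dvd_sqfree sqfree_monom_inj sub_length)

lemma grlex_max_exists:
  assumes "finite A" "A \<noteq> {}"
  shows "\<exists>m \<in> A. \<forall>m' \<in> A. m' \<noteq> m \<longrightarrow> grlex_less m' m"
  using assms
proof (induction A rule: finite_ne_induct)
  case (insert x F)
  then obtain m where m: "m \<in> F" "\<forall>m' \<in> F. m' \<noteq> m \<longrightarrow> grlex_less m' m" by auto
  show ?case
  proof (cases "grlex_less x m")
    case True
    then show ?thesis using m by auto
  next
    case False
    then have "grlex_less m x" using grlex_less_total m(1) insert.hyps by metis
    then show ?thesis using m grlex_less_trans by (metis insert_iff)
  qed
qed simp

lemma lead_monom_eqI:
  assumes "m \<in> keys p" "\<And>m'. m' \<in> keys p \<Longrightarrow> m' \<noteq> m \<Longrightarrow> grlex_less m' m"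
  shows "lead_monom p = m"
  unfolding lead_monom_def
proof (rule the_equality)
  fix m' assume *: "m' \<in> keys p \<and>
    (\<forall>m'' \<in> keys p. m'' \<noteq> m' \<longrightarrow> grlex_less m'' m')"
  show "m' = m"
  proof (rule ccontr)
    assume "m' \<noteq> m"
    then show False using * assms grlex_less_asym by metis
  qed
qed (use assms in auto)

lemma lead_monom_nonzero:
  assumes "p \<noteq> 0"
  shows "lead_monom p \<in> keys p"
    and "m' \<in> keys p \<Longrightarrow> m' \<noteq> lead_monom p \<Longrightarrow> grlex_less m' (lead_monom p)"
proof -
  have "keys p \<noteq> {}"
    using assms by (simp add: keys_empty_iff)
  then obtain m where "m \<in> keys p" "\<forall>m'\<in>keys p. m' \<noteq> m \<longrightarrow> grlex_less m' m"
    using grlex_max_exists[of "keys p"] by auto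
  moreover from this have "lead_monom p = m" by (intro lead_monom_eqI) auto
  ultimately show "lead_monom p \<in> keys p"
    and "m' \<in> keys p \<Longrightarrow> m' \<noteq> lead_monom p \<Longrightarrow> grlex_less m' (lead_monom p)" by auto
qed

section \<open>Standard monomials\<close>

text \<open>For nonempty \<open>V\<close> these sets are the standard monomials of the ideal in the
  usual sense: \<open>lead_not_standard\<close> excludes them as leading monomials, and the minimal
  sets outside are leading monomials of the basis. For empty \<open>V\<close> all sets match, so the
  empty set is standard here although 1 lies in the ideal.\<close>

definition standard :: "bool list set \<Rightarrow> nat \<Rightarrow> bool list \<Rightarrow> bool" where
  "standard V n S \<longleftrightarrow> length S = n \<and> (\<forall>T. length T = n \<and> matches V S T \<longrightarrow>
     T = S \<or> S \<prec> T)"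

text \<open>Toggling \<open>i\<close> in a smaller partner \<open>T\<close> of \<open>S\<close>
  gives a partner of \<open>S\<close> with \<open>i\<close> added. If \<open>i\<close> was in
  \<open>T\<close>, the partner loses degree while \<open>S\<close> gains; if not, both monomials
  are multiplied by x_i, which the order respects. Either way the enlarged set has a smaller partner
  as well.\<close>

lemma standard_remove:
  assumes V: "\<forall>p \<in> V. length p = n" and i: "i < n" "\<not> S ! i" "length S = n"
    and std: "standard V n (S[i := True])"
  shows "standard V n S"
proof (rule ccontr)
  assume "\<not> standard V n S"
  then obtain T where T: "length T = n" "matches V S T" "T \<noteq> S"
      "\<not> S \<prec> T"
    using i unfolding standard_def by auto
  then have less: "T \<prec> S"
    using grlex_less_total sqfree_monom_inj i by metis
  let ?S = "S[i := True]" and ?T = "T[i := \<not> T ! i]"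
  have par: "(parity ?S p \<noteq> parity ?T p) = (parity S p \<noteq> parity T p)" if "p \<in> V" for p
    using that V i T by (simp add: parity_update) blast
  have "matches V ?S ?T"
    using T(2) par unfolding matches_def by metis
  moreover have "?T \<noteq> ?S"
    using T(3) less i T(1)
    by (metis (full_types) grlex_less_irrefl list_update_id list_update_overwrite nth_list_update_eq)
  ultimately have less': "?S \<prec> ?T"
    using std T(1) unfolding standard_def by (metis length_list_update)
  have "?T \<prec> ?S"
  proof (cases "T ! i")
    case True
    have "weight ?T + 1 = weight T" using weight_update[of i T False] True i T(1) by simp
    moreover have "weight ?S = weight S + 1" using weight_update[of i S True] i by simp
    moreover have "weight T \<le> weight S" using less by (auto simp: grlex_less_conv)
    ultimately show ?thesis by (simp add: grlex_less_conv)
  next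
    case False
    have "sqfree_monom (U[i := True]) = sqfree_monom U + Poly_Mapping.single i 1"
      if "\<not> U ! i" "length U = n" for U
      by (rule poly_mapping_eqI)
        (use that i in \<open>auto simp: lookup_add lookup_sqfree_monom lookup_single when_def nth_list_update\<close>)
    then show ?thesis using False i T(1) less by (simp add: grlex_less_add)
  qed
  then show False using less' grlex_less_asym by blast
qed

lemma sub_step:
  assumes "sub U S" "U \<noteq> S"
  obtains i where "i < length S" "S ! i" "sub U (S[i := False])"
proof -
  have "length U = length S" using assms(1) by (rule sub_length)
  with assms(2) obtain i where i: "i < length S" "U ! i \<noteq> S ! i"
    by (auto simp: list_eq_iff_nth_eq)
  with assms have "S ! i" "sub U (S[i := False])"
    by (auto simp: sub_conv_nth nth_list_update)
  with i that show ?thesis by blast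
qed

lemma weight_remove: "i < length S \<Longrightarrow> S ! i \<Longrightarrow> Suc (weight (S[i := False])) = weight S"
  using weight_update[of i S False] by simp

lemma sub_remove: "i < length S \<Longrightarrow> sub (S[i := False]) S"
  by (auto simp: sub_conv_nth nth_list_update)

text \<open>The standard sets form a simplicial complex: the elements outside \<open>U\<close> are
  removed one at a time.\<close>

lemma standard_sub:
  assumes "\<forall>p \<in> V. length p = n"
  shows "sub U S \<Longrightarrow> standard V n S \<Longrightarrow> standard V n U"
proof (induction "weight S" arbitrary: S rule: less_induct)
  case less
  show ?case
  proof (cases "U = S")
    case False
    then obtain i where i: "i < length S" "S ! i" "sub U (S[i := False])"
      using sub_step less.prems by blast
    have "length S = n" using less.prems by (simp add: standard_def)
    then have "standard V n (S[i := False])"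
      using standard_remove[OF assms, of i "S[i := False]"] i less.prems list_update_id[of S i] by simp
    then show ?thesis using less.hyps[of "S[i := False]"] weight_remove[of i S] i by simp
  qed (use less in simp)
qed

text \<open>Only deletions of single elements are inspected, which makes a test with at most n
  deletions possible; \<open>minimal_nonstandard_sub\<close> extends standardness to all proper
  subsets.\<close>

definition minimal_nonstandard :: "bool list set \<Rightarrow> nat \<Rightarrow> bool list \<Rightarrow> bool" where
  "minimal_nonstandard V n S \<longleftrightarrow> length S = n \<and> \<not> standard V n S \<and>
     (\<forall>i<n. S ! i \<longrightarrow> standard V n (S[i := False]))"

lemma minimal_nonstandard_exists:
  "length S = n \<Longrightarrow> \<not> standard V n S \<Longrightarrow> \<exists>R. sub R S \<and> minimal_nonstandard V n R"
proof (induction "weight S" arbitrary: S rule: less_induct)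
  case less
  show ?case
  proof (cases "minimal_nonstandard V n S")
    case False
    then obtain i where i: "i < n" "S ! i" "\<not> standard V n (S[i := False])"
      using less.prems by (auto simp: minimal_nonstandard_def)
    then obtain R where "sub R (S[i := False])" "minimal_nonstandard V n R"
      using less.hyps[of "S[i := False]"] weight_remove[of i S] less.prems by auto
    then show ?thesis using sub_trans sub_remove i less.prems by metis
  qed (use sub_refl in blast)
qed

lemma minimal_nonstandard_sub:
  assumes "\<forall>p \<in> V. length p = n" "minimal_nonstandard V n S" "sub U S" "U \<noteq> S"
  shows "standard V n U"
  using sub_step[OF assms(3,4)] standard_sub[OF assms(1)] assms(2)
  unfolding minimal_nonstandard_def by metis

definition representative :: "bool list set \<Rightarrow> nat \<Rightarrow> bool list \<Rightarrow> bool list \<Rightarrow> bool" where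
  "representative V n S T \<longleftrightarrow> matches V S T \<and> standard V n T"

lemma grlex_min_exists:
  assumes "finite A" "A \<noteq> {}"
  shows "\<exists>m \<in> A. \<forall>m' \<in> A. m' \<noteq> m \<longrightarrow> grlex_less m m'"
  using assms
proof (induction A rule: finite_ne_induct)
  case (insert x F)
  then obtain m where m: "m \<in> F" "\<forall>m' \<in> F. m' \<noteq> m \<longrightarrow> grlex_less m m'" by auto
  show ?case
  proof (cases "grlex_less m x")
    case True
    then show ?thesis using m by auto
  next
    case False
    then have "grlex_less x m" using grlex_less_total m(1) insert.hyps by metis
    then show ?thesis using m grlex_less_trans by (metis insert_iff)
  qed
qed simp

lemma representative_exists:
  assumes "length S = n"
  shows "\<exists>T. representative V n S T"
proof -
  let ?A = "{T. length T = n \<and> matches V S T}"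
  have "finite ?A" by (rule finite_subset[OF _ finite_vecs[of n]]) auto
  moreover have "?A \<noteq> {}" using assms matches_refl by blast
  ultimately obtain T where T: "T \<in> ?A"
      "\<And>U. U \<in> ?A \<Longrightarrow> sqfree_monom U \<noteq> sqfree_monom T \<Longrightarrow>
        T \<prec> U"
    using grlex_min_exists[of "sqfree_monom ` ?A"] by auto
  have "standard V n T"
    unfolding standard_def
  proof (intro conjI allI impI)
    fix U assume U: "length U = n \<and> matches V T U"
    then have "U \<in> ?A" using T(1) matches_trans by blast
    then show "U = T \<or> T \<prec> U"
      using T sqfree_monom_inj by fastforce
  qed (use T in simp)
  then show ?thesis using T by (auto simp: representative_def)
qed

lemma representative_unique:
  "representative V n S T \<Longrightarrow> representative V n S T' \<Longrightarrow> T = T'"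
  unfolding representative_def standard_def
  by (metis grlex_less_asym matches_sym matches_trans)

lemma representative_less:
  assumes "representative V n S T" "length S = n" "\<not> standard V n S"
  shows "T \<prec> S"
  using assms unfolding representative_def by (metis matches_sym standard_def)

section \<open>The basis\<close>

text \<open>The coefficients are rational numbers mapped into the reals because the output format
  lists rational coefficients.\<close>

definition sqfree_poly :: "nat \<Rightarrow> (bool list \<Rightarrow> rat) \<Rightarrow> mpoly" where
  "sqfree_poly n w = (\<Sum>u\<in>vecs n. Poly_Mapping.single (sqfree_monom u) (of_rat (w u)))"

lemma lookup_sqfree_poly:
  "lookup (sqfree_poly n w) m =
    (\<Sum>u\<in>vecs n. if sqfree_monom u = m then of_rat (w u) else 0)"
  by (simp add: sqfree_poly_def lookup_sum lookup_single when_def)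

lemma lookup_sqfree_poly_monom:
  assumes "length u = n"
  shows "lookup (sqfree_poly n w) (sqfree_monom u) = of_rat (w u)"
proof -
  have "(\<Sum>v\<in>vecs n. if sqfree_monom v = sqfree_monom u then of_rat (w v) else 0) =
      (\<Sum>v\<in>vecs n. if v = u then (of_rat (w v) :: real) else 0)"
    using assms by (intro sum.cong) (auto dest: sqfree_monom_inj)
  then show ?thesis using assms by (simp add: lookup_sqfree_poly)
qed

lemma keys_sqfree_poly:
  "keys (sqfree_poly n w) = sqfree_monom ` {u. length u = n \<and> w u \<noteq> 0}"
proof -
  have "\<exists>u. length u = n \<and> m = sqfree_monom u" if "m \<in> keys (sqfree_poly n w)" for m
  proof (rule ccontr)
    assume "\<not> ?thesis"
    then have "lookup (sqfree_poly n w) m = 0"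
      unfolding lookup_sqfree_poly by (intro sum.neutral) auto
    then show False using that by (simp add: in_keys_iff)
  qed
  then show ?thesis
    by (fastforce simp: in_keys_iff lookup_sqfree_poly_monom)
qed

lemma sqfree_poly_in_polys: "sqfree_poly n w \<in> polys n"
  by (auto simp: polys_def keys_sqfree_poly keys_sqfree_monom)

section \<open>Monomials and squarefree polynomials as functions on the cube\<close>

definition support :: "nat \<Rightarrow> monom \<Rightarrow> bool list" where
  "support n m = map (\<lambda>i. lookup m i \<noteq> 0) [0..<n]"

lemma length_support [simp]: "length (support n m) = n"
  by (simp add: support_def)

lemma support_sqfree: "length u = n \<Longrightarrow> support n (sqfree_monom u) = u"
  by (rule nth_equalityI) (auto simp: support_def lookup_sqfree_monom)

lemma sqfree_monom_support_dvd: "monom_dvd (sqfree_monom (support n m)) m"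
  by (auto simp: monom_dvd_conv lookup_sqfree_monom support_def of_bool_def)

text \<open>On the cube all positive powers of a variable coincide, so a monomial depends on its
  support only.\<close>

lemma eval_monom_cube:
  assumes "keys m \<subseteq> {..<n}" "length a = n"
  shows "eval_monom (\<lambda>i. of_bool (a ! i)) m = of_bool (sub (support n m) a)"
proof (cases "sub (support n m) a")
  case True
  have "of_bool (a ! i) ^ lookup m i = (1 :: real)" if "i \<in> keys m" for i
  proof -
    have "i < n" using that assms by auto
    then have "a ! i" using True that assms by (auto simp: sub_conv_nth support_def in_keys_iff)
    then show ?thesis by simp
  qed
  then show ?thesis using True by (simp add: eval_monom_def)
next
  case False
  then obtain i where "i < n" "\<not> a ! i" "lookup m i \<noteq> 0"
    using assms by (auto simp: sub_conv_nth support_def)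
  then have "eval_monom (\<lambda>i. of_bool (a ! i)) m = 0"
    unfolding eval_monom_def by (intro prod_zero) (auto simp: in_keys_iff zero_power intro!: bexI[of _ i])
  then show ?thesis using False by simp
qed

lemma eval_poly_superset:
  assumes "finite A" "keys p \<subseteq> A"
  shows "eval_poly a p = (\<Sum>m\<in>A. lookup p m * eval_monom a m)"
  unfolding eval_poly_def using assms by (intro sum.mono_neutral_left) (auto simp: in_keys_iff)

lemma eval_sqfree_poly:
  assumes "length a = n"
  shows "eval_poly (\<lambda>i. of_bool (a ! i)) (sqfree_poly n w) =
    (\<Sum>u\<in>vecs n. of_rat (w u) * of_bool (sub u a))"
proof -
  have inj: "inj_on sqfree_monom (vecs n)" by (auto intro!: inj_onI dest: sqfree_monom_inj)
  have "eval_poly (\<lambda>i. of_bool (a ! i)) (sqfree_poly n w) =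
      (\<Sum>m\<in>sqfree_monom ` vecs n. lookup (sqfree_poly n w) m *
        eval_monom (\<lambda>i. of_bool (a ! i)) m)"
    by (rule eval_poly_superset) (auto simp: keys_sqfree_poly)
  also have "\<dots> = (\<Sum>u\<in>vecs n. of_rat (w u) * of_bool (sub u a))"
    unfolding sum.reindex[OF inj] o_def
  proof (rule sum.cong)
    fix u assume "u \<in> vecs n"
    then have "length u = n" by simp
    moreover have "keys (sqfree_monom u) \<subseteq> {..<n}"
      using \<open>length u = n\<close> by (auto simp: keys_sqfree_monom)
    ultimately show "lookup (sqfree_poly n w) (sqfree_monom u) *
        eval_monom (\<lambda>i. of_bool (a ! i)) (sqfree_monom u) = of_rat (w u) * of_bool (sub u a)"
      using eval_monom_cube[of "sqfree_monom u" n a] assms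
      by (simp add: lookup_sqfree_poly_monom support_sqfree)
  qed simp
  finally show ?thesis .
qed

section \<open>Change of variables between x and y = 1 - 2 x\<close>

lemma finite_sub: "finite {u. sub u S}"
  by (rule finite_subset[OF _ finite_vecs[of "length S"]]) (auto simp: sub_conv_nth)

lemma sum_sub_Cons:
  "(\<Sum>u | sub u (t # T). h u) =
    (\<Sum>u | sub u T. h (False # u)) + (if t then \<Sum>u | sub u T. h (True # u) else (0 :: real))"
proof -
  have *: "{u. sub u (t # T)} =
      (#) False ` {u. sub u T} \<union> (if t then (#) True ` {u. sub u T} else {})" (is "?l = ?r")
  proof (rule set_eqI)
    show "u \<in> ?l \<longleftrightarrow> u \<in> ?r" for u by (cases u) auto
  qed
  show ?thesis
    unfolding * by (subst sum.union_disjoint) (auto simp: finite_sub sum.reindex)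
qed

lemma sub_Nil_iff: "{u. sub u []} = {[]}"
  by (auto simp: sub_conv_nth)

lemma character_Cons: "character (s # S) (a # p) = (if s \<and> a then -1 else 1) * character S p"
  by (simp add: character_def)

text \<open>The left-hand side multiplies out the product of the factors 1 - 2 x_i over
  \<open>S\<close>, one factor per induction step.\<close>

lemma character_expand:
  "length a = length S \<Longrightarrow>
    (\<Sum>u | sub u S. (-2) ^ weight u * of_bool (sub u a)) = character S a"
proof (induction S arbitrary: a)
  case (Cons t S)
  then obtain b a' where "a = b # a'" "length a' = length S" by (cases a) auto
  with Cons.IH[of a'] show ?case
    by (cases t; cases b) (simp_all add: sum_sub_Cons character_Cons mult.assoc sum_negf flip: sum_distrib_left)
qed (simp add: sub_Nil_iff character_def)

text \<open>The inverse substitution x_i = (1 - y_i) / 2. Both expansions involve subsets of the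
  given set only, hence divisors of the monomial; this is the triangularity that preserves leading
  monomials.\<close>

lemma monomial_expand:
  "length a = length S \<Longrightarrow>
    of_bool (sub S a) = (1 / 2) ^ weight S * (\<Sum>u | sub u S. (-1) ^ weight u * character u a)"
proof (induction S arbitrary: a)
  case (Cons t S)
  then obtain b a' where "a = b # a'" "length a' = length S" by (cases a) auto
  with Cons.IH[of a'] show ?case
    by (cases t; cases b) (simp_all add: sum_sub_Cons character_Cons sum_negf)
qed (simp add: sub_Nil_iff character_def)

text \<open>The coefficients of \<open>(-2)\<^sup>-\<^sup>|\<^sup>S\<^sup>|\<close> times the difference of \<open>\<Prod>\<^sub>i\<^sub>\<in>\<^sub>S (1 - 2 x\<^sub>i)\<close> and
  \<open>\<plusminus> \<Prod>\<^sub>i\<^sub>\<in>\<^sub>T (1 - 2 x\<^sub>i)\<close>.\<close>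

definition basis_coef :: "bool list \<Rightarrow> bool list \<Rightarrow> bool \<Rightarrow> bool list \<Rightarrow> rat" where
  "basis_coef S T c u = (-1/2) ^ weight S * (-2) ^ weight u *
     (of_bool (sub u S) - (if c then -1 else 1) * of_bool (sub u T))"

definition basis_poly :: "nat \<Rightarrow> bool list \<Rightarrow> bool list \<Rightarrow> bool \<Rightarrow> mpoly" where
  "basis_poly n S T c = sqfree_poly n (basis_coef S T c)"

definition square_poly :: "bool list \<Rightarrow> mpoly" where
  "square_poly u = Poly_Mapping.single (sqfree_monom u + sqfree_monom u) 1 - Poly_Mapping.single (sqfree_monom u) 1"

definition reduced_basis :: "nat \<Rightarrow> bool list set \<Rightarrow> mpoly set" where
  "reduced_basis n V = (if V = {} then {1} else
     {square_poly u | u. weight u = 1 \<and> standard V n u} \<union>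
     {basis_poly n S T c | S T c. minimal_nonstandard V n S \<and> representative V n S T \<and>
        (\<forall>p \<in> V. (parity S p \<noteq> parity T p) = c)})"

lemma reduced_basis_cases:
  assumes "g \<in> reduced_basis n V" "V \<noteq> {}"
  obtains u where "weight u = 1" "standard V n u" "g = square_poly u"
  | S T c where "minimal_nonstandard V n S" "representative V n S T"
    "\<forall>p \<in> V. (parity S p \<noteq> parity T p) = c" "g = basis_poly n S T c"
  using assms unfolding reduced_basis_def by (simp only: if_False) blast

text \<open>By \<open>character_expand\<close> the polynomial is, up to the factor (-2)^-|S|, the
  difference of one character and a signed other one; \<open>c\<close> is the sign that makes them
  equal at \<open>a\<close>.\<close>

lemma eval_basis_poly:
  assumes "length S = n" "length T = n" "length a = n" "(parity S a \<noteq> parity T a) = c"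
  shows "eval_poly (\<lambda>i. of_bool (a ! i)) (basis_poly n S T c) = 0"
proof -
  have *: "(\<Sum>u\<in>vecs n. of_bool (sub u U) * ((-2) ^ weight u * of_bool (sub u a))) = character U a"
    if "length U = n" for U
  proof -
    have "(\<Sum>u\<in>vecs n. of_bool (sub u U) * ((-2) ^ weight u * of_bool (sub u a))) =
        (\<Sum>u | sub u U. (-2) ^ weight u * (of_bool (sub u a) :: real))"
      by (rule sum.mono_neutral_cong_right) (use that in \<open>auto simp: sub_length\<close>)
    then show ?thesis using that assms(3) by (simp add: character_expand)
  qed
  have "eval_poly (\<lambda>i. of_bool (a ! i)) (basis_poly n S T c) =
      (\<Sum>u\<in>vecs n. (-1/2) ^ weight S * (of_bool (sub u S) * ((-2) ^ weight u * of_bool (sub u a)) -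
        (if c then -1 else 1) * (of_bool (sub u T) * ((-2) ^ weight u * of_bool (sub u a)))))"
    unfolding basis_poly_def eval_sqfree_poly[OF assms(3)]
    by (rule sum.cong)
      (simp_all add: basis_coef_def of_rat_mult of_rat_power of_rat_divide of_rat_minus of_rat_diff algebra_simps)
  also have "\<dots> = (-1/2) ^ weight S * (character S a - (if c then -1 else 1) * character T a)"
    unfolding sum_distrib_left[symmetric] sum_subtractf *[OF assms(1)] *[OF assms(2)] by simp
  finally show ?thesis using assms(4) by (auto simp: character_def)
qed

text \<open>Every monomial divides the one of \<open>S\<close> or the smaller one of
  \<open>T\<close>. As \<open>S\<close> is not contained in \<open>T\<close>, its own coefficient is
  not cancelled, and the factor (-1/2)^|S| normalises it to 1.\<close>

lemma lead_basis_poly: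
  assumes "length S = n" "length T = n" "T \<prec> S"
  shows "lead_monom (basis_poly n S T c) = sqfree_monom S" "lead_coef (basis_poly n S T c) = 1"
proof -
  have "\<not> sub S T" using assms grlex_less_asym sub_grlex by (metis grlex_less_irrefl)
  then have 1: "basis_coef S T c S = 1"
    by (simp add: basis_coef_def flip: power_mult_distrib)
  show lead: "lead_monom (basis_poly n S T c) = sqfree_monom S"
  proof (rule lead_monom_eqI)
    fix m' assume m': "m' \<in> keys (basis_poly n S T c)" "m' \<noteq> sqfree_monom S"
    then obtain u where u: "m' = sqfree_monom u" "length u = n" "basis_coef S T c u \<noteq> 0"
      by (auto simp: basis_poly_def keys_sqfree_poly)
    then have "sub u S \<or> sub u T" by (auto simp: basis_coef_def split: if_splits)
    then show "grlex_less m' (sqfree_monom S)"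
      using sub_grlex u(1) m'(2) assms(3) grlex_less_trans by metis
  qed (use 1 assms in \<open>auto simp: basis_poly_def keys_sqfree_poly\<close>)
  show "lead_coef (basis_poly n S T c) = 1"
    unfolding lead_coef_def lead using 1 assms by (simp add: basis_poly_def lookup_sqfree_poly_monom)
qed

lemma lookup_square_poly:
  "lookup (square_poly u) m =
    (1 when sqfree_monom u + sqfree_monom u = m) - (1 when sqfree_monom u = m)"
  by (simp add: square_poly_def lookup_minus lookup_single)

lemma square_poly_keys:
  assumes "weight u = 1"
  shows "keys (square_poly u) = {sqfree_monom u + sqfree_monom u, sqfree_monom u}"
    and "lead_monom (square_poly u) = sqfree_monom u + sqfree_monom u"
    and "lead_coef (square_poly u) = 1"
proof -
  let ?m = "sqfree_monom u"
  have d: "monom_degree (?m + ?m) = 2" "monom_degree ?m = 1"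
    using assms by (auto simp: monom_degree_add)
  then have ne: "?m + ?m \<noteq> ?m" by (metis one_eq_numeral_iff semiring_norm(85))
  show k: "keys (square_poly u) = {?m + ?m, ?m}"
    using ne by (auto simp: in_keys_iff lookup_square_poly when_def split: if_splits)
  show l: "lead_monom (square_poly u) = ?m + ?m"
    by (rule lead_monom_eqI) (use k d in \<open>auto simp: grlex_less_conv\<close>)
  show "lead_coef (square_poly u) = 1"
    unfolding lead_coef_def l lookup_square_poly using ne by (auto simp: when_def)
qed

lemma eval_square_poly:
  assumes "length u = n" "length a = n"
  shows "eval_poly (\<lambda>i. of_bool (a ! i)) (square_poly u) = 0"
proof -
  let ?m = "sqfree_monom u"
  have k: "keys ?m \<subseteq> {..<n}" "keys (?m + ?m) \<subseteq> {..<n}"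
    using assms by (auto simp: keys_sqfree_monom in_keys_iff lookup_add lookup_sqfree_monom)
  have "support n (?m + ?m) = support n ?m"
    by (simp add: support_def lookup_add)
  then have e: "eval_monom (\<lambda>i. of_bool (a ! i)) (?m + ?m) = eval_monom (\<lambda>i. of_bool (a ! i)) ?m"
    using k assms by (simp add: eval_monom_cube)
  have "keys (square_poly u) \<subseteq> {?m + ?m, ?m}"
    by (auto simp: in_keys_iff lookup_square_poly when_def split: if_splits)
  then have "eval_poly (\<lambda>i. of_bool (a ! i)) (square_poly u) =
      (\<Sum>m\<in>{?m + ?m, ?m}. lookup (square_poly u) m * eval_monom (\<lambda>i. of_bool (a ! i)) m)"
    by (intro eval_poly_superset) auto
  also have "\<dots> = 0"
    using e by (cases "?m + ?m = ?m") (auto simp: lookup_square_poly when_def)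
  finally show ?thesis .
qed

lemma square_poly_in_polys: "length u = n \<Longrightarrow> square_poly u \<in> polys n"
  by (auto simp: polys_def in_keys_iff lookup_square_poly when_def lookup_add lookup_sqfree_monom
      split: if_splits)

text \<open>If the leading monomial of \<open>p\<close> were a standard monomial \<open>x\<^sup>S\<close>, then summing \<open>p\<close> against the
  character of \<open>S\<close> over \<open>V\<close> would isolate its leading coefficient.\<close>

lemma lead_not_standard:
  assumes V: "affine_set n V" "V \<noteq> {}" and p: "p \<in> combinatorial_ideal n V" "p \<noteq> 0"
    and lead: "lead_monom p = sqfree_monom S" and std: "standard V n S"
  shows False
proof -
  let ?e = "\<lambda>a i. of_bool (a ! i) :: real"
  have S: "length S = n" using std by (simp add: standard_def)
  have len: "length a = n" if "a \<in> V" for a using that V(1) by (simp add: affine_set_def)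
  have finV: "finite V" by (rule finite_affine_set[OF V(1)])
  have keys: "keys m \<subseteq> {..<n}" if "m \<in> keys p" for m
    using p(1) that by (auto simp: combinatorial_ideal_def polys_def)
  \<comment> \<open>\<open>S\<close> is the least element of its class, so a different set that is
    not greater cannot match it.\<close>
  have orth: "(\<Sum>a\<in>V. character U a * character S a) = 0"
    if "length U = n" "U \<noteq> S" "\<not> S \<prec> U" for U
  proof (rule character_orthogonal[OF V(1)])
    show "\<not> matches V U S"
      using that std unfolding standard_def by (metis matches_sym)
  qed (use that S in auto)
  have expand: "(\<Sum>a\<in>V. of_bool (sub T a) * character S a) =
      (1/2) ^ weight T * (\<Sum>u | sub u T. (-1) ^ weight u * (\<Sum>a\<in>V. character u a * character S a))"
    if "length T = n" for T
  proof -
    have "(\<Sum>a\<in>V. of_bool (sub T a) * character S a) =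
        (\<Sum>a\<in>V. (1/2) ^ weight T * (\<Sum>u | sub u T. (-1) ^ weight u * (character u a * character S a)))"
      by (rule sum.cong) (use that len in \<open>auto simp: monomial_expand sum_distrib_right mult.assoc\<close>)
    also have "\<dots> = (1/2) ^ weight T * (\<Sum>u | sub u T. (-1) ^ weight u * (\<Sum>a\<in>V. character u a * character S a))"
      unfolding sum_distrib_left[symmetric] by (subst sum.swap) (simp add: sum_distrib_left)
    finally show ?thesis .
  qed
  have other: "(\<Sum>a\<in>V. eval_monom (?e a) m * character S a) = 0"
    if m: "m \<in> keys p" "m \<noteq> lead_monom p" for m
  proof -
    let ?T = "support n m"
    have "grlex_less m (sqfree_monom S)"
      using lead_monom_nonzero(2)[OF p(2) m] lead by simp
    then have less: "?T \<prec> S"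
      using monom_dvd_grlex[OF sqfree_monom_support_dvd[of n m]] grlex_less_trans by metis
    have "(\<Sum>a\<in>V. character u a * character S a) = 0" if "sub u ?T" for u
    proof (rule orth)
      show "length u = n" using sub_length[OF that] by simp
      have "u \<prec> S"
        using sub_grlex[OF that] less grlex_less_trans by metis
      then show "u \<noteq> S" "\<not> S \<prec> u"
        using grlex_less_asym by auto
    qed
    then have "(\<Sum>a\<in>V. of_bool (sub ?T a) * character S a) = 0"
      by (simp add: expand)
    then show ?thesis
      using keys[OF m(1)] len by (simp add: eval_monom_cube)
  qed
  \<comment> \<open>Proper subsets of \<open>S\<close> are smaller than \<open>S\<close>, so only
    \<open>u = S\<close> survives; there the squared character sums to the number of points.\<close>
  have sum_S: "(\<Sum>a\<in>V. of_bool (sub S a) * character S a) = (1/2) ^ weight S * ((-1) ^ weight S * real (card V))"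
  proof -
    have "(\<Sum>u | sub u S. (-1) ^ weight u * (\<Sum>a\<in>V. character u a * character S a)) =
        (\<Sum>u\<in>{S}. (-1) ^ weight u * (\<Sum>a\<in>V. character u a * character S a))"
    proof (rule sum.mono_neutral_right)
      show "\<forall>u\<in>{u. sub u S} - {S}. (-1) ^ weight u * (\<Sum>a\<in>V. character u a * character S a) = 0"
        using orth sub_length sub_grlex grlex_less_asym S by (metis (no_types, lifting) Diff_iff insertCI mem_Collect_eq mult_zero_right)
    qed (auto simp: finite_sub)
    also have "\<dots> = (-1) ^ weight S * real (card V)"
      by (simp add: character_def if_distrib[of "\<lambda>x. x * _"] cong: if_cong)
    finally show ?thesis using expand[OF S] by simp
  qed
  have "0 = (\<Sum>a\<in>V. eval_poly (?e a) p * character S a)"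
    using p(1) by (simp add: combinatorial_ideal_def)
  also have "\<dots> = (\<Sum>a\<in>V. \<Sum>m\<in>keys p.
      lookup p m * (eval_monom (?e a) m * character S a))"
    unfolding eval_poly_def by (simp add: sum_distrib_right mult.assoc)
  also have "\<dots> = (\<Sum>m\<in>keys p.
      lookup p m * (\<Sum>a\<in>V. eval_monom (?e a) m * character S a))"
    by (subst sum.swap) (simp add: sum_distrib_left)
  also have "\<dots> = (\<Sum>m\<in>{lead_monom p}.
      lookup p m * (\<Sum>a\<in>V. eval_monom (?e a) m * character S a))"
    by (rule sum.mono_neutral_right) (use lead_monom_nonzero(1)[OF p(2)] other in auto)
  also have "\<dots> = lookup p (lead_monom p) * (\<Sum>a\<in>V. of_bool (sub S a) * character S a)"
    using keys[OF lead_monom_nonzero(1)[OF p(2)]] len S by (simp add: lead eval_monom_cube support_sqfree)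
  finally have "lookup p (lead_monom p) * ((1/2) ^ weight S * ((-1) ^ weight S * real (card V))) = 0"
    unfolding sum_S by simp
  then show False
    using lead_monom_nonzero(1)[OF p(2)] V(2) finV by (simp add: in_keys_iff)
qed

text \<open>If the support of the leading monomial is nonstandard, a minimal nonstandard subset
  divides it. If the support is standard and some exponent is at least 2, the square of that
  variable divides it, and the variable is standard as a subset of the support. A squarefree
  standard leading monomial is excluded by \<open>lead_not_standard\<close>.\<close>

lemma reduced_basis_divides:
  assumes V: "affine_set n V" "V \<noteq> {}" and p: "p \<in> combinatorial_ideal n V" "p \<noteq> 0"
  shows "\<exists>g \<in> reduced_basis n V. g \<noteq> 0 \<and> lead_coef g = 1 \<and> monom_dvd (lead_monom g) (lead_monom p)"
proof -
  let ?m = "lead_monom p"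
  let ?S = "support n ?m"
  have keys: "keys ?m \<subseteq> {..<n}"
    using p(1) lead_monom_nonzero(1)[OF p(2)] by (auto simp: combinatorial_ideal_def polys_def)
  have len: "\<forall>p \<in> V. length p = n" using V(1) by (simp add: affine_set_def)
  have nz: "lead_coef g = 1 \<Longrightarrow> g \<noteq> 0" for g by (auto simp: lead_coef_def)
  have dvd_trans: "monom_dvd a b \<Longrightarrow> monom_dvd b c \<Longrightarrow> monom_dvd a c" for a b c
    by (meson monom_dvd_conv order_trans)
  show ?thesis
  proof (cases "standard V n ?S")
    case False
    then obtain R where R: "sub R ?S" "minimal_nonstandard V n R"
      using minimal_nonstandard_exists[of ?S n V] by auto
    then have lenR: "length R = n" "\<not> standard V n R" by (auto simp: minimal_nonstandard_def)
    then obtain T where T: "representative V n R T" using representative_exists by blast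
    then obtain c where c: "\<forall>p \<in> V. (parity R p \<noteq> parity T p) = c"
      by (auto simp: representative_def matches_def)
    have lenT: "length T = n" using T by (simp add: representative_def standard_def)
    have "monom_dvd (sqfree_monom R) ?m"
      using R(1) dvd_trans sqfree_monom_support_dvd by (metis lenR(1) length_support monom_dvd_sqfree)
    moreover have "basis_poly n R T c \<in> reduced_basis n V"
      using V(2) R(2) T c by (auto simp: reduced_basis_def)
    ultimately show ?thesis
      using lead_basis_poly[OF lenR(1) lenT representative_less[OF T lenR]] nz by metis
  next
    case True
    show ?thesis
    proof (cases "\<exists>i. lookup ?m i \<ge> 2")
      case True
      then obtain i where i: "lookup ?m i \<ge> 2" by blast
      then have "i < n" using keys by (auto simp: in_keys_iff subset_iff)
      define u where "u = (replicate n False)[i := True]"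
      have u: "length u = n" "\<And>j. j < n \<Longrightarrow> u ! j \<longleftrightarrow> j = i"
        using \<open>i < n\<close> by (auto simp: u_def nth_list_update)
      have "weight (replicate n False) = 0" by (induction n) auto
      then have "weight u = 1"
        using weight_update[of i "replicate n False" True] \<open>i < n\<close> by (simp add: u_def)
      moreover have "sub u ?S"
        using i u by (auto simp: sub_conv_nth support_def)
      then have "standard V n u" using standard_sub[OF len] \<open>standard V n ?S\<close> by blast
      ultimately have "square_poly u \<in> reduced_basis n V" using V(2) by (auto simp: reduced_basis_def)
      moreover have "monom_dvd (sqfree_monom u + sqfree_monom u) ?m"
        using i u by (auto simp: monom_dvd_conv lookup_add lookup_sqfree_monom of_bool_def)
      ultimately show ?thesis
        using square_poly_keys[OF \<open>weight u = 1\<close>] nz by metis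
    next
      case False
      have "?m = sqfree_monom ?S"
      proof (rule poly_mapping_eqI)
        fix i
        have "\<not> 2 \<le> lookup ?m i" using False by blast
        then have "lookup ?m i \<le> 1" by linarith
        moreover have "lookup ?m i = 0" if "\<not> i < n"
          using keys that by (auto simp: in_keys_iff subset_iff)
        ultimately show "lookup ?m i = lookup (sqfree_monom ?S) i"
          by (cases "i < n") (auto simp: lookup_sqfree_monom support_def of_bool_def)
      qed
      then show ?thesis using lead_not_standard[OF V p _ True] by blast
    qed
  qed
qed

section \<open>The Groebner basis property and reducedness\<close>

lemma reduced_basis_subset:
  assumes V: "affine_set n V"
  shows "reduced_basis n V \<subseteq> combinatorial_ideal n V"
proof
  fix g assume g: "g \<in> reduced_basis n V"
  have len: "length p = n" if "p \<in> V" for p using V that by (simp add: affine_set_def)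
  show "g \<in> combinatorial_ideal n V"
  proof (cases "V = {}")
    case True
    then show ?thesis using g by (simp add: reduced_basis_def combinatorial_ideal_def polys_def)
  next
    case False
    show ?thesis
      using g False
    proof (cases rule: reduced_basis_cases)
      case (1 u)
      then show ?thesis
        using len by (auto simp: combinatorial_ideal_def standard_def eval_square_poly square_poly_in_polys)
    next
      case (2 S T c)
      then have "length S = n" "length T = n"
        by (auto simp: minimal_nonstandard_def representative_def standard_def)
      then show ?thesis
        using 2 len by (auto simp: combinatorial_ideal_def eval_basis_poly)
          (auto simp: basis_poly_def sqfree_poly_in_polys)
    qed
  qed
qed

lemma finite_reduced_basis: "finite (reduced_basis n V)"
proof (cases "V = {}")
  case False
  have "g \<in> square_poly ` vecs n \<union> (\<lambda>(S, T, c). basis_poly n S T c) ` (vecs n \<times> vecs n \<times> UNIV)"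
    if "g \<in> reduced_basis n V" for g
  proof -
    show ?thesis
      using that False
    proof (cases rule: reduced_basis_cases)
      case (2 S T c)
      then have "(S, T, c) \<in> vecs n \<times> vecs n \<times> UNIV"
        by (auto simp: minimal_nonstandard_def representative_def standard_def)
      with 2 show ?thesis by (auto intro!: UnI2 image_eqI[of _ _ "(S, T, c)"])
    qed (auto simp: standard_def)
  qed
  then show ?thesis
    by (intro finite_subset[of "reduced_basis n V" "square_poly ` vecs n \<union>
      (\<lambda>(S, T, c). basis_poly n S T c) ` (vecs n \<times> vecs n \<times> UNIV)"]) (blast | simp)+
qed (simp add: reduced_basis_def)

text \<open>As the divisor \<open>g\<close> has leading coefficient 1, the leading term of
  \<open>p\<close> is a single term times the leading term of \<open>g\<close>.\<close>

lemma groebner_basis_divides: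
  assumes G: "finite G" "G \<subseteq> I" and I: "I \<subseteq> polys n"
    and dvd: "\<And>p. p \<in> I \<Longrightarrow> p \<noteq> 0 \<Longrightarrow>
      \<exists>g \<in> G. g \<noteq> 0 \<and> lead_coef g = 1 \<and> monom_dvd (lead_monom g) (lead_monom p)"
  shows "groebner_basis n I G"
proof -
  have "lead_term p \<in> J"
    if J: "is_ideal n J" "lead_term ` (G - {0}) \<subseteq> J" and p: "p \<in> I" "p \<noteq> 0" for J p
  proof -
    from dvd[OF p] obtain g k where g: "g \<in> G" "g \<noteq> 0" "lead_coef g = 1"
        "lead_monom p = lead_monom g + k"
      by (auto simp: monom_dvd_def)
    have "keys (lead_monom p) \<subseteq> {..<n}"
      using p I lead_monom_nonzero(1)[OF p(2)] by (auto simp: polys_def)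
    then have "Poly_Mapping.single k (lead_coef p) \<in> polys n"
      unfolding polys_def g(4) by (auto simp: in_keys_iff lookup_add subset_iff split: if_splits)
    then have "Poly_Mapping.single k (lead_coef p) * lead_term g \<in> J"
      using J g by (auto simp: is_ideal_def)
    moreover have "Poly_Mapping.single k (lead_coef p) * lead_term g = lead_term p"
      unfolding lead_term_def mult_single g(3,4) by (simp add: add.commute)
    ultimately show ?thesis by simp
  qed
  then have "ideal_generated n (lead_term ` (I - {0})) \<subseteq> ideal_generated n (lead_term ` (G - {0}))"
    unfolding ideal_generated_def hull_def by blast
  moreover have "ideal_generated n (lead_term ` (G - {0})) \<subseteq> ideal_generated n (lead_term ` (I - {0}))"
    unfolding ideal_generated_def using G(2) by (intro hull_mono) auto
  ultimately show ?thesis using G by (simp add: groebner_basis_def)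
qed

text \<open>Apart from the leading monomials, all monomials of basis elements are standard: proper
  subsets of the minimal set \<open>S\<close>, subsets of the standard set \<open>T\<close>, and the
  variable in x_i^2 - x_i. No leading monomial divides a standard one, so it remains to compare the
  leading monomials with each other.\<close>

theorem reduced_groebner_basis_reduced_basis:
  assumes V: "affine_set n V"
  shows "reduced_groebner_basis n (combinatorial_ideal n V) (reduced_basis n V)"
proof (cases "V = {}")
  case True
  have l: "lead_monom 1 = 0"
    by (rule lead_monom_eqI) simp_all
  have "monom_dvd (lead_monom 1) m" for m
    by (simp add: l monom_dvd_def)
  moreover have "lead_coef 1 = 1" by (simp add: lead_coef_def l)
  ultimately have "groebner_basis n (combinatorial_ideal n V) {1}"
    using reduced_basis_subset[OF V] True
    by (intro groebner_basis_divides) (auto simp: reduced_basis_def combinatorial_ideal_def)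
  then show ?thesis
    using True \<open>lead_coef 1 = 1\<close> by (simp add: reduced_groebner_basis_def reduced_basis_def)
next
  case False
  have len: "\<forall>p \<in> V. length p = n" using V by (simp add: affine_set_def)
  have "groebner_basis n (combinatorial_ideal n V) (reduced_basis n V)"
    using finite_reduced_basis reduced_basis_subset[OF V] reduced_basis_divides[OF V False]
    by (intro groebner_basis_divides) (auto simp: combinatorial_ideal_def)
  moreover have "lead_coef g = 1 \<and>
      (\<forall>g'\<in>reduced_basis n V - {g}. \<forall>m\<in>keys g. \<not> monom_dvd (lead_monom g') m)"
    if g: "g \<in> reduced_basis n V" for g
  proof -
    have cases: "(\<exists>u. weight u = 1 \<and> standard V n u \<and> h = square_poly u) \<or>
        (\<exists>S T c. minimal_nonstandard V n S \<and> standard V n T \<and> length S = n \<and>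
          length T = n \<and> T \<prec> S \<and>
          representative V n S T \<and> (\<forall>p \<in> V. (parity S p \<noteq> parity T p) = c) \<and> h = basis_poly n S T c)"
      if "h \<in> reduced_basis n V" for h
    proof -
      show ?thesis
        using that False
      proof (cases rule: reduced_basis_cases)
        case (2 S T c)
        then have "length S = n" "\<not> standard V n S" "standard V n T" "length T = n"
          by (auto simp: minimal_nonstandard_def representative_def standard_def)
        then show ?thesis using 2 representative_less by blast
      qed blast
    qed
    have no_square: "\<not> monom_dvd (sqfree_monom u + sqfree_monom u) (sqfree_monom v)"
      if "weight u = 1" for u v
    proof -
      obtain i where "i < length u" "u ! i" using weight_1_nth \<open>weight u = 1\<close> by blast
      then have "lookup (sqfree_monom u + sqfree_monom u) i = 2"
        by (simp add: lookup_add lookup_sqfree_monom)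
      moreover have "lookup (sqfree_monom v) i \<le> 1"
        by (simp add: lookup_sqfree_monom)
      ultimately have "\<not> lookup (sqfree_monom u + sqfree_monom u) i \<le>
          lookup (sqfree_monom v) i" by simp
      then show ?thesis unfolding monom_dvd_conv by blast
    qed
    have lead1: "lead_coef g = 1"
      using cases[OF g] lead_basis_poly square_poly_keys by metis
    have no_dvd_standard: "\<not> monom_dvd (lead_monom g') (sqfree_monom u)"
      if "g' \<in> reduced_basis n V" "standard V n u" for g' u
    proof
      assume dvd: "monom_dvd (lead_monom g') (sqfree_monom u)"
      from cases[OF that(1)] show False
      proof (elim disjE exE conjE)
        fix w assume "weight w = 1" "g' = square_poly w"
        then show False using dvd no_square square_poly_keys(2) by metis
      next
        fix S T c
        assume *: "minimal_nonstandard V n S" "length S = n" "length T = n" "g' = basis_poly n S T c"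
          "T \<prec> S"
        then have "monom_dvd (sqfree_monom S) (sqfree_monom u)"
          using dvd lead_basis_poly by metis
        then have "sub S u" using * that(2) by (simp add: monom_dvd_sqfree standard_def)
        then have "standard V n S" using standard_sub[OF len] that(2) by blast
        then show False using *(1) by (simp add: minimal_nonstandard_def)
      qed
    qed
    have "\<not> monom_dvd (lead_monom g') m"
      if g': "g' \<in> reduced_basis n V" "g' \<noteq> g" and m: "m \<in> keys g" for g' m
      using cases[OF g]
    proof (elim disjE exE conjE)
      fix u assume u: "weight u = 1" "standard V n u" "g = square_poly u"
      have "m = sqfree_monom u + sqfree_monom u \<or> m = sqfree_monom u"
        using m square_poly_keys(1)[OF u(1)] u(3) by auto
      then show ?thesis
      proof
        assume m: "m = sqfree_monom u + sqfree_monom u"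
        have lenu: "length u = n" using u(2) by (simp add: standard_def)
        show ?thesis
        proof
          assume dvd: "monom_dvd (lead_monom g') m"
          from cases[OF g'(1)] show False
          proof (elim disjE exE conjE)
            fix w assume w: "weight w = 1" "standard V n w" "g' = square_poly w"
            then have "monom_dvd (sqfree_monom w + sqfree_monom w) (sqfree_monom u + sqfree_monom u)"
              using dvd square_poly_keys(2) m by metis
            then have "monom_dvd (sqfree_monom w) (sqfree_monom u)"
              by (simp add: monom_dvd_conv lookup_add) (metis add_le_mono not_le add_strict_mono)
            then have "sub w u"
              using w lenu by (simp add: monom_dvd_sqfree standard_def)
            then have "w = u" using sub_weight u(1) w(1) by auto
            then show False using g'(2) u(3) w(3) by simp
          next
            fix S T c
            assume *: "minimal_nonstandard V n S" "length S = n" "length T = n" "g' = basis_poly n S T c"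
              "T \<prec> S"
            then have "monom_dvd (sqfree_monom S) (sqfree_monom u + sqfree_monom u)"
              using dvd lead_basis_poly m by metis
            \<comment> \<open>A squarefree divisor of the square of a squarefree monomial divides
              that monomial itself.\<close>
            then have "\<forall>i. S ! i \<longrightarrow> i < n \<longrightarrow> u ! i"
              using * lenu unfolding monom_dvd_conv
              by (auto simp: lookup_add lookup_sqfree_monom of_bool_def split: if_splits)
            then have "sub S u" using * lenu by (simp add: sub_conv_nth)
            then have "standard V n S" using standard_sub[OF len] u(2) by blast
            then show False using *(1) by (simp add: minimal_nonstandard_def)
          qed
        qed
      qed (use no_dvd_standard[OF g'(1) u(2)] in simp)
    next
      fix S T c
      assume *: "minimal_nonstandard V n S" "standard V n T" "length S = n" "length T = n"
        "g = basis_poly n S T c" "T \<prec> S"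
        "representative V n S T" "\<forall>p \<in> V. (parity S p \<noteq> parity T p) = c"
      obtain u where u: "m = sqfree_monom u" "basis_coef S T c u \<noteq> 0"
        using m *(5) by (auto simp: basis_poly_def keys_sqfree_poly)
      then have "sub u S \<or> sub u T" by (auto simp: basis_coef_def split: if_splits)
      then consider "u = S" | "standard V n u"
        using standard_sub[OF len] minimal_nonstandard_sub[OF len] * by blast
      then show ?thesis
      proof cases
        case 1
        show ?thesis
        proof
          assume dvd: "monom_dvd (lead_monom g') m"
          from cases[OF g'(1)] show False
          proof (elim disjE exE conjE)
            fix w assume "weight w = 1" "g' = square_poly w"
            then show False using dvd no_square square_poly_keys(2) u(1) by metis
          next
            fix S' T' c'
            assume **: "minimal_nonstandard V n S'" "length S' = n" "length T' = n"
              "g' = basis_poly n S' T' c'" "T' \<prec> S'"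
              "representative V n S' T'" "\<forall>p \<in> V. (parity S' p \<noteq> parity T' p) = c'"
            then have "sub S' S"
              using dvd lead_basis_poly u(1) 1 monom_dvd_sqfree *(3) by metis
            then have "S' = S"
              using minimal_nonstandard_sub[OF len *(1)] **(1) by (auto simp: minimal_nonstandard_def)
            moreover from this have "T' = T"
              using representative_unique *(7) **(6) by blast
            \<comment> \<open>A point of \<open>V\<close> pins down the sign, so equal leading
              monomials force equal polynomials.\<close>
            moreover obtain p where "p \<in> V" using False by blast
            ultimately have "c' = c" using *(8) **(7) by metis
            with \<open>S' = S\<close> \<open>T' = T\<close> show False using g'(2) *(5) **(4) by simp
          qed
        qed
      qed (use no_dvd_standard[OF g'(1)] u(1) in blast)
    qed
    then show ?thesis using lead1 by blast
  qed
  ultimately show ?thesis by (simp add: reduced_groebner_basis_def)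
qed

section \<open>The algorithm\<close>

subsection \<open>Generators of the affine space of solutions\<close>

text \<open>An assignment together with those coordinates of a tuple that have yet to be identified
  with variables.\<close>

type_synonym point = "bool list \<times> bool list"

definition xor3_pair :: "point \<Rightarrow> point \<Rightarrow> point \<Rightarrow> point" where
  "xor3_pair p q r = (xor3 (fst p) (fst q) (fst r), xor3 (snd p) (snd q) (snd r))"

text \<open>The point satisfies the next equation, between variable \<open>i\<close> and the first
  remaining coordinate.\<close>

definition good :: "nat \<Rightarrow> point \<Rightarrow> bool" where
  "good i p \<longleftrightarrow> fst p ! i = hd (snd p)"

definition drop_pair :: "point \<Rightarrow> point" where
  "drop_pair p = (fst p, tl (snd p))"

text \<open>If \<open>a\<close> is good and \<open>b\<close> is not, then correction by \<open>a + b\<close> is a homomorphism, so that the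
  corrected generators span the good part of the span.\<close>

definition correct :: "nat \<Rightarrow> point \<Rightarrow> point \<Rightarrow> point \<Rightarrow> point" where
  "correct i a b p = (if good i p then p else xor3_pair p a b)"

text \<open>\<open>a\<close> is the first good generator and \<open>b\<close> the first bad one.
  Without a good generator the span has no good point, since three bad points add up to a bad one.
  Without a bad generator nothing is corrected, and \<open>a\<close> merely fills the place of
  \<open>b\<close>.\<close>

definition step :: "nat \<Rightarrow> point list \<Rightarrow> point list" where
  "step i ps = (case dropWhile (\<lambda>p. \<not> good i p) ps of [] \<Rightarrow> []
     | a # _ \<Rightarrow> (case dropWhile (good i) ps of [] \<Rightarrow> map (drop_pair \<circ> correct i a a) ps
        | b # _ \<Rightarrow> map (drop_pair \<circ> correct i a b) ps))"

fun equate :: "nat list \<Rightarrow> point list \<Rightarrow> bool list list" where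
  "equate [] ps = map fst ps"
| "equate (i # xs) ps = equate xs (step i ps)"

text \<open>The product of the current affine space with the relation is cut down by the equations that
  identify the constrained variables with the coordinates of the relation.\<close>

definition constrain :: "bool list list \<times> nat list \<Rightarrow> bool list list \<Rightarrow> bool list list" where
  "constrain c vs = (case vs of [] \<Rightarrow> [] | v # _ \<Rightarrow> (case fst c of [] \<Rightarrow> []
     | r # _ \<Rightarrow> equate (snd c) (map (\<lambda>v. (v, r)) vs @ map (\<lambda>t. (v, t)) (fst c))))"

definition points_ok :: "nat \<Rightarrow> nat \<Rightarrow> point set \<Rightarrow> bool" where
  "points_ok n k A \<longleftrightarrow> (\<forall>p \<in> A. length (fst p) = n \<and> length (snd p) = k)"

lemma points_ok_affine_span:
  assumes "points_ok n k A"
  shows "points_ok n k (affine_span xor3_pair A)"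
  unfolding points_ok_def
proof
  fix p assume "p \<in> affine_span xor3_pair A"
  then show "length (fst p) = n \<and> length (snd p) = k"
    by (rule affine_span_invariant) (use assms in \<open>auto simp: points_ok_def xor3_pair_def\<close>)
qed

text \<open>For three truth values, iterated equality is addition modulo 2, just as iterated
  inequality is. So satisfaction of the equation is an affine function of the point.\<close>

lemma good_xor3_pair:
  assumes "points_ok n (Suc k) {p, q, r}" "i < n"
  shows "good i (xor3_pair p q r) = (good i p = (good i q = good i r))"
proof -
  have "hd (xor3 (snd p) (snd q) (snd r)) = (hd (snd p) \<noteq> (hd (snd q) \<noteq> hd (snd r)))"
    using assms by (auto simp: points_ok_def length_Suc_conv)
  then show ?thesis
    using assms by (auto simp: points_ok_def good_def xor3_pair_def nth_xor3)
qed

lemma drop_pair_xor3_pair: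
  assumes "points_ok n (Suc k) {p, q, r}"
  shows "drop_pair (xor3_pair p q r) = xor3_pair (drop_pair p) (drop_pair q) (drop_pair r)"
  using assms by (auto simp: points_ok_def drop_pair_def xor3_pair_def length_Suc_conv)

lemma xor3_pair_eqI:
  assumes "points_ok n k {p, q}"
    and "\<And>i. i < n \<Longrightarrow> fst p ! i = fst q ! i" "\<And>i. i < k \<Longrightarrow> snd p ! i = snd q ! i"
  shows "p = q"
  using assms by (intro prod_eqI nth_equalityI) (auto simp: points_ok_def)

text \<open>With e(p) = 1 for bad and e(p) = 0 for good points, the correction is p + e(p) (a + b).
  By \<open>good_xor3_pair\<close> the function e is affine, so a + b occurs on both sides with the
  same multiplicity modulo 2.\<close>

lemma correct_hom:
  assumes ok: "points_ok n (Suc k) {p, q, r, a, b}" and i: "i < n"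
  shows "correct i a b (xor3_pair p q r) =
    xor3_pair (correct i a b p) (correct i a b q) (correct i a b r)"
proof -
  have g: "good i (xor3_pair p q r) = (good i p = (good i q = good i r))"
    using ok by (intro good_xor3_pair[OF _ i, where k = k]) (auto simp: points_ok_def)
  show ?thesis
  proof (rule xor3_pair_eqI[where n = n and k = "Suc k"])
    show "points_ok n (Suc k) {correct i a b (xor3_pair p q r),
        xor3_pair (correct i a b p) (correct i a b q) (correct i a b r)}"
      using ok by (auto simp: points_ok_def correct_def xor3_pair_def)
  next
    fix j assume "j < n"
    then show "fst (correct i a b (xor3_pair p q r)) ! j =
        fst (xor3_pair (correct i a b p) (correct i a b q) (correct i a b r)) ! j"
      using ok g by (cases "good i p"; cases "good i q"; cases "good i r")
        (auto simp: points_ok_def correct_def xor3_pair_def nth_xor3)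
  next
    fix j assume "j < Suc k"
    then show "snd (correct i a b (xor3_pair p q r)) ! j =
        snd (xor3_pair (correct i a b p) (correct i a b q) (correct i a b r)) ! j"
      using ok g by (cases "good i p"; cases "good i q"; cases "good i r")
        (auto simp: points_ok_def correct_def xor3_pair_def nth_xor3)
  qed
qed

text \<open>As a homomorphism, the correction maps the span onto the span of the corrected
  generators. It fixes good points and makes bad points good, so this image is exactly the good
  part. The alternative in the assumption on \<open>b\<close> covers the case that no generator is
  bad.\<close>

lemma correct_image:
  assumes ok: "points_ok n (Suc k) A" and i: "i < n" and a: "a \<in> A" "good i a"
    and b: "b \<in> A" "\<not> good i b \<or> (\<forall>p \<in> A. good i p)"
  shows "affine_span xor3_pair ((drop_pair \<circ> correct i a b) ` A) =
    drop_pair ` {p \<in> affine_span xor3_pair A. good i p}"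
proof -
  let ?A = "affine_span xor3_pair A"
  have ok': "points_ok n (Suc k) ?A" by (rule points_ok_affine_span[OF ok])
  have ab: "a \<in> ?A" "b \<in> ?A" using a b by (auto intro: affine_span.base)
  have good3: "good i (xor3_pair p q r) = (good i p = (good i q = good i r))"
    if "p \<in> ?A" "q \<in> ?A" "r \<in> ?A" for p q r
    using that ok' by (intro good_xor3_pair[OF _ i, where k = k]) (auto simp: points_ok_def)
  have hom: "correct i a b (xor3_pair p q r) =
      xor3_pair (correct i a b p) (correct i a b q) (correct i a b r)"
    if "p \<in> ?A" "q \<in> ?A" "r \<in> ?A" for p q r
    using that ok' ab by (intro correct_hom[OF _ i, where k = k]) (auto simp: points_ok_def)
  \<comment> \<open>If \<open>b\<close> were good, all generators and with them the whole span would
    be good.\<close>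
  have bad: "\<not> good i b" if p: "p \<in> ?A" "\<not> good i p" for p
  proof
    assume "good i b"
    then have all: "\<forall>p \<in> A. good i p" using b by blast
    have "p \<in> ?A \<and> good i p"
    proof (rule affine_span_invariant[OF p(1), where Q = "\<lambda>p. p \<in> ?A \<and> good i p"])
      fix q r s assume "q \<in> ?A \<and> good i q" "r \<in> ?A \<and> good i r" "s \<in> ?A \<and> good i s"
      then show "xor3_pair q r s \<in> ?A \<and> good i (xor3_pair q r s)"
        by (auto simp: good3 intro: affine_span.closed)
    qed (use all in \<open>auto intro: affine_span.base\<close>)
    then show False using p by simp
  qed
  have in_span: "correct i a b p \<in> ?A \<and> good i (correct i a b p)" if "p \<in> ?A" for p
    using that ab bad[OF that] a(2) good3[OF that ab]
    by (auto simp: correct_def intro: affine_span.closed)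
  have "affine_span xor3_pair (correct i a b ` A) = correct i a b ` ?A"
    by (rule affine_span_image) (rule hom)
  also have "\<dots> = {p \<in> ?A. good i p}"
  proof (intro equalityI subsetI)
    fix p assume "p \<in> {p \<in> ?A. good i p}"
    then show "p \<in> correct i a b ` ?A" by (intro image_eqI[of _ _ p]) (auto simp: correct_def)
  qed (use in_span in auto)
  finally have span: "affine_span xor3_pair (correct i a b ` A) = {p \<in> ?A. good i p}" .
  have "affine_span xor3_pair (drop_pair ` (correct i a b ` A)) =
      drop_pair ` affine_span xor3_pair (correct i a b ` A)"
  proof (rule affine_span_image)
    fix p q r assume "p \<in> affine_span xor3_pair (correct i a b ` A)"
      "q \<in> affine_span xor3_pair (correct i a b ` A)" "r \<in> affine_span xor3_pair (correct i a b ` A)"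
    then show "drop_pair (xor3_pair p q r) = xor3_pair (drop_pair p) (drop_pair q) (drop_pair r)"
      unfolding span using ok' by (intro drop_pair_xor3_pair[where n = n and k = k]) (auto simp: points_ok_def)
  qed
  then show ?thesis unfolding span by (simp add: image_comp)
qed

lemma step_cases:
  obtains "\<forall>p \<in> set ps. \<not> good i p" "step i ps = []"
  | a b where "a \<in> set ps" "good i a" "b \<in> set ps" "\<not> good i b \<or> (\<forall>p \<in> set ps. good i p)"
      "step i ps = map (drop_pair \<circ> correct i a b) ps"
proof (cases "dropWhile (\<lambda>p. \<not> good i p) ps")
  case Nil
  then have "\<forall>p \<in> set ps. \<not> good i p" by simp
  then show ?thesis using that(1) Nil by (simp add: step_def)
next
  case (Cons a qs)
  have a: "a \<in> set ps" "good i a"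
    using Cons hd_dropWhile[of "\<lambda>p. \<not> good i p" ps] by (metis list.set_intros(1) set_dropWhileD, simp)
  show ?thesis
  proof (cases "dropWhile (good i) ps")
    case Nil
    then have "\<forall>p \<in> set ps. good i p" by simp
    then show ?thesis using that(2)[OF a a(1)] Cons Nil by (simp add: step_def)
  next
    case Cons': (Cons b rs)
    have "b \<in> set ps" "\<not> good i b"
      using Cons' hd_dropWhile[of "good i" ps] by (metis list.set_intros(1) set_dropWhileD, simp)
    then show ?thesis using that(2)[OF a] Cons Cons' by (simp add: step_def)
  qed
qed

lemma points_ok_step:
  assumes "points_ok n (Suc k) (set ps)"
  shows "points_ok n k (set (step i ps))"
proof (cases rule: step_cases[of ps i])
  case (2 a b)
  then show ?thesis
    using assms by (auto simp: points_ok_def drop_pair_def correct_def xor3_pair_def)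
qed (simp add: points_ok_def)

lemma affine_span_empty [simp]: "affine_span f {} = {}"
proof -
  have False if "p \<in> affine_span f {}" for p using that by induction auto
  then show ?thesis by blast
qed

lemma affine_span_step:
  assumes ok: "points_ok n (Suc k) (set ps)" and i: "i < n"
  shows "affine_span xor3_pair (set (step i ps)) =
    drop_pair ` {p \<in> affine_span xor3_pair (set ps). good i p}"
proof (cases rule: step_cases[of ps i])
  case 1
  let ?A = "affine_span xor3_pair (set ps)"
  have ok': "points_ok n (Suc k) ?A" by (rule points_ok_affine_span[OF ok])
  have "p \<in> ?A \<and> \<not> good i p" if "p \<in> ?A" for p
  proof (rule affine_span_invariant[OF that, where Q = "\<lambda>p. p \<in> ?A \<and> \<not> good i p"])
    fix q r s assume *: "q \<in> ?A \<and> \<not> good i q" "r \<in> ?A \<and> \<not> good i r" "s \<in> ?A \<and> \<not> good i s"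
    then have "points_ok n (Suc k) {q, r, s}" using ok' by (auto simp: points_ok_def)
    from good_xor3_pair[OF this i] show "xor3_pair q r s \<in> ?A \<and> \<not> good i (xor3_pair q r s)"
      using * by (auto intro: affine_span.closed)
  qed (use 1 in \<open>auto intro: affine_span.base\<close>)
  then show ?thesis by (auto simp: 1(2))
next
  case (2 a b)
  then show ?thesis using correct_image[OF ok i 2(1-4)] by simp
qed

text \<open>Each step keeps the pairs that satisfy one equation and forgets its coordinate. That
  coordinate equals a value of \<open>v\<close>, so it can be restored; what is left in the end are
  the \<open>v\<close> that were paired with their own projection.\<close>

lemma affine_span_equate:
  "points_ok n (length xs) (set ps) \<Longrightarrow> set xs \<subseteq> {..<n} \<Longrightarrow>
    affine_span xor3 (set (equate xs ps)) =
      {v. (v, map ((!) v) xs) \<in> affine_span xor3_pair (set ps)}"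
proof (induction xs arbitrary: ps)
  case Nil
  have "affine_span xor3 (fst ` set ps) = fst ` affine_span xor3_pair (set ps)"
    by (rule affine_span_image) (simp add: xor3_pair_def)
  moreover have "snd p = []" if "p \<in> affine_span xor3_pair (set ps)" for p
    using points_ok_affine_span[OF Nil(1)] that by (simp add: points_ok_def)
  then have "fst ` affine_span xor3_pair (set ps) = {v. (v, []) \<in> affine_span xor3_pair (set ps)}"
    by (force simp: image_iff)
  ultimately show ?case by simp
next
  case (Cons i xs)
  let ?A = "affine_span xor3_pair (set ps)"
  have ok: "points_ok n (Suc (length xs)) (set ps)" using Cons.prems by simp
  have ok': "points_ok n (Suc (length xs)) ?A" by (rule points_ok_affine_span[OF ok])
  have i: "i < n" using Cons.prems by simp
  have "(v, map ((!) v) xs) \<in> drop_pair ` {p \<in> ?A. good i p} \<longleftrightarrow> (v, map ((!) v) (i # xs)) \<in> ?A" for v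
  proof
    assume "(v, map ((!) v) xs) \<in> drop_pair ` {p \<in> ?A. good i p}"
    then obtain p where p: "p \<in> ?A" "good i p" "fst p = v" "tl (snd p) = map ((!) v) xs"
      by (auto simp: drop_pair_def)
    then have "snd p \<noteq> []" using ok' by (auto simp: points_ok_def)
    then have "snd p = map ((!) v) (i # xs)"
      using p by (cases "snd p") (auto simp: good_def)
    then have "p = (v, map ((!) v) (i # xs))" using p(3) by (intro prod_eqI) simp_all
    then show "(v, map ((!) v) (i # xs)) \<in> ?A" using p(1) by (simp only:)
  next
    assume "(v, map ((!) v) (i # xs)) \<in> ?A"
    then show "(v, map ((!) v) xs) \<in> drop_pair ` {p \<in> ?A. good i p}"
      by (intro image_eqI[of _ _ "(v, map ((!) v) (i # xs))"]) (auto simp: drop_pair_def good_def)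
  qed
  then show ?case
    using Cons.IH[OF points_ok_step[OF ok]] Cons.prems(2) by (simp add: affine_span_step[OF ok i])
qed

text \<open>The product is spanned by |vs| + |ts| pairs instead of |vs| |ts|, because (u, t) = (u,
  r) + (v, r) + (v, t) for the fixed first elements \<open>v\<close> and \<open>r\<close>. The
  relation is closed under \<open>xor3\<close>, so its list of tuples is its own span.\<close>

lemma affine_span_constrain:
  assumes vs: "\<forall>v \<in> set vs. length v = n" and ts: "\<forall>t \<in> set ts. length t = length xs"
    and closed: "\<forall>p \<in> set ts. \<forall>q \<in> set ts. \<forall>r \<in> set ts. xor3 p q r \<in> set ts"
    and xs: "set xs \<subseteq> {..<n}"
  shows "affine_span xor3 (set (constrain (ts, xs) vs)) =
    {v \<in> affine_span xor3 (set vs). map ((!) v) xs \<in> set ts}"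
proof (cases "vs = [] \<or> ts = []")
  case False
  then obtain v vs' r ts' where Cons: "vs = v # vs'" "ts = r # ts'"
    by (meson neq_Nil_conv)
  let ?A = "(\<lambda>u. (u, r)) ` set vs \<union> (\<lambda>t. (v, t)) ` set ts"
  let ?S = "affine_span xor3_pair ?A"
  have ok: "points_ok n (length xs) ?A"
    using vs ts Cons by (auto simp: points_ok_def)
  have "?S = affine_span xor3 (set vs) \<times> set ts"
  proof (intro equalityI subsetI)
    fix p assume "p \<in> ?S"
    then show "p \<in> affine_span xor3 (set vs) \<times> set ts"
    proof induction
      case (base p)
      then show ?case using Cons by (auto intro: affine_span.base)
    next
      case (closed p q r)
      then show ?case using assms(3) by (auto simp: xor3_pair_def intro: affine_span.closed)
    qed
  next
    fix p assume "p \<in> affine_span xor3 (set vs) \<times> set ts"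
    then obtain u t where p: "p = (u, t)" "u \<in> affine_span xor3 (set vs)" "t \<in> set ts" by auto
    have rr: "xor3 r r r = r" "xor3 r r t = t"
      using ts p Cons by (auto intro!: nth_equalityI simp: nth_xor3)
    have "affine_span xor3_pair ((\<lambda>u. (u, r)) ` set vs) = (\<lambda>u. (u, r)) ` affine_span xor3 (set vs)"
      by (rule affine_span_image) (simp add: xor3_pair_def rr)
    then have "(u, r) \<in> affine_span xor3_pair ((\<lambda>u. (u, r)) ` set vs)" using p by auto
    then have "(u, r) \<in> ?S"
    proof induction
      case (base p)
      then show ?case by (auto intro: affine_span.base)
    qed (rule affine_span.closed)
    moreover have "(v, r) \<in> ?S" "(v, t) \<in> ?S" using p Cons by (auto intro: affine_span.base)
    ultimately have "xor3_pair (u, r) (v, r) (v, t) \<in> ?S" by (rule affine_span.closed)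
    moreover have "length u = n" "length v = n"
      using affine_span_vecs[OF vs p(2)] vs Cons by auto
    then have "xor3 u v v = u" by (auto intro!: nth_equalityI simp: nth_xor3)
    ultimately show "p \<in> ?S" using p(1) rr by (simp add: xor3_pair_def)
  qed
  then show ?thesis
    using affine_span_equate[of n xs "map (\<lambda>u. (u, r)) vs @ map (\<lambda>t. (v, t)) ts"] ok xs Cons
    by (simp add: constrain_def)
qed (auto simp: constrain_def split: list.splits)

lemma length_step: "length (step i ps) \<le> length ps"
  by (cases rule: step_cases[of ps i]) auto

lemma length_equate: "length (equate xs ps) \<le> length ps"
proof (induction xs arbitrary: ps)
  case (Cons i xs)
  show ?case using order_trans[OF Cons length_step] by simp
qed simp

text \<open>Growth is additive: after all constraints the length is at most the initial one plus the
  total number of listed tuples. This keeps the algorithm polynomial although the points may be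
  affinely dependent.\<close>

lemma length_constrain: "length (constrain c vs) \<le> length vs + length (fst c)"
proof (cases "vs = [] \<or> fst c = []")
  case False
  then obtain v vs' r ts' where "vs = v # vs'" "fst c = r # ts'"
    by (meson neq_Nil_conv)
  then show ?thesis
    using length_equate[of "snd c" "map (\<lambda>v. (v, r)) vs @ map (\<lambda>t. (v, t)) (fst c)"]
    by (simp add: constrain_def)
qed (auto simp: constrain_def split: list.splits)

lemma constrain_vecs:
  assumes "\<forall>v \<in> set vs. length v = n" "\<forall>t \<in> set ts. length t = length xs"
  shows "\<forall>v \<in> set (constrain (ts, xs) vs). length v = n"
proof -
  have equate: "\<forall>v \<in> set (equate xs ps). length v = n" if "points_ok n (length xs) (set ps)" for ps
    using that
  proof (induction xs arbitrary: ps)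
    case (Cons i xs)
    then show ?case using points_ok_step[of n "length xs" ps i] by simp
  qed (auto simp: points_ok_def)
  show ?thesis
  proof (cases "vs = [] \<or> ts = []")
    case False
    then obtain v vs' r ts' where Cons: "vs = v # vs'" "ts = r # ts'"
      by (meson neq_Nil_conv)
    let ?ps = "map (\<lambda>v. (v, r)) vs @ map (\<lambda>t. (v, t)) ts"
    have "length v = n" "length r = length xs" using assms Cons by simp_all
    then have "points_ok n (length xs) (set ?ps)"
      using assms unfolding points_ok_def by (simp add: ball_Un)
    from equate[OF this] show ?thesis by (simp only: constrain_def Cons list.case fst_conv snd_conv)
  qed (auto simp: constrain_def split: list.splits)
qed

fun solve :: "(bool list list \<times> nat list) list \<Rightarrow> bool list list \<Rightarrow> bool list list" where
  "solve [] vs = vs"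
| "solve (c # cs) vs = solve cs (constrain c vs)"

lemma affine_span_solve:
  assumes "\<forall>v \<in> set vs. length v = n"
    and "\<forall>(ts, xs) \<in> set cs. (\<forall>t \<in> set ts. length t = length xs) \<and> set xs \<subseteq> {..<n} \<and>
      (\<forall>p \<in> set ts. \<forall>q \<in> set ts. \<forall>r \<in> set ts. xor3 p q r \<in> set ts)"
  shows "(\<forall>v \<in> set (solve cs vs). length v = n) \<and> affine_span xor3 (set (solve cs vs)) =
    {v \<in> affine_span xor3 (set vs). \<forall>(ts, xs) \<in> set cs. map ((!) v) xs \<in> set ts}"
  using assms
proof (induction cs arbitrary: vs)
  case (Cons c cs)
  obtain ts xs where c: "c = (ts, xs)" by fastforce
  have *: "\<forall>t \<in> set ts. length t = length xs" "set xs \<subseteq> {..<n}"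
    "\<forall>p \<in> set ts. \<forall>q \<in> set ts. \<forall>r \<in> set ts. xor3 p q r \<in> set ts"
    using Cons.prems(2) c by auto
  show ?case
    using Cons.IH[of "constrain c vs"] Cons.prems constrain_vecs[OF Cons.prems(1) *(1)]
      affine_span_constrain[OF Cons.prems(1) *(1,3,2)]
    by (auto simp: c)
qed simp

subsection \<open>Enumeration of the squarefree monomials\<close>

text \<open>The lists beginning with \<open>False\<close> come first because x_1 is the greatest
  variable. The result is in increasing lexicographic order, on which the search for a least match
  relies.\<close>

fun combos :: "nat \<Rightarrow> nat \<Rightarrow> bool list list" where
  "combos 0 0 = [[]]"
| "combos 0 (Suc k) = []"
| "combos (Suc n) 0 = map ((#) False) (combos n 0)"
| "combos (Suc n) (Suc k) = map ((#) False) (combos n (Suc k)) @ map ((#) True) (combos n k)"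

lemma set_combos: "set (combos n k) = {u. length u = n \<and> weight u = k}"
proof (induction n k rule: combos.induct)
  case 1
  show ?case by auto
next
  case (2 k)
  show ?case by auto
next
  case (3 n)
  have "u \<in> (#) False ` {u. length u = n \<and> weight u = 0} \<longleftrightarrow> length u = Suc n \<and> weight u = 0" for u
    by (cases u) auto
  then show ?case using 3 by auto
next
  case (4 n k)
  have "u \<in> (#) False ` {u. length u = n \<and> weight u = Suc k} \<union> (#) True ` {u. length u = n \<and> weight u = k}
      \<longleftrightarrow> length u = Suc n \<and> weight u = Suc k" for u
    by (cases u) auto
  then show ?case using 4 by auto
qed

fun sqfrees :: "nat \<Rightarrow> nat \<Rightarrow> bool list list" where
  "sqfrees n 0 = combos n 0"
| "sqfrees n (Suc d) = sqfrees n d @ combos n (Suc d)"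

lemma set_sqfrees: "set (sqfrees n d) = {u. length u = n \<and> weight u \<le> d}"
  by (induction d) (auto simp: set_combos le_Suc_eq)

lemma lex_less_Cons:
  assumes "length u = length v"
  shows "sqfree_monom (a # u) < sqfree_monom (b # v) \<longleftrightarrow> (\<not> a \<and> b) \<or> (a = b \<and> sqfree_monom u < sqfree_monom v)"
proof -
  have ex: "(\<exists>i. Q i) \<longleftrightarrow> Q 0 \<or> (\<exists>i. Q (Suc i))" for Q :: "nat \<Rightarrow> bool"
    by (metis not0_implies_Suc)
  show ?thesis
    unfolding lex_less_conv[symmetric] lex_less_def
    by (subst ex) (auto simp: lookup_sqfree_monom All_less_Suc2 of_bool_def)
qed

lemma sorted_combos: "sorted_wrt (\<lambda>u v. sqfree_monom u < sqfree_monom v) (combos n k)"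
proof (induction n k rule: combos.induct)
  case (3 n)
  have "sorted_wrt (\<lambda>u v. sqfree_monom (False # u) < sqfree_monom (False # v)) (combos n 0)"
    by (rule sorted_wrt_mono_rel[OF _ 3]) (auto simp: set_combos lex_less_Cons)
  then show ?case by (simp add: sorted_wrt_map)
next
  case (4 n k)
  have "sorted_wrt (\<lambda>u v. sqfree_monom (False # u) < sqfree_monom (False # v)) (combos n (Suc k))"
    by (rule sorted_wrt_mono_rel[OF _ 4(1)]) (auto simp: set_combos lex_less_Cons)
  moreover have "sorted_wrt (\<lambda>u v. sqfree_monom (True # u) < sqfree_monom (True # v)) (combos n k)"
    by (rule sorted_wrt_mono_rel[OF _ 4(2)]) (auto simp: set_combos lex_less_Cons)
  ultimately show ?case
    by (auto simp: sorted_wrt_map sorted_wrt_append set_combos lex_less_Cons)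
qed auto

lemma sorted_sqfrees:
  "sorted_wrt (\<lambda>u v. u \<prec> v) (sqfrees n d)"
proof -
  have *: "sorted_wrt (\<lambda>u v. u \<prec> v) (combos n k)" for k
    by (rule sorted_wrt_mono_rel[OF _ sorted_combos]) (auto simp: set_combos grlex_less_conv)
  show ?thesis
  proof (induction d)
    case (Suc d)
    then show ?case using *[of "Suc d"]
      by (auto simp: sorted_wrt_append set_sqfrees set_combos grlex_less_conv)
  qed (simp add: *)
qed

lemma distinct_sqfrees: "distinct (sqfrees n d)"
proof -
  have "distinct xs" if "sorted_wrt (\<lambda>u v. u \<prec> v) xs" for xs
    using that by (induction xs) auto
  then show ?thesis using sorted_sqfrees by blast
qed

lemma distinct_combos: "distinct (combos n k)"
proof -
  have "distinct xs" if "sorted_wrt (\<lambda>u v. sqfree_monom u < sqfree_monom v) xs" for xs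
    using that by (induction xs) auto
  then show ?thesis using sorted_combos by blast
qed

text \<open>The zero vector and the unit vectors span the cube affinely: v is the sum of v without
  bit i, the i-th unit vector and zero. These points are the starting list, before any constraint is
  imposed.\<close>

lemma affine_span_sqfrees_1: "affine_span xor3 (set (sqfrees n 1)) = vecs n"
proof -
  let ?A = "affine_span xor3 (set (sqfrees n 1))"
  have "v \<in> ?A" if "length v = n" for v
    using that
  proof (induction "weight v" arbitrary: v rule: less_induct)
    case less
    show ?case
    proof (cases "weight v = 0")
      case True
      then show ?thesis using less by (intro affine_span.base) (simp del: sqfrees.simps add: set_sqfrees)
    next
      case False
      then obtain i where i: "i < n" "v ! i"
        using less.prems unfolding weight_eq_card by (metis (mono_tags, lifting) card.empty empty_Collect_eq)
      let ?z = "replicate n False"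
      have z: "weight ?z = 0" by (induction n) auto
      have "weight (?z[i := True]) = 1" using weight_update[of i ?z True] i z by simp
      then have "?z \<in> ?A" "?z[i := True] \<in> ?A"
        using z by (auto intro!: affine_span.base simp del: sqfrees.simps simp: set_sqfrees)
      moreover have "v[i := False] \<in> ?A"
        using less.hyps[of "v[i := False]"] less.prems weight_remove[of i v] i by simp
      ultimately have "xor3 (v[i := False]) (?z[i := True]) ?z \<in> ?A" by (metis affine_span.closed)
      moreover have "xor3 (v[i := False]) (?z[i := True]) ?z = v"
        using less.prems i by (intro nth_equalityI) (auto simp: nth_xor3 nth_list_update)
      ultimately show ?thesis by simp
    qed
  qed
  moreover have "length v = n" if "v \<in> ?A" for v
    by (rule affine_span_vecs[OF _ that]) (simp del: sqfrees.simps add: set_sqfrees)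
  ultimately show ?thesis by auto
qed

subsection \<open>Selection of the basis elements\<close>

text \<open>The value \<open>[]\<close> for an exhausted list is a dummy: the searches of the
  algorithm run over lists that contain \<open>S\<close>, which matches itself.\<close>

fun first_match :: "bool list set \<Rightarrow> bool list \<Rightarrow> bool list list \<Rightarrow> bool list" where
  "first_match A S [] = []"
| "first_match A S (T # Ts) = (if matches A S T then T else first_match A S Ts)"

lemma first_match_least:
  assumes "sorted_wrt (\<lambda>u v. u \<prec> v) ms"
    and "U \<in> set ms" "matches A S U"
  shows "first_match A S ms \<in> set ms \<and> matches A S (first_match A S ms) \<and>
    (\<forall>T \<in> set ms. matches A S T \<longrightarrow> T = first_match A S ms \<or>
      (first_match A S ms) \<prec> T)"
  using assms by (induction ms) auto

text \<open>In the graded order a set of size greater than \<open>d\<close> exceeds all sets of size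
  at most \<open>d\<close>, so restricting the search to the latter does not miss the least element
  of the class.\<close>

lemma representative_first_match:
  assumes "length S = n" "weight S \<le> d"
  shows "representative A n S (first_match A S (sqfrees n d))"
proof -
  let ?T = "first_match A S (sqfrees n d)"
  have T: "length ?T = n" "weight ?T \<le> d" "matches A S ?T"
    "\<And>U. length U = n \<Longrightarrow> weight U \<le> d \<Longrightarrow> matches A S U \<Longrightarrow>
      U = ?T \<or> ?T \<prec> U"
    using first_match_least[OF sorted_sqfrees, of S n d A S] assms matches_refl
    by (auto simp: set_sqfrees)
  have "standard A n ?T"
    unfolding standard_def
  proof (intro conjI allI impI)
    fix U assume U: "length U = n \<and> matches A ?T U"
    then have "matches A S U" using T(3) matches_trans by blast
    then show "U = ?T \<or> ?T \<prec> U"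
      using T U by (cases "weight U \<le> d") (auto simp: grlex_less_conv)
  qed (fact T(1))
  then show ?thesis using T by (simp add: representative_def)
qed

lemma standard_first_match:
  assumes "length S = n" "weight S \<le> d"
  shows "standard A n S \<longleftrightarrow> first_match A S (sqfrees n d) = S"
  using representative_first_match[OF assms, of A] representative_unique[of A n S]
  by (metis matches_refl representative_def)

lemma weight_first_match:
  assumes "length S = n" "weight S \<le> d"
  shows "weight (first_match A S (sqfrees n d)) \<le> weight S"
proof (cases "standard A n S")
  case True
  then have "first_match A S (sqfrees n d) = S" by (simp only: standard_first_match[OF assms])
  then show ?thesis by simp
next
  case False
  then show ?thesis
    using representative_less[OF representative_first_match[OF assms, of A] assms(1)]
    by (auto simp: grlex_less_conv)
qed

fun removals :: "bool list \<Rightarrow> bool list list" where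
  "removals [] = []"
| "removals (b # S) = (if b then [False # S] else []) @ map ((#) b) (removals S)"

lemma set_removals: "set (removals S) = {S[i := False] | i. i < length S \<and> S ! i}"
proof (induction S)
  case (Cons b S)
  have ex: "(\<exists>i. Q i) \<longleftrightarrow> Q 0 \<or> (\<exists>i. Q (Suc i))" for Q :: "nat \<Rightarrow> bool"
    by (metis not0_implies_Suc)
  have "R \<in> set (removals (b # S)) \<longleftrightarrow> R \<in> {(b # S)[i := False] | i. i < length (b # S) \<and> (b # S) ! i}" for R
    by (simp only: mem_Collect_eq, subst ex) (auto simp: Cons)
  then show ?case by blast
qed simp

definition basis_terms :: "bool list list \<Rightarrow> bool list \<Rightarrow> bool list \<Rightarrow> bool \<Rightarrow> term_list" where
  "basis_terms us S T c =
     map (\<lambda>u. (basis_coef S T c u, map of_bool u)) (filter (\<lambda>u. basis_coef S T c u \<noteq> 0) us)"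

definition square_terms :: "bool list \<Rightarrow> term_list" where
  "square_terms u = [(1, map (\<lambda>b. 2 * of_bool b) u), (-1, map of_bool u)]"

text \<open>The computable counterpart of \<open>minimal_nonstandard\<close>, with generators
  \<open>A\<close> for the solution set and the list \<open>ms\<close> for all sets.\<close>

definition minimal :: "bool list set \<Rightarrow> bool list list \<Rightarrow> bool list \<Rightarrow> bool" where
  "minimal A ms S \<longleftrightarrow> first_match A S ms \<noteq> S \<and> (\<forall>R \<in> set (removals S). first_match A R ms = R)"

text \<open>The sign is read off at the first generator, since the sum of the parities of matching
  sets is constant on the solutions. \<open>units\<close> is to be empty for d < 2, as the squares
  have degree 2. No generators means no solutions, and then the basis is the constant 1.\<close>

definition basis_output :: "nat \<Rightarrow> bool list list \<Rightarrow> bool list list \<Rightarrow> bool list list \<Rightarrow> term_list list" where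
  "basis_output n ms units gens = (if gens = [] then [[(1, replicate n 0)]] else
     map (\<lambda>S. let T = first_match (set gens) S ms in
         basis_terms ms S T (parity S (hd gens) \<noteq> parity T (hd gens)))
       (filter (minimal (set gens) ms) ms) @
     map square_terms (filter (\<lambda>u. first_match (set gens) u ms = u) units))"

lemma valid_basis_terms: "valid_terms n (basis_terms (sqfrees n d) S T c)"
proof -
  have "inj (of_bool :: bool \<Rightarrow> nat)" by (auto intro!: injI simp: of_bool_def split: if_splits)
  then have "distinct (map (map of_bool :: bool list \<Rightarrow> nat list) (filter Q (sqfrees n d)))" for Q
    unfolding distinct_map using distinct_sqfrees by (auto intro: inj_on_subset inj_mapI)
  then show ?thesis
    by (auto simp: valid_terms_def basis_terms_def o_def set_sqfrees)
qed

text \<open>The sum over all 2^n sets in \<open>sqfree_poly\<close> collapses to the listed ones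
  because coefficients vanish outside the subsets of \<open>S\<close> and of
  \<open>T\<close>.\<close>

lemma poly_of_basis_terms:
  assumes "length S = n" "length T = n" "weight S \<le> d" "weight T \<le> d"
  shows "poly_of_terms (basis_terms (sqfrees n d) S T c) = basis_poly n S T c"
proof -
  let ?h = "\<lambda>u. Poly_Mapping.single (sqfree_monom u) (of_rat (basis_coef S T c u)) :: mpoly"
  have "poly_of_terms (basis_terms (sqfrees n d) S T c) =
      sum_list (map ?h (filter (\<lambda>u. basis_coef S T c u \<noteq> 0) (sqfrees n d)))"
    by (simp add: poly_of_terms_def basis_terms_def o_def sqfree_monom_def)
  also have "\<dots> = sum ?h (set (filter (\<lambda>u. basis_coef S T c u \<noteq> 0) (sqfrees n d)))"
    by (rule sum_list_distinct_conv_sum_set) (simp add: distinct_sqfrees)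
  also have "\<dots> = sum ?h (vecs n)"
  proof (rule sum.mono_neutral_left)
    have "?h u = 0" if "u \<in> vecs n" "\<not> (weight u \<le> d \<and> basis_coef S T c u \<noteq> 0)" for u
    proof (cases "weight u \<le> d")
      case False
      then show ?thesis
        using assms sub_weight[of u S] sub_weight[of u T] by (auto simp: basis_coef_def)
    qed (use that in simp)
    then show "\<forall>u\<in>vecs n - set (filter (\<lambda>u. basis_coef S T c u \<noteq> 0) (sqfrees n d)). ?h u = 0"
      unfolding set_filter set_sqfrees by auto
  qed (auto simp: set_sqfrees)
  finally show ?thesis by (simp add: basis_poly_def sqfree_poly_def)
qed

lemma valid_square_terms:
  assumes "length u = n" "weight u = 1"
  shows "valid_terms n (square_terms u)"
proof -
  obtain i where "i < length u" "u ! i" using weight_1_nth assms(2) by blast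
  then have "map (\<lambda>b. 2 * of_bool b) u ! i \<noteq> (map of_bool u ! i :: nat)" by simp
  then have "map (\<lambda>b. 2 * of_bool b) u \<noteq> (map of_bool u :: nat list)" by metis
  then show ?thesis using assms by (simp add: valid_terms_def square_terms_def)
qed

lemma poly_of_square_terms: "poly_of_terms (square_terms u) = square_poly u"
proof -
  have "Poly_Mapping.nth (map (\<lambda>b. 2 * of_bool b) u) = sqfree_monom u + sqfree_monom u"
    by (rule poly_mapping_eqI) (simp add: lookup_add lookup_sqfree_monom nth_default_def)
  then show ?thesis
    by (simp add: poly_of_terms_def square_terms_def square_poly_def sqfree_monom_def single_uminus)
qed

lemma truncation_square_poly:
  assumes "weight u = 1" "length u = n"
  shows "square_poly u \<in> polys_upto n d \<longleftrightarrow> 2 \<le> d"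
  using assms by (auto simp: polys_upto_def square_poly_in_polys square_poly_keys monom_degree_add)

text \<open>In a graded order the leading monomial has the degree of the whole polynomial.\<close>

lemma truncation_basis_poly:
  assumes "length S = n" "length T = n" "T \<prec> S"
  shows "basis_poly n S T c \<in> polys_upto n d \<longleftrightarrow> weight S \<le> d"
proof -
  have nz: "basis_poly n S T c \<noteq> 0"
    using lead_basis_poly(2)[OF assms, of c] by (auto simp: lead_coef_def)
  note lead = lead_monom_nonzero[OF nz, unfolded lead_basis_poly(1)[OF assms]]
  have "monom_degree m \<le> weight S" if "m \<in> keys (basis_poly n S T c)" for m
    using lead(2)[OF that] by (cases "m = sqfree_monom S") (auto simp: grlex_less_conv)
  moreover have "basis_poly n S T c \<in> polys n" by (simp add: basis_poly_def sqfree_poly_in_polys)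
  ultimately show ?thesis
    using lead(1) by (auto simp: polys_upto_def) force+
qed

lemma standard_matches_cong:
  assumes "\<And>T U. length T = n \<Longrightarrow> length U = n \<Longrightarrow> matches V T U = matches A T U"
  shows "standard V n S \<longleftrightarrow> standard A n S"
  using assms unfolding standard_def by metis

theorem encodes_basis_output:
  assumes gens: "\<forall>v \<in> set gens. length v = n" and V: "V = affine_span xor3 (set gens)"
    and units: "units = (if 2 \<le> d then combos n 1 else [])"
  shows "encodes_polys n (truncation n d (reduced_basis n V))
    (enc_list enc_terms (basis_output n (sqfrees n d) units gens))"
proof (cases "gens = []")
  case True
  have z: "Poly_Mapping.nth (replicate n (0 :: nat)) = 0"
    by (rule poly_mapping_eqI) (simp add: nth_default_def)
  have "truncation n d (reduced_basis n V) = {1}"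
    by (auto simp: truncation_def reduced_basis_def V True polys_upto_def polys_def monom_degree_def)
  then show ?thesis
    unfolding encodes_polys_def
    by (intro exI[of _ "[[(1, replicate n 0)]]"])
      (simp add: basis_output_def True valid_terms_def poly_of_terms_def z)
next
  case False
  let ?ms = "sqfrees n d" and ?A = "set gens"
  have matches: "matches V T U = matches ?A T U" if "length T = n" "length U = n" for T U
    unfolding V by (rule matches_affine_span[OF gens that])
  have std: "standard V n S \<longleftrightarrow> standard ?A n S" for S
    by (rule standard_matches_cong) (rule matches)
  have first: "first_match ?A S ?ms = S \<longleftrightarrow> standard V n S" if "length S = n" "weight S \<le> d" for S
    using standard_first_match[OF that, of ?A] std by simp
  have rep: "representative V n S (first_match ?A S ?ms)" if "length S = n" "weight S \<le> d" for S
    using representative_first_match[OF that, of ?A] std matches that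
    by (auto simp: representative_def standard_def)
  have min: "minimal ?A ?ms S \<longleftrightarrow> minimal_nonstandard V n S" if S: "length S = n" "weight S \<le> d" for S
  proof -
    have "first_match ?A R ?ms = R \<longleftrightarrow> standard V n R" if "R \<in> set (removals S)" for R
    proof (rule first)
      obtain i where "i < length S" "S ! i" "R = S[i := False]" using \<open>R \<in> _\<close> by (auto simp: set_removals)
      then show "length R = n" "weight R \<le> d" using S weight_remove[of i S] by auto
    qed
    then show ?thesis
      using S by (auto simp: minimal_def minimal_nonstandard_def first set_removals)
  qed
  have hd: "hd gens \<in> V" using False by (simp add: V affine_span.base)
  then have Vne: "V \<noteq> {}" by blast
  let ?T = "\<lambda>S. first_match ?A S ?ms"
  let ?c = "\<lambda>S. parity S (hd gens) \<noteq> parity (?T S) (hd gens)"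
  let ?Ss = "filter (minimal ?A ?ms) ?ms" and ?us = "filter (\<lambda>u. ?T u = u) units"
  have Ss: "length S = n" "weight S \<le> d" "minimal_nonstandard V n S" "length (?T S) = n"
      "(?T S) \<prec> S" "weight (?T S) \<le> d"
      "representative V n S (?T S)" "\<forall>p \<in> V. (parity S p \<noteq> parity (?T S) p) = ?c S"
    if "S \<in> set ?Ss" for S
  proof -
    show S: "length S = n" "weight S \<le> d" "minimal_nonstandard V n S"
      using that min by (auto simp: set_sqfrees)
    show r: "representative V n S (?T S)" by (rule rep[OF S(1,2)])
    show "length (?T S) = n" using r by (simp add: representative_def standard_def)
    have "\<not> standard V n S" using S(3) by (simp add: minimal_nonstandard_def)
    then show "(?T S) \<prec> S"
      by (rule representative_less[OF r S(1)])
    then show "weight (?T S) \<le> d" using S by (auto simp: grlex_less_conv)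
    show "\<forall>p \<in> V. (parity S p \<noteq> parity (?T S) p) = ?c S"
      using r hd unfolding representative_def matches_def by metis
  qed
  have us: "length u = n" "weight u = 1" "standard V n u" "2 \<le> d" if "u \<in> set ?us" for u
    using that first by (auto simp: units set_combos split: if_splits)
  let ?P = "\<lambda>S. basis_poly n S (?T S) (?c S)"
  let ?out = "map (\<lambda>S. basis_terms ?ms S (?T S) (?c S)) ?Ss @ map square_terms ?us"
  have out: "basis_output n ?ms units gens = ?out"
    by (simp add: basis_output_def False Let_def)
  have polys: "map poly_of_terms ?out = map ?P ?Ss @ map square_poly ?us"
    using Ss by (auto simp: poly_of_basis_terms poly_of_square_terms simp del: set_filter)
  \<comment> \<open>The listed polynomials are distinguished by their leading monomials, which are
    easier to compare than the polynomials.\<close>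
  have "map lead_monom (map ?P ?Ss @ map square_poly ?us) =
      map sqfree_monom ?Ss @ map (\<lambda>u. sqfree_monom u + sqfree_monom u) ?us"
    using Ss us by (auto simp: lead_basis_poly square_poly_keys simp del: set_filter)
  moreover have "distinct (map sqfree_monom ?Ss @ map (\<lambda>u. sqfree_monom u + sqfree_monom u) ?us)"
  proof -
    have "inj_on sqfree_monom (set ?Ss)"
      using Ss(1) by (intro inj_onI sqfree_monom_inj) auto
    moreover have "inj_on (\<lambda>u. sqfree_monom u + sqfree_monom u) (set ?us)"
    proof (rule inj_onI)
      fix u v assume *: "u \<in> set ?us" "v \<in> set ?us"
        "sqfree_monom u + sqfree_monom u = sqfree_monom v + sqfree_monom v"
      have "sqfree_monom u = sqfree_monom v"
      proof (rule poly_mapping_eqI)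
        fix i show "lookup (sqfree_monom u) i = lookup (sqfree_monom v) i"
          using arg_cong[OF *(3), of "\<lambda>m. lookup m i"] by (simp add: lookup_add)
      qed
      then show "u = v" using us(1) * by (intro sqfree_monom_inj) auto
    qed
    moreover have "sqfree_monom S \<noteq> sqfree_monom u + sqfree_monom u" if u: "u \<in> set ?us" for S u
    proof
      assume eq: "sqfree_monom S = sqfree_monom u + sqfree_monom u"
      obtain i where "i < length u" "u ! i"
        using weight_1_nth us(2)[OF u] by blast
      then show False
        using arg_cong[OF eq, of "\<lambda>m. lookup m i"]
        by (simp add: lookup_add lookup_sqfree_monom of_bool_def split: if_splits)
    qed
    moreover have "distinct ?Ss" "distinct ?us"
      by (auto simp: distinct_sqfrees distinct_combos units)
    ultimately show ?thesis by (auto simp: distinct_map simp del: set_filter)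
  qed
  ultimately have "distinct (map lead_monom (map ?P ?Ss @ map square_poly ?us))"
    by (simp only:)
  then have dist: "distinct (map poly_of_terms ?out)"
    unfolding polys distinct_map[of lead_monom] by (rule conjunct1)
  have "set (map poly_of_terms ?out) = truncation n d (reduced_basis n V)"
  proof (intro equalityI subsetI)
    fix g assume "g \<in> set (map poly_of_terms ?out)"
    then consider S where "S \<in> set ?Ss" "g = ?P S" | u where "u \<in> set ?us" "g = square_poly u"
      unfolding polys by (auto simp del: set_filter)
    then show "g \<in> truncation n d (reduced_basis n V)"
    proof cases
      case 1
      have "g \<in> reduced_basis n V"
        using Ss[OF 1(1)] 1(2) Vne unfolding reduced_basis_def by (simp only: if_False) blast
      then show ?thesis
        using truncation_basis_poly Ss[OF 1(1)] 1(2) by (simp add: truncation_def)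
    next
      case 2
      have "g \<in> reduced_basis n V"
        using us[OF 2(1)] 2(2) Vne unfolding reduced_basis_def by (simp only: if_False) blast
      then show ?thesis
        using truncation_square_poly us[OF 2(1)] 2(2) by (simp add: truncation_def)
    qed
  next
    fix g assume "g \<in> truncation n d (reduced_basis n V)"
    then have g: "g \<in> reduced_basis n V" "g \<in> polys_upto n d" by (auto simp: truncation_def)
    from g(1) Vne show "g \<in> set (map poly_of_terms ?out)"
    proof (cases rule: reduced_basis_cases)
      case (1 u)
      have u: "length u = n" using 1(2) by (simp add: standard_def)
      then have d: "2 \<le> d" using g(2) 1 truncation_square_poly by simp
      then have "u \<in> set ?us" using 1 u first by (simp add: units set_combos)
      then show ?thesis unfolding polys using 1(3) by (simp del: set_filter)
    next
      case (2 S T c)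
      have S: "length S = n" "\<not> standard V n S" using 2(1) by (auto simp: minimal_nonstandard_def)
      have T: "length T = n" using 2(2) by (simp add: representative_def standard_def)
      have w: "weight S \<le> d"
        using truncation_basis_poly[OF S(1) T representative_less[OF 2(2) S]] g(2) 2(4) by simp
      then have "S \<in> set ?Ss" using min[OF S(1) w] 2(1) S(1) by (simp add: set_sqfrees)
      moreover have "T = ?T S" by (rule representative_unique[OF 2(2) rep[OF S(1) w]])
      moreover from this have "c = ?c S" using 2(3) hd by blast
      ultimately show ?thesis unfolding polys 2(4) by (simp del: set_filter)
    qed
  qed
  moreover have "\<forall>ts \<in> set ?out. valid_terms n ts"
    using us by (auto simp: valid_basis_terms valid_square_terms simp del: set_filter)
  ultimately show ?thesis
    unfolding encodes_polys_def out using dist by blast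
qed

section \<open>The program\<close>

definition ev :: "program \<Rightarrow> tree list \<Rightarrow> expr \<Rightarrow> tree \<Rightarrow> nat \<Rightarrow> bool" where
  "ev P env e v k \<longleftrightarrow> (\<exists>k' \<le> k. eval P env e v k')"

definition ev_args :: "program \<Rightarrow> tree list \<Rightarrow> expr list \<Rightarrow> tree list \<Rightarrow> nat \<Rightarrow> bool" where
  "ev_args P env es vs k \<longleftrightarrow> (\<exists>k' \<le> k. eval_args P env es vs k')"

definition fn :: "program \<Rightarrow> nat \<Rightarrow> tree list \<Rightarrow> tree \<Rightarrow> nat \<Rightarrow> bool" where
  "fn P f vs v k \<longleftrightarrow> f < length P \<and> ev P vs (P ! f) v k"

text \<open>The opening step of most execution proofs below: value and step count become unknowns
  that the syntax-directed rules build up, and both are compared with the claimed ones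
  afterwards.\<close>

lemma ev_mono: "ev P env e v k \<Longrightarrow> v = v' \<Longrightarrow> k \<le> k' \<Longrightarrow> ev P env e v' k'"
  unfolding ev_def using le_trans by blast

lemma fn_mono: "fn P f vs v k \<Longrightarrow> v = v' \<Longrightarrow> k \<le> k' \<Longrightarrow> fn P f vs v' k'"
  unfolding fn_def using ev_mono by blast

lemma ev_Var: "i < length env \<Longrightarrow> ev P env (EVar i) (env ! i) 1"
  unfolding ev_def using eval_Var by blast

lemma ev_Vars:
  "ev P (a0 # env) (EVar 0) a0 1"
  "ev P (a0 # a1 # env) (EVar 1) a1 1"
  "ev P (a0 # a1 # a2 # env) (EVar 2) a2 1"
  "ev P (a0 # a1 # a2 # a3 # env) (EVar 3) a3 1"
  "ev P (a0 # a1 # a2 # a3 # a4 # env) (EVar 4) a4 1"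
  using ev_Var[of 0 "a0 # env" P] ev_Var[of 1 "a0 # a1 # env" P]
    ev_Var[of 2 "a0 # a1 # a2 # env" P] ev_Var[of 3 "a0 # a1 # a2 # a3 # env" P]
    ev_Var[of 4 "a0 # a1 # a2 # a3 # a4 # env" P]
  by simp_all

lemma ev_Atom: "ev P env EAtom Atom 1"
  unfolding ev_def using eval_Atom by blast

lemma ev_Pair: "ev P env e1 v1 k1 \<Longrightarrow> ev P env e2 v2 k2 \<Longrightarrow> ev P env (EPair e1 e2) (Pair v1 v2) (1 + k1 + k2)"
  unfolding ev_def by (meson add_le_mono eval_Pair le_refl)

lemma ev_Head: "ev P env e (Pair a b) k \<Longrightarrow> ev P env (EHead e) a (1 + k)"
  unfolding ev_def by (metis add_le_cancel_left eval_Head head.simps(2))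

lemma ev_Tail: "ev P env e (Pair a b) k \<Longrightarrow> ev P env (ETail e) b (1 + k)"
  unfolding ev_def by (metis add_le_cancel_left eval_Tail tail.simps(2))

text \<open>For arguments that are not visibly a pair, such as a unary number given by a
  formula.\<close>

lemma ev_Tail_gen: "ev P env e v k \<Longrightarrow> ev P env (ETail e) (tail v) (1 + k)"
  unfolding ev_def by (metis add_le_cancel_left eval_Tail)

lemma ev_If_Pair: "ev P env e (Pair a b) k \<Longrightarrow> ev P env e1 v k1 \<Longrightarrow> ev P env (EIf e e1 e2) v (1 + k + k1)"
  unfolding ev_def by (meson add_le_mono eval_If_Pair le_refl tree.distinct(2))

lemma ev_If_Atom: "ev P env e Atom k \<Longrightarrow> ev P env e2 v k2 \<Longrightarrow> ev P env (EIf e e1 e2) v (1 + k + k2)"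
  unfolding ev_def by (meson add_le_mono eval_If_Atom le_refl)

lemma ev_Call: "ev_args P env es vs k \<Longrightarrow> fn P f vs v k' \<Longrightarrow> ev P env (ECall f es) v (1 + k + k')"
  unfolding ev_def ev_args_def fn_def by (meson add_le_mono eval_Call le_refl)

lemma ev_args_Nil: "ev_args P env [] [] 0"
  unfolding ev_args_def using eval_args_Nil by blast

lemma ev_args_Cons: "ev P env e v k \<Longrightarrow> ev_args P env es vs k' \<Longrightarrow> ev_args P env (e # es) (v # vs) (k + k')"
  unfolding ev_def ev_args_def by (meson add_le_mono eval_args_Cons)

lemma ev_Let: "ev P env e1 v1 k1 \<Longrightarrow> ev P (v1 # env) e2 v2 k2 \<Longrightarrow> ev P env (ELet e1 e2) v2 (1 + k1 + k2)"
  unfolding ev_def by (meson add_le_mono eval_Let le_refl)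

text \<open>Copies of \<open>EIf\<close> and of the truth values for Boolean data, so that the syntax of a program
  determines the evaluation rule.\<close>

definition EIfB :: "expr \<Rightarrow> expr \<Rightarrow> expr \<Rightarrow> expr" where
  "EIfB = EIf"

definition ETrue :: expr where
  "ETrue = EPair EAtom EAtom"

definition EFalse :: expr where
  "EFalse = EAtom"

definition EXor :: "expr \<Rightarrow> expr \<Rightarrow> expr" where
  "EXor a b = EIfB a (EIfB b EFalse ETrue) b"

definition ENot :: "expr \<Rightarrow> expr" where
  "ENot a = EIfB a EFalse ETrue"

lemma ev_True: "ev P env ETrue (enc_bool True) 3"
  unfolding ETrue_def enc_bool_def by (rule ev_mono, (rule ev_Pair ev_Atom)+) simp_all

lemma ev_False: "ev P env EFalse (enc_bool False) 1"
  unfolding EFalse_def enc_bool_def by (rule ev_mono, rule ev_Atom) simp_all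

text \<open>Both branches are charged, although one is executed, so that no case distinction arises;
  a branch has to evaluate only if it is taken.\<close>

lemma ev_IfB:
  assumes "ev P env c (enc_bool b) k" "b \<Longrightarrow> ev P env e1 r1 k1" "\<not> b \<Longrightarrow> ev P env e2 r2 k2"
  shows "ev P env (EIfB c e1 e2) (if b then r1 else r2) (1 + k + k1 + k2)"
proof (cases b)
  case True
  then have "ev P env (EIfB c e1 e2) r1 (1 + k + k1)"
    using assms unfolding EIfB_def by (intro ev_If_Pair) (auto simp: enc_bool_def)
  then show ?thesis by (rule ev_mono) (use True in auto)
next
  case False
  then have "ev P env (EIfB c e1 e2) r2 (1 + k + k2)"
    using assms unfolding EIfB_def by (intro ev_If_Atom) (auto simp: enc_bool_def)
  then show ?thesis by (rule ev_mono) (use False in auto)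
qed

text \<open>For a failed test where the calls in the first branch have hypotheses that cannot be
  ensured for the present arguments.\<close>

lemma ev_IfB_False:
  "ev P env c (enc_bool b) k \<Longrightarrow> \<not> b \<Longrightarrow> ev P env e2 r k2 \<Longrightarrow> ev P env (EIfB c e1 e2) r (1 + k + k2)"
  unfolding EIfB_def by (rule ev_If_Atom) (simp_all add: enc_bool_def)

lemma ev_Not: "ev P env a (enc_bool x) k \<Longrightarrow> ev P env (ENot a) (enc_bool (\<not> x)) (k + 5)"
  unfolding ENot_def by (rule ev_mono, rule ev_IfB ev_False ev_True, assumption, rule ev_False, rule ev_True) auto

text \<open>\<open>b\<close> occurs twice in the code of \<open>EXor\<close> but is evaluated once.
  Charging it twice, as \<open>ev_IfB\<close> would, doubles the bound with every recursive call in
  functions such as \<open>f_parity\<close> and makes it exponential.\<close>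

lemma ev_Xor:
  assumes a: "ev P env a (enc_bool x) k1" and b: "ev P env b (enc_bool y) k2"
  shows "ev P env (EXor a b) (enc_bool (x \<noteq> y)) (k1 + k2 + 6)"
proof (cases x)
  case True
  have "ev P env (EIfB b EFalse ETrue) (enc_bool (\<not> y)) (k2 + 5)"
    using ev_Not[OF b] by (simp add: ENot_def)
  then have "ev P env (EXor a b) (enc_bool (\<not> y)) (1 + k1 + (k2 + 5))"
    using a True unfolding EXor_def EIfB_def by (intro ev_If_Pair) (auto simp: enc_bool_def)
  then show ?thesis by (rule ev_mono) (use True in auto)
next
  case False
  then have "ev P env (EXor a b) (enc_bool y) (1 + k1 + k2)"
    using a b unfolding EXor_def EIfB_def by (intro ev_If_Atom) (auto simp: enc_bool_def)
  then show ?thesis by (rule ev_mono) (use False in auto)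
qed

definition EAnd :: "expr \<Rightarrow> expr \<Rightarrow> expr" where
  "EAnd a b = EIfB a b EFalse"

lemma ev_And:
  assumes "ev P env a (enc_bool x) k1" "ev P env b (enc_bool y) k2"
  shows "ev P env (EAnd a b) (enc_bool (x \<and> y)) (k1 + k2 + 2)"
  unfolding EAnd_def by (rule ev_mono, (rule ev_IfB ev_False assms)+) auto

lemmas ev_rules = ev_Vars ev_Let ev_And ev_Atom ev_Pair ev_Head ev_Tail ev_Call ev_args_Nil ev_args_Cons
  ev_True ev_False ev_IfB ev_Not ev_Xor

abbreviation enc_bools :: "bool list \<Rightarrow> tree" where
  "enc_bools \<equiv> enc_list enc_bool"

abbreviation enc_vecs :: "bool list list \<Rightarrow> tree" where
  "enc_vecs \<equiv> enc_list enc_bools"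

definition enc_point :: "point \<Rightarrow> tree" where
  "enc_point p = Pair (enc_bools (fst p)) (enc_bools (snd p))"

lemma enc_point_Pair: "enc_point (v, r) = Pair (enc_bools v) (enc_bools r)"
  by (simp add: enc_point_def)

definition enc_cstr :: "bool list list \<times> nat list \<Rightarrow> tree" where
  "enc_cstr c = Pair (enc_vecs (fst c)) (enc_list enc_unary (snd c))"

lemma enc_unary_simps: "enc_unary 0 = Atom" "enc_unary (Suc n) = Pair Atom (enc_unary n)"
proof -
  have "enc_list (\<lambda>_. Atom) xs = enc_list (\<lambda>_. Atom) ys" if "length xs = length ys" for xs ys :: "nat list"
    using that by (induction xs ys rule: list_induct2) auto
  from this[of "[Suc 0..<Suc n]" "[0..<n]"]
  show "enc_unary 0 = Atom" "enc_unary (Suc n) = Pair Atom (enc_unary n)"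
    by (simp_all add: enc_unary_def upt_conv_Cons del: upt_Suc)
qed

section \<open>Indices of the functions in the program\<close>

abbreviation (input) "f_main \<equiv> 0 :: nat"
abbreviation (input) "f_mapcons \<equiv> 1 :: nat"
abbreviation (input) "f_append \<equiv> 2 :: nat"
abbreviation (input) "f_combos \<equiv> 3 :: nat"
abbreviation (input) "f_sqfrees \<equiv> 4 :: nat"
abbreviation (input) "f_xor3 \<equiv> 5 :: nat"
abbreviation (input) "f_good \<equiv> 6 :: nat"
abbreviation (input) "f_find \<equiv> 7 :: nat"
abbreviation (input) "f_correct \<equiv> 8 :: nat"
abbreviation (input) "f_step \<equiv> 9 :: nat"
abbreviation (input) "f_step_with \<equiv> 10 :: nat"
abbreviation (input) "f_equate \<equiv> 11 :: nat"
abbreviation (input) "f_firsts \<equiv> 12 :: nat"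
abbreviation (input) "f_pair_with \<equiv> 13 :: nat"
abbreviation (input) "f_constrain \<equiv> 14 :: nat"
abbreviation (input) "f_solve \<equiv> 15 :: nat"
abbreviation (input) "f_parity \<equiv> 16 :: nat"
abbreviation (input) "f_agree \<equiv> 17 :: nat"
abbreviation (input) "f_matches \<equiv> 18 :: nat"
abbreviation (input) "f_first_match \<equiv> 19 :: nat"
abbreviation (input) "f_equal \<equiv> 20 :: nat"
abbreviation (input) "f_removals \<equiv> 21 :: nat"
abbreviation (input) "f_standard \<equiv> 22 :: nat"
abbreviation (input) "f_all_standard \<equiv> 23 :: nat"
abbreviation (input) "f_minimal \<equiv> 24 :: nat"
abbreviation (input) "f_sub \<equiv> 25 :: nat"
abbreviation (input) "f_weight \<equiv> 26 :: nat"
abbreviation (input) "f_diff \<equiv> 27 :: nat"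
abbreviation (input) "f_power \<equiv> 28 :: nat"
abbreviation (input) "f_odd \<equiv> 29 :: nat"
abbreviation (input) "f_rat \<equiv> 30 :: nat"
abbreviation (input) "f_terms \<equiv> 31 :: nat"
abbreviation (input) "f_term \<equiv> 32 :: nat"
abbreviation (input) "f_polys \<equiv> 33 :: nat"
abbreviation (input) "f_poly \<equiv> 34 :: nat"
abbreviation (input) "f_poly_of \<equiv> 35 :: nat"
abbreviation (input) "f_double \<equiv> 36 :: nat"
abbreviation (input) "f_squares \<equiv> 37 :: nat"
abbreviation (input) "f_square \<equiv> 38 :: nat"
abbreviation (input) "f_square_of \<equiv> 39 :: nat"
abbreviation (input) "f_output \<equiv> 40 :: nat"

abbreviation (input) "V0 \<equiv> EVar 0"
abbreviation (input) "V1 \<equiv> EVar 1"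
abbreviation (input) "V2 \<equiv> EVar 2"
abbreviation (input) "V3 \<equiv> EVar 3"
abbreviation (input) "V4 \<equiv> EVar 4"

section \<open>Code of the functions\<close>

definition "b_mapcons = EIf V1 (EPair (EPair V0 (EHead V1)) (ECall f_mapcons [V0, ETail V1, V2])) V2"

definition "b_append = EIf V0 (EPair (EHead V0) (ECall f_append [ETail V0, V1])) V1"

definition "b_combos = EIf V0
  (EIf V1
    (ECall f_mapcons [EFalse, ECall f_combos [ETail V0, V1],
      ECall f_mapcons [ETrue, ECall f_combos [ETail V0, ETail V1], EAtom]])
    (ECall f_mapcons [EFalse, ECall f_combos [ETail V0, V1], EAtom]))
  (EIf V1 EAtom (EPair EAtom EAtom))"

definition "b_sqfrees = EIf V1
  (ECall f_sqfrees [V0, ETail V1, ECall f_append [ECall f_combos [V0, V1], V2]])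
  (ECall f_append [ECall f_combos [V0, V1], V2])"

definition "b_xor3 = EIf V0
  (EPair (EXor (EHead V0) (EXor (EHead V1) (EHead V2))) (ECall f_xor3 [ETail V0, ETail V1, ETail V2]))
  EAtom"

definition "b_good = EIf V1 (ECall f_good [ETail V0, ETail V1, V2]) (ENot (EXor (EHead V0) V2))"

definition "b_find = EIf V1
  (EIfB (EXor V0 (ECall f_good [EHead (EHead V1), V2, EHead (ETail (EHead V1))]))
    (ECall f_find [V0, ETail V1, V2]) V1)
  EAtom"

definition "b_correct = EIf V0
  (EPair
    (EIfB (ECall f_good [EHead (EHead V0), V1, EHead (ETail (EHead V0))])
      (EPair (EHead (EHead V0)) (ETail (ETail (EHead V0))))
      (EPair (ECall f_xor3 [EHead (EHead V0), EHead V2, EHead V3])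
        (ECall f_xor3 [ETail (ETail (EHead V0)), ETail (ETail V2), ETail (ETail V3)])))
    (ECall f_correct [ETail V0, V1, V2, V3]))
  EAtom"

definition "b_step = ECall f_step_with
  [V0, V1, ECall f_find [ETrue, V0, V1], ECall f_find [EFalse, V0, V1]]"

definition "b_step_with = EIf V2
  (EIf V3 (ECall f_correct [V0, V1, EHead V2, EHead V3]) (ECall f_correct [V0, V1, EHead V2, EHead V2]))
  EAtom"

definition "b_equate = EIf V0 (ECall f_equate [ETail V0, ECall f_step [V1, EHead V0]]) (ECall f_firsts [V1])"

definition "b_firsts = EIf V0 (EPair (EHead (EHead V0)) (ECall f_firsts [ETail V0])) EAtom"

definition "b_pair_with = EIf V0
  (EPair (EPair (EHead V0) V1) (ECall f_pair_with [ETail V0, V1, V2])) V2"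

definition "b_constrain = EIf V1
  (EIf (EHead V0)
    (ECall f_equate [ETail V0, ECall f_pair_with [V1, EHead (EHead V0),
      ECall f_mapcons [EHead V1, EHead V0, EAtom]]])
    EAtom)
  EAtom"

definition "b_solve = EIf V0 (ECall f_solve [ETail V0, ECall f_constrain [EHead V0, V1]]) V1"

definition "b_parity = EIf V0
  (EXor (EAnd (EHead V0) (EHead V1)) (ECall f_parity [ETail V0, ETail V1])) EFalse"

definition "b_agree = EIf V2
  (EIfB (EXor V3 (EXor (ECall f_parity [V0, EHead V2]) (ECall f_parity [V1, EHead V2])))
    EFalse (ECall f_agree [V0, V1, ETail V2, V3]))
  ETrue"

definition "b_matches = ECall f_agree [V0, V1, V2,
  EXor (ECall f_parity [V0, EHead V2]) (ECall f_parity [V1, EHead V2])]"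

definition "b_first_match = EIf V1
  (EIfB (ECall f_matches [V0, EHead V1, V2]) (EHead V1) (ECall f_first_match [V0, ETail V1, V2]))
  EAtom"

definition "b_equal = EIf V0
  (EIfB (EXor (EHead V0) (EHead V1)) EFalse (ECall f_equal [ETail V0, ETail V1])) ETrue"

text \<open>The recursive call is bound before the test. Written in both branches it would be
  charged twice by \<open>ev_IfB\<close>, with an exponential bound as the result;
  \<open>b_weight\<close> follows the same pattern.\<close>

definition "b_removals = EIf V0
  (ELet (ECall f_mapcons [EHead V0, ECall f_removals [ETail V0], EAtom])
    (EIfB (EHead V1) (EPair (EPair EFalse (ETail V1)) V0) V0))
  EAtom"

definition "b_standard = ECall f_equal [V0, ECall f_first_match [V0, V1, V2]]"

definition "b_all_standard = EIf V0
  (EIfB (ECall f_standard [EHead V0, V1, V2]) (ECall f_all_standard [ETail V0, V1, V2]) EFalse) ETrue"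

definition "b_minimal = EIfB (ECall f_standard [V0, V1, V2]) EFalse
  (ECall f_all_standard [ECall f_removals [V0], V1, V2])"

definition "b_sub = EIf V0
  (EIfB (EAnd (EHead V0) (ENot (EHead V1))) EFalse (ECall f_sub [ETail V0, ETail V1])) ETrue"

definition "b_weight = EIf V0
  (ELet (ECall f_weight [ETail V0]) (EIfB (EHead V1) (EPair EAtom V0) V0)) EAtom"

definition "b_diff = EIf V0 (ECall f_diff [ETail V0, ETail V1]) V1"

definition "b_power = EIf V0 (EPair EFalse (ECall f_power [ETail V0])) (EPair ETrue EAtom)"

definition "b_odd = EIf V0 (ENot (ECall f_odd [ETail V0])) EFalse"

definition "b_rat = EPair V0 (EPair (EPair ETrue EAtom) (ECall f_power [V1]))"

definition "b_terms = EIf V0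
  (ECall f_term [EHead V0, V1, V2, V3, ECall f_terms [ETail V0, V1, V2, V3]]) EAtom"

definition "e_codegree = ECall f_diff [ECall f_weight [V0], ECall f_weight [V1]]"

text \<open>In the absence of higher-order functions, filtering is done by passing the finished rest
  of the list as last argument and putting a term in front of it or not. The cases are those of
  \<open>basis_coef_dyadic\<close>.\<close>

definition "b_term = EIfB (ECall f_sub [V0, V1])
  (EIfB (ECall f_sub [V0, V2])
    (EIfB V3 (EPair (EPair (ECall f_rat [ECall f_odd [e_codegree], ETail e_codegree]) V0) V4) V4)
    (EPair (EPair (ECall f_rat [ECall f_odd [e_codegree], e_codegree]) V0) V4))
  (EIfB (ECall f_sub [V0, V2])
    (EPair (EPair (ECall f_rat [EXor (ENot V3) (ECall f_odd [e_codegree]), e_codegree]) V0) V4)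
    V4)"

definition "b_polys = EIf V0
  (ECall f_poly [EHead V0, V1, V2, ECall f_polys [ETail V0, V1, V2, V3]]) V3"

definition "b_poly = EIfB (ECall f_minimal [V0, V1, V2])
  (EPair (ECall f_poly_of [V0, ECall f_first_match [V0, V1, V2], V1, V2]) V3) V3"

definition "b_poly_of = ECall f_terms [V2, V0, V1,
  EXor (ECall f_parity [V0, EHead V3]) (ECall f_parity [V1, EHead V3])]"

definition "b_double = EIf V0
  (EPair (EIfB (EHead V0) (EPair EAtom (EPair EAtom EAtom)) EAtom) (ECall f_double [ETail V0])) EAtom"

definition "b_squares = EIf V0
  (ECall f_square [EHead V0, V1, V2, ECall f_squares [ETail V0, V1, V2]]) EAtom"

definition "b_square = EIfB (ECall f_standard [V0, V1, V2])
  (EPair (ECall f_square_of [V0]) V3) V3"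

definition "b_square_of =
  EPair (EPair (ECall f_rat [EFalse, EAtom]) (ECall f_double [V0]))
    (EPair (EPair (ECall f_rat [ETrue, EAtom]) V0) EAtom)"

definition "b_output = EIf V0
  (ECall f_polys [V1, V1, V0, ECall f_squares [V2, V1, V0]])
  (EPair (EPair (EPair (ECall f_rat [EFalse, EAtom]) V3) EAtom) EAtom)"

fun e_unary :: "nat \<Rightarrow> expr" where
  "e_unary 0 = EAtom"
| "e_unary (Suc n) = EPair EAtom (e_unary n)"

text \<open>\<open>d\<close> is fixed in advance: it enters as a literal, and whether 2 <= d is
  decided when the program is written, not when it runs.\<close>

definition b_main :: "nat \<Rightarrow> expr" where
  "b_main d = ECall f_output
    [ECall f_solve [ETail V0, ECall f_sqfrees [EHead V0, e_unary 1, EAtom]],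
     ECall f_sqfrees [EHead V0, e_unary d, EAtom],
     if 2 \<le> d then ECall f_combos [EHead V0, e_unary 1] else EAtom,
     EHead V0]"

definition program :: "nat \<Rightarrow> program" where
  "program d = [b_main d, b_mapcons, b_append, b_combos, b_sqfrees, b_xor3, b_good, b_find, b_correct,
    b_step, b_step_with, b_equate, b_firsts, b_pair_with, b_constrain, b_solve, b_parity, b_agree,
    b_matches, b_first_match, b_equal, b_removals, b_standard, b_all_standard, b_minimal, b_sub,
    b_weight, b_diff, b_power, b_odd, b_rat, b_terms, b_term, b_polys, b_poly, b_poly_of, b_double,
    b_squares, b_square, b_square_of, b_output]"

section \<open>Correctness and cost of the functions\<close>

abbreviation "exec d \<equiv> ev (program d)"
abbreviation "run d \<equiv> fn (program d)"

lemma fn_program: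
  "run d f_main vs v k = exec d vs (b_main d) v k"
  "run d f_mapcons vs v k = exec d vs b_mapcons v k"
  "run d f_append vs v k = exec d vs b_append v k"
  "run d f_combos vs v k = exec d vs b_combos v k"
  "run d f_sqfrees vs v k = exec d vs b_sqfrees v k"
  "run d f_xor3 vs v k = exec d vs b_xor3 v k"
  "run d f_good vs v k = exec d vs b_good v k"
  "run d f_find vs v k = exec d vs b_find v k"
  "run d f_correct vs v k = exec d vs b_correct v k"
  "run d f_step vs v k = exec d vs b_step v k"
  "run d f_step_with vs v k = exec d vs b_step_with v k"
  "run d f_equate vs v k = exec d vs b_equate v k"
  "run d f_firsts vs v k = exec d vs b_firsts v k"
  "run d f_pair_with vs v k = exec d vs b_pair_with v k"
  "run d f_constrain vs v k = exec d vs b_constrain v k"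
  "run d f_solve vs v k = exec d vs b_solve v k"
  "run d f_parity vs v k = exec d vs b_parity v k"
  "run d f_agree vs v k = exec d vs b_agree v k"
  "run d f_matches vs v k = exec d vs b_matches v k"
  "run d f_first_match vs v k = exec d vs b_first_match v k"
  "run d f_equal vs v k = exec d vs b_equal v k"
  "run d f_removals vs v k = exec d vs b_removals v k"
  "run d f_standard vs v k = exec d vs b_standard v k"
  "run d f_all_standard vs v k = exec d vs b_all_standard v k"
  "run d f_minimal vs v k = exec d vs b_minimal v k"
  "run d f_sub vs v k = exec d vs b_sub v k"
  "run d f_weight vs v k = exec d vs b_weight v k"
  "run d f_diff vs v k = exec d vs b_diff v k"
  "run d f_power vs v k = exec d vs b_power v k"
  "run d f_odd vs v k = exec d vs b_odd v k"
  "run d f_rat vs v k = exec d vs b_rat v k"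
  "run d f_terms vs v k = exec d vs b_terms v k"
  "run d f_term vs v k = exec d vs b_term v k"
  "run d f_polys vs v k = exec d vs b_polys v k"
  "run d f_poly vs v k = exec d vs b_poly v k"
  "run d f_poly_of vs v k = exec d vs b_poly_of v k"
  "run d f_double vs v k = exec d vs b_double v k"
  "run d f_squares vs v k = exec d vs b_squares v k"
  "run d f_square vs v k = exec d vs b_square v k"
  "run d f_square_of vs v k = exec d vs b_square_of v k"
  "run d f_output vs v k = exec d vs b_output v k"
  by (simp_all add: fn_def program_def)

lemmas body_simps = fn_program enc_list.simps enc_unary_simps
  b_mapcons_def b_append_def b_combos_def b_sqfrees_def b_xor3_def b_good_def b_find_def
  b_correct_def b_step_def b_step_with_def b_equate_def b_firsts_def b_pair_with_def
  b_constrain_def b_solve_def b_parity_def b_agree_def b_matches_def b_first_match_def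
  b_equal_def b_removals_def b_standard_def b_all_standard_def b_minimal_def b_sub_def
  b_weight_def b_diff_def b_power_def b_odd_def b_rat_def b_terms_def b_term_def b_polys_def
  b_poly_def b_poly_of_def b_double_def b_squares_def b_square_def b_square_of_def b_output_def

text \<open>Two encodings are allowed so that the same code prepends a bit to vectors and pairs an
  assignment with tuples: both are a \<open>Pair\<close> with a fixed first component.\<close>

lemma fn_mapcons:
  assumes "\<And>x. h (f x) = Pair b (g x)"
  shows "run d f_mapcons [b, enc_list g xs, enc_list h ys] (enc_list h (map f xs @ ys)) (20 * length xs + 20)"
proof (induction xs)
  case Nil
  show ?case
    unfolding body_simps
    by (rule ev_mono, rule ev_If_Atom, (rule ev_rules)+, simp_all)
next
  case (Cons x xs)
  show ?case
    unfolding body_simps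
    by (rule ev_mono, rule ev_If_Pair, (rule ev_rules Cons)+, simp_all add: assms)
qed

lemma fn_mapcons_bools:
  "run d f_mapcons [enc_bool b, enc_vecs xs, enc_vecs ys]
    (enc_vecs (map ((#) b) xs @ ys)) (20 * length xs + 20)"
  "run d f_mapcons [enc_bool b, enc_vecs xs, Atom]
    (enc_vecs (map ((#) b) xs)) (20 * length xs + 20)"
  using fn_mapcons[of enc_bools "(#) b" "enc_bool b" enc_bools d xs ys]
    fn_mapcons[of enc_bools "(#) b" "enc_bool b" enc_bools d xs "[]"] by simp_all

lemma fn_mapcons_points:
  "run d f_mapcons [enc_bools v, enc_vecs ts, Atom]
    (enc_list enc_point (map (\<lambda>t. (v, t)) ts)) (20 * length ts + 20)"
  using fn_mapcons[of enc_point "\<lambda>t. (v, t)" "enc_bools v" enc_bools d ts "[]"]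
  by (simp add: enc_point_def)

lemma fn_append:
  "run d f_append [enc_list g xs, enc_list g ys] (enc_list g (xs @ ys)) (20 * length xs + 20)"
proof (induction xs)
  case Nil
  show ?case
    unfolding body_simps
    by (rule ev_mono, rule ev_If_Atom, (rule ev_rules)+, simp_all)
next
  case (Cons x xs)
  show ?case
    unfolding body_simps
    by (rule ev_mono, rule ev_If_Pair, (rule ev_rules Cons)+, simp_all)
qed

text \<open>The recursion is executed without sharing of results, so the cost obeys Pascal's
  recurrence, plus the cost of copying the lists.\<close>

fun combos_time :: "nat \<Rightarrow> nat \<Rightarrow> nat" where
  "combos_time 0 k = 10"
| "combos_time (Suc n) 0 = combos_time n 0 + 20 * length (combos n 0) + 40"
| "combos_time (Suc n) (Suc k) = combos_time n (Suc k) + combos_time n k +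
    20 * length (combos n (Suc k)) + 20 * length (combos n k) + 80"

lemma fn_combos:
  "run d f_combos [enc_unary n, enc_unary k] (enc_vecs (combos n k)) (combos_time n k)"
proof (induction n k rule: combos.induct)
  case 1
  show ?case
    unfolding body_simps
    by (rule ev_mono, rule ev_If_Atom, rule ev_rules, rule ev_If_Atom, (rule ev_rules)+, simp_all)
next
  case (2 k)
  show ?case
    unfolding body_simps
    by (rule ev_mono, rule ev_If_Atom, rule ev_rules, rule ev_If_Pair, (rule ev_rules)+, simp_all)
next
  case (3 n)
  show ?case
    unfolding body_simps
    by (rule ev_mono, rule ev_If_Pair, rule ev_rules, rule ev_If_Atom,
      (rule ev_rules fn_mapcons_bools 3[unfolded enc_unary_simps])+, simp_all)
next
  case (4 n k)
  show ?case
    unfolding body_simps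
    by (rule ev_mono, rule ev_If_Pair, rule ev_rules, rule ev_If_Pair,
      (rule ev_rules fn_mapcons_bools 4[unfolded enc_unary_simps])+, simp_all)
qed

fun sqfrees_time :: "nat \<Rightarrow> nat \<Rightarrow> nat" where
  "sqfrees_time n 0 = combos_time n 0 + 20 * length (combos n 0) + 40"
| "sqfrees_time n (Suc k) = sqfrees_time n k + combos_time n (Suc k) + 20 * length (combos n (Suc k)) + 40"

lemma fn_sqfrees:
  "run d f_sqfrees [enc_unary n, enc_unary k, enc_vecs us]
    (enc_vecs (sqfrees n k @ us)) (sqfrees_time n k)"
proof (induction k arbitrary: us)
  case 0
  show ?case
    unfolding body_simps
    by (rule ev_mono, rule ev_If_Atom, (rule ev_rules fn_append fn_combos[of _ _ 0, unfolded enc_unary_simps])+, simp_all)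
next
  case (Suc k)
  show ?case
    unfolding body_simps
    by (rule ev_mono, rule ev_If_Pair,
      (rule ev_rules Suc fn_append fn_combos[of _ _ "Suc k", unfolded enc_unary_simps])+, simp_all)
qed

section \<open>Cost of imposing the constraints\<close>

lemma fn_xor3:
  "length v = length u \<Longrightarrow> length w = length u \<Longrightarrow>
    run d f_xor3 [enc_bools u, enc_bools v, enc_bools w] (enc_bools (xor3 u v w)) (50 * length u + 50)"
proof (induction u arbitrary: v w)
  case Nil
  then show ?case
    unfolding body_simps
    by - (rule ev_mono, rule ev_If_Atom, (rule ev_rules)+, simp_all)
next
  case (Cons a u)
  then obtain b v' c w' where vw: "v = b # v'" "w = c # w'" by (metis length_Suc_conv)
  then have "length v' = length u" "length w' = length u" using Cons.prems by simp_all
  note IH = Cons.IH[OF this]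
  show ?case
    unfolding body_simps vw
    by (rule ev_mono, rule ev_If_Pair, (rule ev_rules IH)+, simp_all)
qed

lemma fn_good:
  "i < length v \<Longrightarrow>
    run d f_good [enc_bools v, enc_unary i, enc_bool b] (enc_bool (v ! i = b)) (20 * i + 30)"
proof (induction i arbitrary: v)
  case 0
  then obtain a u where v: "v = a # u" by (cases v) auto
  show ?case
    unfolding body_simps v
    by (rule ev_mono, rule ev_If_Atom, (rule ev_rules)+, simp_all)
next
  case (Suc i)
  then obtain a u where v: "v = a # u" by (cases v) auto
  then have IH: "run d f_good [enc_bools u, enc_unary i, enc_bool b] (enc_bool (u ! i = b)) (20 * i + 30)"
    using Suc by simp
  show ?case
    unfolding body_simps v
    by (rule ev_mono, rule ev_If_Pair, (rule ev_rules IH)+, simp_all)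
qed

text \<open>One function serves both searches: with \<open>b\<close> true it skips to the first good
  point, with \<open>b\<close> false to the first bad one.\<close>

lemma fn_find:
  assumes "i < n" "points_ok n (Suc k) (set ps)"
  shows "run d f_find [enc_bool b, enc_list enc_point ps, enc_unary i]
    (enc_list enc_point (dropWhile (\<lambda>p. good i p \<noteq> b) ps)) (length ps * (20 * n + 200) + 20)"
  using assms(2)
proof (induction ps)
  case Nil
  show ?case
    unfolding body_simps
    by (rule ev_mono, rule ev_If_Atom, (rule ev_rules)+, simp_all)
next
  case (Cons p ps)
  obtain v r rs where p: "p = (v, r # rs)" "length v = n"
    using Cons.prems by (cases p) (auto simp: points_ok_def length_Suc_conv)
  have IH: "run d f_find [enc_bool b, enc_list enc_point ps, enc_unary i]
    (enc_list enc_point (dropWhile (\<lambda>p. good i p \<noteq> b) ps)) (length ps * (20 * n + 200) + 20)"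
    by (rule Cons.IH) (use Cons.prems in \<open>simp add: points_ok_def\<close>)
  have "i < length v" using assms p by simp
  note good = fn_good[OF this]
  show ?case
    unfolding body_simps p(1) enc_point_Pair
    by (rule ev_mono, rule ev_If_Pair, (rule ev_rules IH good)+)
      (use assms in \<open>auto simp: enc_point_Pair good_def\<close>)
qed

lemma fn_correct:
  assumes "i < n" "points_ok n (Suc k) {a, b}" "points_ok n (Suc k) (set ps)"
  shows "run d f_correct [enc_list enc_point ps, enc_unary i, enc_point a, enc_point b]
    (enc_list enc_point (map (drop_pair \<circ> correct i a b) ps)) (length ps * (70 * n + 50 * k + 400) + 20)"
  using assms(3)
proof (induction ps)
  case Nil
  show ?case
    unfolding body_simps
    by (rule ev_mono, rule ev_If_Atom, (rule ev_rules)+, simp_all)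
next
  case (Cons p ps)
  obtain v r rs where p: "p = (v, r # rs)" "length v = n" "length rs = k"
    using Cons.prems by (cases p) (auto simp: points_ok_def length_Suc_conv)
  obtain va ra rsa where a: "a = (va, ra # rsa)" "length va = n" "length rsa = k"
    using assms(2) by (cases a) (auto simp: points_ok_def length_Suc_conv)
  obtain vb rb rsb where b: "b = (vb, rb # rsb)" "length vb = n" "length rsb = k"
    using assms(2) by (cases b) (auto simp: points_ok_def length_Suc_conv)
  have IH: "run d f_correct [enc_list enc_point ps, enc_unary i, enc_point a, enc_point b]
    (enc_list enc_point (map (drop_pair \<circ> correct i a b) ps)) (length ps * (70 * n + 50 * k + 400) + 20)"
    by (rule Cons.IH) (use Cons.prems in \<open>simp add: points_ok_def\<close>)
  have "i < length v" using assms p by simp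
  note good = fn_good[OF this]
  have x1: "run d f_xor3 [enc_bools v, enc_bools va, enc_bools vb] (enc_bools (xor3 v va vb)) (50 * n + 50)"
    using fn_xor3[of va v vb] p a b by simp
  have x2: "run d f_xor3 [enc_bools rs, enc_bools rsa, enc_bools rsb] (enc_bools (xor3 rs rsa rsb)) (50 * k + 50)"
    using fn_xor3[of rsa rs rsb] p a b by simp
  show ?case
    unfolding body_simps p(1) a(1) b(1) enc_point_Pair
    by (rule ev_mono, rule ev_If_Pair,
        (rule ev_rules IH[unfolded a(1) b(1) enc_point_Pair enc_list.simps] good x1 x2)+)
      (use assms in \<open>auto simp: enc_point_Pair good_def correct_def drop_pair_def xor3_pair_def\<close>)
qed

lemma fn_step_with:
  assumes "i < n" "points_ok n (Suc k) (set ps)" "points_ok n (Suc k) (set as)" "points_ok n (Suc k) (set bs)"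
  shows "run d f_step_with [enc_list enc_point ps, enc_unary i, enc_list enc_point as, enc_list enc_point bs]
    (enc_list enc_point (case as of [] \<Rightarrow> [] | a # _ \<Rightarrow>
      (case bs of [] \<Rightarrow> map (drop_pair \<circ> correct i a a) ps | b # _ \<Rightarrow> map (drop_pair \<circ> correct i a b) ps)))
    (length ps * (70 * n + 50 * k + 400) + 50)"
proof (cases as)
  case Nil
  show ?thesis
    unfolding body_simps Nil
    by (rule ev_mono, rule ev_If_Atom, (rule ev_rules)+, simp_all)
next
  case (Cons a as')
  have a: "points_ok n (Suc k) {a, a}" using assms Cons by (auto simp: points_ok_def)
  show ?thesis
  proof (cases bs)
    case Nil
    show ?thesis
      unfolding body_simps Nil Cons
      by (rule ev_mono, rule ev_If_Pair, rule ev_rules, rule ev_If_Atom,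
          (rule ev_rules fn_correct[OF assms(1) a assms(2)])+, simp_all)
  next
    case Cons': (Cons b bs')
    have b: "points_ok n (Suc k) {a, b}" using assms Cons Cons' by (auto simp: points_ok_def)
    show ?thesis
      unfolding body_simps Cons' Cons
      by (rule ev_mono, rule ev_If_Pair, rule ev_rules, rule ev_If_Pair,
          (rule ev_rules fn_correct[OF assms(1) b assms(2)])+, simp_all)
  qed
qed

lemma fn_step:
  assumes "i < n" "points_ok n (Suc k) (set ps)"
  shows "run d f_step [enc_list enc_point ps, enc_unary i]
    (enc_list enc_point (step i ps)) (length ps * (110 * n + 50 * k + 800) + 200)"
proof -
  have *: "points_ok n (Suc k) (set (dropWhile Q ps))" for Q
    using assms(2) by (auto simp: points_ok_def dest: set_dropWhileD)
  have False_eq: "(\<lambda>p. good i p \<noteq> False) = good i" "(\<lambda>p. good i p \<noteq> True) = (\<lambda>p. \<not> good i p)" by auto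
  show ?thesis
    unfolding body_simps
    by (rule ev_mono, (rule ev_rules fn_step_with[OF assms * *]
        fn_find[OF assms, where b = True, unfolded False_eq] fn_find[OF assms, where b = False, unfolded False_eq])+)
      (simp_all add: step_def algebra_simps)
qed

lemma fn_firsts:
  "run d f_firsts [enc_list enc_point ps] (enc_vecs (map fst ps)) (20 * length ps + 20)"
proof (induction ps)
  case Nil
  show ?case
    unfolding body_simps
    by (rule ev_mono, rule ev_If_Atom, (rule ev_rules)+, simp_all)
next
  case (Cons p ps)
  obtain v r where p: "p = (v, r)" by fastforce
  show ?case
    unfolding body_simps p enc_point_Pair
    by (rule ev_mono, rule ev_If_Pair, (rule ev_rules Cons)+, simp_all)
qed

text \<open>\<open>step\<close> never lengthens the list and the tuples only get shorter, so bounds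
  \<open>m\<close> and \<open>L\<close> fixed at the start remain valid and all steps have the same
  cost bound.\<close>

lemma fn_equate:
  "points_ok n (length xs) (set ps) \<Longrightarrow> set xs \<subseteq> {..<n} \<Longrightarrow> length xs \<le> m \<Longrightarrow> length ps \<le> L \<Longrightarrow>
    run d f_equate [enc_list enc_unary xs, enc_list enc_point ps]
      (enc_vecs (equate xs ps)) (length xs * (L * (110 * n + 50 * m + 800) + 220) + 20 * L + 30)"
proof (induction xs arbitrary: ps)
  case Nil
  then show ?case
    unfolding body_simps
    by - (rule ev_mono, rule ev_If_Atom, (rule ev_rules fn_firsts)+, simp_all)
next
  case (Cons i xs)
  have ok: "points_ok n (Suc (length xs)) (set ps)" and i: "i < n" using Cons.prems by simp_all
  have IH: "run d f_equate [enc_list enc_unary xs, enc_list enc_point (step i ps)]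
      (enc_vecs (equate xs (step i ps))) (length xs * (L * (110 * n + 50 * m + 800) + 220) + 20 * L + 30)"
    using Cons.prems length_step[of i ps] by (intro Cons.IH points_ok_step ok) auto
  have "length ps * (110 * n + 50 * length xs + 800) \<le> L * (110 * n + 50 * m + 800)"
    using Cons.prems by (intro mult_mono) auto
  then have step: "run d f_step [enc_list enc_point ps, enc_unary i]
      (enc_list enc_point (step i ps)) (L * (110 * n + 50 * m + 800) + 200)"
    by (intro fn_mono[OF fn_step[OF i ok]]) auto
  show ?case
    unfolding body_simps
    by (rule ev_mono, rule ev_If_Pair, (rule ev_rules step IH)+, simp_all)
qed

lemma fn_pair_with:
  "run d f_pair_with [enc_vecs vs, enc_bools r, enc_list enc_point ps]
    (enc_list enc_point (map (\<lambda>v. (v, r)) vs @ ps)) (20 * length vs + 20)"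
proof (induction vs)
  case Nil
  show ?case
    unfolding body_simps
    by (rule ev_mono, rule ev_If_Atom, (rule ev_rules)+, simp_all)
next
  case (Cons v vs)
  show ?case
    unfolding body_simps
    by (rule ev_mono, rule ev_If_Pair, (rule ev_rules Cons)+, simp_all add: enc_point_Pair)
qed

definition constrain_time :: "nat \<Rightarrow> nat \<Rightarrow> nat \<Rightarrow> nat" where
  "constrain_time n m L = m * (L * (110 * n + 50 * m + 800) + 220) + 40 * L + 200"

lemma fn_constrain:
  assumes vs: "\<forall>v \<in> set vs. length v = n" and ts: "\<forall>t \<in> set ts. length t = length xs"
    and xs: "set xs \<subseteq> {..<n}" "length xs \<le> m" and L: "length vs + length ts \<le> L"
  shows "run d f_constrain [enc_cstr (ts, xs), enc_vecs vs]
    (enc_vecs (constrain (ts, xs) vs)) (constrain_time n m L)"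
proof (cases vs)
  case Nil
  show ?thesis
    unfolding body_simps Nil
    by (rule ev_mono, rule ev_If_Atom, (rule ev_rules)+, simp_all add: constrain_def constrain_time_def)
next
  case (Cons v vs')
  show ?thesis
  proof (cases ts)
    case Nil
    show ?thesis
      unfolding body_simps Nil Cons enc_cstr_def fst_conv snd_conv
      by (rule ev_mono, rule ev_If_Pair, rule ev_rules, rule ev_If_Atom, (rule ev_rules)+,
          simp_all add: constrain_def constrain_time_def)
  next
    case Cons': (Cons r ts')
    let ?ps = "map (\<lambda>v. (v, r)) vs @ map (\<lambda>t. (v, t)) ts"
    have "points_ok n (length xs) (set ?ps)"
      using vs ts Cons Cons' by (simp add: points_ok_def ball_Un)
    then have eq: "run d f_equate [enc_list enc_unary xs, enc_list enc_point ?ps]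
        (enc_vecs (equate xs ?ps)) (m * (L * (110 * n + 50 * m + 800) + 220) + 20 * L + 30)"
      using L xs by (intro fn_mono[OF fn_equate[where m = m and L = L]]) (auto intro: mult_le_mono1)
    note r = eq fn_pair_with[of d vs r "map (\<lambda>t. (v, t)) ts"] fn_mapcons_points[of d v ts]
    show ?thesis
      unfolding body_simps Cons' Cons enc_cstr_def fst_conv snd_conv
      by (rule ev_mono, rule ev_If_Pair, rule ev_rules, rule ev_If_Pair, (rule ev_rules)+,
          (rule ev_rules r[unfolded Cons Cons' enc_list.simps])+)
        (use L Cons Cons' in \<open>simp_all add: constrain_def constrain_time_def\<close>)
  qed
qed

text \<open>The last assumption is the invariant of the recursion, counting the present points and
  the tuples still to come: imposing a constraint shifts its tuples from the second summand to the
  first at most.\<close>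

lemma fn_solve:
  assumes "\<forall>v \<in> set vs. length v = n"
    and "\<forall>(ts, xs) \<in> set cs. (\<forall>t \<in> set ts. length t = length xs) \<and> set xs \<subseteq> {..<n} \<and> length xs \<le> m"
    and "length vs + (\<Sum>c\<leftarrow>cs. length (fst c)) \<le> L"
  shows "run d f_solve [enc_list enc_cstr cs, enc_vecs vs]
    (enc_vecs (solve cs vs)) (length cs * (constrain_time n m L + 20) + 10)"
  using assms
proof (induction cs arbitrary: vs)
  case Nil
  show ?case
    unfolding body_simps
    by (rule ev_mono, rule ev_If_Atom, (rule ev_rules)+, simp_all)
next
  case (Cons c cs)
  obtain ts xs where c: "c = (ts, xs)" by fastforce
  have *: "\<forall>t \<in> set ts. length t = length xs" "set xs \<subseteq> {..<n}" "length xs \<le> m"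
    using Cons.prems(2) c by auto
  have con: "run d f_constrain [enc_cstr c, enc_vecs vs]
      (enc_vecs (constrain c vs)) (constrain_time n m L)"
    using Cons.prems * unfolding c by (intro fn_constrain) auto
  have IH: "run d f_solve [enc_list enc_cstr cs, enc_vecs (constrain c vs)]
      (enc_vecs (solve cs (constrain c vs))) (length cs * (constrain_time n m L + 20) + 10)"
  proof (rule Cons.IH)
    show "\<forall>v\<in>set (constrain c vs). length v = n"
      unfolding c by (rule constrain_vecs[OF Cons.prems(1) *(1)])
    show "length (constrain c vs) + (\<Sum>c\<leftarrow>cs. length (fst c)) \<le> L"
      using Cons.prems(3) length_constrain[of c vs] by simp
  qed (use Cons.prems in auto)
  show ?case
    unfolding body_simps
    by (rule ev_mono, rule ev_If_Pair, (rule ev_rules con IH)+, simp_all)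
qed

section \<open>Cost of matching and of the test for minimality\<close>

lemma fn_parity:
  "length v = length S \<Longrightarrow>
    run d f_parity [enc_bools S, enc_bools v] (enc_bool (parity S v)) (50 * length S + 50)"
proof (induction S arbitrary: v)
  case Nil
  then show ?case
    unfolding body_simps
    by - (rule ev_mono, rule ev_If_Atom, (rule ev_rules)+, simp_all)
next
  case (Cons s S)
  then obtain a v' where v: "v = a # v'" by (metis length_Suc_conv)
  then have "length v' = length S" using Cons.prems by simp
  note IH = Cons.IH[OF this]
  show ?case
    unfolding body_simps v
    by (rule ev_mono, rule ev_If_Pair,
        (rule ev_rules IH)+, simp_all)
qed

lemma fn_agree:
  assumes "length S = n" "length T = n" "\<forall>v \<in> set vs. length v = n"
  shows "run d f_agree [enc_bools S, enc_bools T, enc_vecs vs, enc_bool c]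
    (enc_bool (\<forall>p \<in> set vs. (parity S p \<noteq> parity T p) = c)) (length vs * (100 * n + 250) + 10)"
  using assms(3)
proof (induction vs)
  case Nil
  show ?case
    unfolding body_simps
    by (rule ev_mono, rule ev_If_Atom, (rule ev_rules)+, simp_all)
next
  case (Cons v vs)
  have par: "run d f_parity [enc_bools U, enc_bools v] (enc_bool (parity U v)) (50 * n + 50)"
    if "length U = n" for U
    using fn_parity[of v U d] Cons.prems that by simp
  have IH: "run d f_agree [enc_bools S, enc_bools T, enc_vecs vs, enc_bool c]
    (enc_bool (\<forall>p \<in> set vs. (parity S p \<noteq> parity T p) = c)) (length vs * (100 * n + 250) + 10)"
    using Cons by simp
  show ?case
    unfolding body_simps
    by (rule ev_mono, rule ev_If_Pair, (rule ev_rules IH par assms)+)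
      (simp_all del: not_iff)
qed

definition matches_time :: "nat \<Rightarrow> nat \<Rightarrow> nat" where
  "matches_time n g = (g + 2) * (100 * n + 250)"

text \<open>The value at the first point is the only candidate for the constant, so one pass over
  the list decides matching.\<close>

lemma matches_hd:
  assumes "vs \<noteq> []"
  shows "matches (set vs) S T \<longleftrightarrow>
    (\<forall>p \<in> set vs. (parity S p \<noteq> parity T p) = (parity S (hd vs) \<noteq> parity T (hd vs)))"
proof
  assume "matches (set vs) S T"
  then obtain c where c: "\<forall>p \<in> set vs. (parity S p \<noteq> parity T p) = c"
    by (auto simp: matches_def)
  with hd_in_set[OF assms] have "(parity S (hd vs) \<noteq> parity T (hd vs)) = c" by blast
  with c show "\<forall>p \<in> set vs. (parity S p \<noteq> parity T p) = (parity S (hd vs) \<noteq> parity T (hd vs))"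
    by simp
qed (unfold matches_def, rule exI)

lemma fn_matches:
  assumes "length S = n" "length T = n" "\<forall>v \<in> set vs. length v = n" "vs \<noteq> []"
  shows "run d f_matches [enc_bools S, enc_bools T, enc_vecs vs]
    (enc_bool (matches (set vs) S T)) (matches_time n (length vs))"
proof -
  obtain v vs' where vs: "vs = v # vs'" using assms(4) by (cases vs) auto
  have par: "run d f_parity [enc_bools U, enc_bools v] (enc_bool (parity U v)) (50 * n + 50)"
    if "length U = n" for U
    using fn_parity[of v U d] assms vs that by simp
  have agree: "run d f_agree [enc_bools S, enc_bools T, enc_vecs vs, enc_bool (parity S v \<noteq> parity T v)]
    (enc_bool (matches (set vs) S T)) (length vs * (100 * n + 250) + 10)"
    using fn_agree[OF assms(1-3), of d "parity S v \<noteq> parity T v"] matches_hd[OF assms(4)] vs by simp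
  show ?thesis
    unfolding body_simps vs enc_list.simps
    by (rule ev_mono, (rule ev_rules agree[unfolded vs enc_list.simps] par assms)+)
      (simp_all add: matches_time_def)
qed

definition first_match_time :: "nat \<Rightarrow> nat \<Rightarrow> nat \<Rightarrow> nat" where
  "first_match_time n g m = m * (matches_time n g + 50) + 10"

lemma fn_first_match:
  assumes "length S = n" "\<forall>v \<in> set vs. length v = n" "vs \<noteq> []" "\<forall>T \<in> set ms. length T = n"
  shows "run d f_first_match [enc_bools S, enc_vecs ms, enc_vecs vs]
    (enc_bools (first_match (set vs) S ms)) (first_match_time n (length vs) (length ms))"
  using assms(4)
proof (induction ms)
  case Nil
  show ?case
    unfolding body_simps
    by (rule ev_mono, rule ev_If_Atom, (rule ev_rules)+, simp_all add: first_match_time_def)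
next
  case (Cons T ms)
  have IH: "run d f_first_match [enc_bools S, enc_vecs ms, enc_vecs vs]
    (enc_bools (first_match (set vs) S ms)) (first_match_time n (length vs) (length ms))"
    using Cons by simp
  have m: "run d f_matches [enc_bools S, enc_bools T, enc_vecs vs]
      (enc_bool (matches (set vs) S T)) (matches_time n (length vs))"
    using fn_matches assms Cons.prems by simp
  show ?case
    unfolding body_simps
    by (rule ev_mono, rule ev_If_Pair, (rule ev_rules IH m)+) (simp_all add: first_match_time_def)
qed

lemma fn_equal:
  "length v = length u \<Longrightarrow>
    run d f_equal [enc_bools u, enc_bools v] (enc_bool (v = u)) (50 * length u + 50)"
proof (induction u arbitrary: v)
  case Nil
  then show ?case
    unfolding body_simps
    by - (rule ev_mono, rule ev_If_Atom, (rule ev_rules)+, simp_all)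
next
  case (Cons a u)
  then obtain b v' where v: "v = b # v'" by (metis length_Suc_conv)
  then have "length v' = length u" using Cons.prems by simp
  note IH = Cons.IH[OF this]
  show ?case
    unfolding body_simps v
    by (rule ev_mono, rule ev_If_Pair, (rule ev_rules IH)+, simp_all)
qed

lemma length_removals: "length (removals S) \<le> length S"
  by (induction S) auto

lemma fn_removals:
  "run d f_removals [enc_bools S] (enc_vecs (removals S))
    (length S * (20 * length S + 100) + 20)"
proof (induction S)
  case Nil
  show ?case
    unfolding body_simps
    by (rule ev_mono, rule ev_If_Atom, (rule ev_rules)+, simp_all)
next
  case (Cons b S)
  have map: "run d f_mapcons [enc_bool b, enc_vecs (removals S), Atom]
      (enc_vecs (map ((#) b) (removals S))) (20 * length S + 20)"
    by (rule fn_mono[OF fn_mapcons_bools(2)]) (use length_removals in simp_all)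
  show ?case
    unfolding body_simps
    by (rule ev_mono, rule ev_If_Pair, (rule ev_rules Cons map)+) (simp_all add: algebra_simps)
qed

definition standard_time :: "nat \<Rightarrow> nat \<Rightarrow> nat \<Rightarrow> nat" where
  "standard_time n g m = first_match_time n g m + 50 * n + 100"

lemma first_match_in_set:
  "U \<in> set ms \<Longrightarrow> matches A S U \<Longrightarrow> first_match A S ms \<in> set ms"
  by (induction ms) auto

lemma fn_standard:
  assumes "S \<in> set ms" "\<forall>v \<in> set vs. length v = n" "vs \<noteq> []" "\<forall>T \<in> set ms. length T = n"
  shows "run d f_standard [enc_bools S, enc_vecs ms, enc_vecs vs]
    (enc_bool (first_match (set vs) S ms = S)) (standard_time n (length vs) (length ms))"
proof -
  let ?T = "first_match (set vs) S ms"
  have "length S = n" "length ?T = n"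
    using assms first_match_in_set[OF assms(1) matches_refl] by auto
  then have eq: "run d f_equal [enc_bools S, enc_bools ?T] (enc_bool (?T = S)) (50 * n + 50)"
    using fn_equal[of ?T S d] by simp
  show ?thesis
    unfolding body_simps
    by (rule ev_mono, (rule ev_rules fn_first_match[OF \<open>length S = n\<close> assms(2-4)] eq)+)
      (simp_all add: standard_time_def)
qed

lemma fn_all_standard:
  assumes "\<forall>v \<in> set vs. length v = n" "vs \<noteq> []" "\<forall>T \<in> set ms. length T = n" "set us \<subseteq> set ms"
  shows "run d f_all_standard [enc_vecs us, enc_vecs ms, enc_vecs vs]
    (enc_bool (\<forall>R \<in> set us. first_match (set vs) R ms = R))
    (length us * (standard_time n (length vs) (length ms) + 50) + 10)"
  using assms(4)
proof (induction us)
  case Nil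
  show ?case
    unfolding body_simps
    by (rule ev_mono, rule ev_If_Atom, (rule ev_rules)+, simp_all)
next
  case (Cons u us)
  have IH: "run d f_all_standard [enc_vecs us, enc_vecs ms, enc_vecs vs]
    (enc_bool (\<forall>R \<in> set us. first_match (set vs) R ms = R))
    (length us * (standard_time n (length vs) (length ms) + 50) + 10)"
    using Cons by simp
  have "u \<in> set ms" using Cons.prems by simp
  note std = fn_standard[OF this assms(1-3)]
  show ?case
    unfolding body_simps
    by (rule ev_mono, rule ev_If_Pair, (rule ev_rules IH std)+) simp_all
qed

definition minimal_time :: "nat \<Rightarrow> nat \<Rightarrow> nat \<Rightarrow> nat" where
  "minimal_time n g m = standard_time n g m + n * (20 * n + 100) + n * (standard_time n g m + 50) + 100"

lemma fn_minimal:
  assumes "S \<in> set ms" "\<forall>v \<in> set vs. length v = n" "vs \<noteq> []" "\<forall>T \<in> set ms. length T = n"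
    and "set (removals S) \<subseteq> set ms"
  shows "run d f_minimal [enc_bools S, enc_vecs ms, enc_vecs vs]
    (enc_bool (minimal (set vs) ms S)) (minimal_time n (length vs) (length ms))"
proof -
  have S: "length S = n" using assms by auto
  have all: "run d f_all_standard [enc_vecs (removals S), enc_vecs ms, enc_vecs vs]
    (enc_bool (\<forall>R \<in> set (removals S). first_match (set vs) R ms = R))
    (n * (standard_time n (length vs) (length ms) + 50) + 10)"
    by (rule fn_mono[OF fn_all_standard[OF assms(2-5)]])
      (use length_removals[of S] S in \<open>auto intro: mult_le_mono1\<close>)
  have rem: "run d f_removals [enc_bools S] (enc_vecs (removals S)) (n * (20 * n + 100) + 20)"
    using fn_removals[of d S] S by simp
  show ?thesis
    unfolding body_simps
    by (rule ev_mono, (rule ev_rules fn_standard[OF assms(1-4)] all rem)+)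
      (simp_all add: minimal_def minimal_time_def)
qed

section \<open>Cost of computing a coefficient\<close>

lemma fn_sub:
  "length v = length u \<Longrightarrow>
    run d f_sub [enc_bools u, enc_bools v] (enc_bool (sub u v)) (50 * length u + 50)"
proof (induction u arbitrary: v)
  case Nil
  then show ?case
    unfolding body_simps
    by - (rule ev_mono, rule ev_If_Atom, (rule ev_rules)+, simp_all)
next
  case (Cons a u)
  then obtain b v' where v: "v = b # v'" by (metis length_Suc_conv)
  then have "length v' = length u" using Cons.prems by simp
  note IH = Cons.IH[OF this]
  show ?case
    unfolding body_simps v
    by (rule ev_mono, rule ev_If_Pair, (rule ev_rules IH)+, simp_all)
qed

lemma fn_weight:
  "run d f_weight [enc_bools u] (enc_unary (weight u)) (50 * length u + 50)"
proof (induction u)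
  case Nil
  show ?case
    unfolding body_simps
    by (rule ev_mono, rule ev_If_Atom, (rule ev_rules)+, simp_all add: enc_unary_simps)
next
  case (Cons a u)
  show ?case
    unfolding body_simps
    by (rule ev_mono, rule ev_If_Pair, (rule ev_rules Cons)+, simp_all add: enc_unary_simps)
qed

lemma fn_diff:
  "a \<le> b \<Longrightarrow> run d f_diff [enc_unary a, enc_unary b] (enc_unary (b - a)) (20 * a + 20)"
proof (induction a arbitrary: b)
  case 0
  show ?case
    unfolding body_simps
    by (rule ev_mono, rule ev_If_Atom, (rule ev_rules)+, simp_all)
next
  case (Suc a)
  then obtain b' where b: "b = Suc b'" by (cases b) auto
  then have "a \<le> b'" using Suc.prems by simp
  note IH = Suc.IH[OF this]
  show ?case
    unfolding body_simps b
    by (rule ev_mono, rule ev_If_Pair, (rule ev_rules IH)+, simp_all)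
qed

text \<open>This makes binary arithmetic dispensable: a power of two is written by recursion on its
  unary exponent.\<close>

lemma bits_power: "bits (2 ^ k) = replicate k False @ [True]"
proof (induction k)
  case 0
  show ?case by (subst bits.simps) (simp add: bits.simps)
next
  case (Suc k)
  then show ?case by (subst bits.simps) simp
qed

lemma fn_power:
  "run d f_power [enc_unary k] (enc_binary (2 ^ k)) (20 * k + 20)"
proof (induction k)
  case 0
  show ?case
    unfolding body_simps
    by (rule ev_mono, rule ev_If_Atom, (rule ev_rules)+, simp_all only: enc_binary_def bits_power) simp_all
next
  case (Suc k)
  show ?case
    unfolding body_simps
    by (rule ev_mono, rule ev_If_Pair, (rule ev_rules Suc)+, simp_all only: enc_binary_def bits_power) simp_all
qed

lemma fn_odd:
  "run d f_odd [enc_unary k] (enc_bool (odd k)) (20 * k + 20)"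
proof (induction k)
  case 0
  show ?case
    unfolding body_simps
    by (rule ev_mono, rule ev_If_Atom, (rule ev_rules)+, simp_all)
next
  case (Suc k)
  show ?case
    unfolding body_simps
    by (rule ev_mono, rule ev_If_Pair, (rule ev_rules Suc)+, simp_all)
qed

text \<open>All nonzero coefficients have this form; the program computes the sign and the
  exponent.\<close>

definition dyadic :: "bool \<Rightarrow> nat \<Rightarrow> rat" where
  "dyadic s k = (if s then -1 else 1) / 2 ^ k"

text \<open>With numerator 1 or -1 the fraction is in lowest terms, so its canonical encoding is
  written without a gcd.\<close>

lemma enc_rat_dyadic:
  "enc_rat (dyadic s k) = Pair (enc_bool s) (Pair (Pair (enc_bool True) Atom) (enc_binary (2 ^ k)))"
proof -
  have "Fract (if s then -1 else 1) (2 ^ k) = dyadic s k"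
    by (simp add: dyadic_def Fract_of_int_quotient)
  then have "quotient_of (dyadic s k) = Rat.normalize (if s then -1 else 1, 2 ^ k)"
    by (metis quotient_of_Fract)
  also have "\<dots> = (if s then -1 else 1, 2 ^ k)"
    by (simp add: Rat.normalize_def Let_def)
  finally have q: "quotient_of (dyadic s k) = (if s then -1 else 1, 2 ^ k)" .
  have "enc_binary 1 = Pair (enc_bool True) Atom"
    using bits_power[of 0] by (simp add: enc_binary_def)
  then show ?thesis by (auto simp: enc_rat_def q nat_power_eq)
qed

lemma fn_rat:
  "run d f_rat [enc_bool s, enc_unary k] (enc_rat (dyadic s k)) (20 * k + 50)"
  unfolding body_simps enc_rat_dyadic
  by (rule ev_mono, (rule ev_rules fn_power)+, simp_all)

lemma fn_rat_tail:
  "run d f_rat [enc_bool s, tail (enc_unary k)] (enc_rat (dyadic s (k - 1))) (20 * k + 50)"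
proof -
  have "tail (enc_unary k) = enc_unary (k - 1)"
    by (cases k) (simp_all add: enc_unary_simps)
  then show ?thesis by (auto intro!: fn_mono[OF fn_rat])
qed

text \<open>If \<open>u\<close> lies in just one of the two sets, the coefficient is (-1/2)^k up to
  sign. If it lies in both, the contributions cancel for equal characters and add up to 2 (-1/2)^k
  for opposite ones, hence the exponent k - 1.\<close>

lemma basis_coef_dyadic:
  assumes "length S = n" "length T = n" "weight T \<le> weight S" "T \<noteq> S" "sub u S \<or> sub u T"
  defines "k \<equiv> weight S - weight u"
  shows "weight u \<le> weight S" and "basis_coef S T c u =
    (if sub u S then if sub u T then if c then dyadic (odd k) (k - 1) else 0 else dyadic (odd k) k
      else dyadic ((\<not> c) \<noteq> odd k) k)"
proof -
  show le: "weight u \<le> weight S"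
    using assms(3,5) sub_weight[of u S] sub_weight[of u T] by auto
  \<comment> \<open>k = 0 would force \<open>u = S\<close> and \<open>u = T\<close>; so k - 1 is a
    true subtraction.\<close>
  have pos: "0 < k" if "sub u S" "sub u T"
  proof (rule ccontr)
    assume "\<not> 0 < k"
    then have "weight u = weight S" using le by (simp add: k_def)
    then have "u = S" "u = T" using that assms(3) sub_weight[of u S] sub_weight[of u T] by auto
    then show False using assms(4) by simp
  qed
  have "(-1/2 :: rat) ^ weight S * (-2) ^ weight u = (-1/2) ^ k * ((-1/2) ^ weight u * (-2) ^ weight u)"
    using le by (simp add: k_def flip: power_add mult.assoc)
  also have "\<dots> = (-1/2) ^ k" by (simp flip: power_mult_distrib)
  also have "\<dots> = dyadic (odd k) k"
    by (simp add: dyadic_def power_divide)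
  finally have *: "(-1/2 :: rat) ^ weight S * (-2) ^ weight u = dyadic (odd k) k" .
  show "basis_coef S T c u =
    (if sub u S then if sub u T then if c then dyadic (odd k) (k - 1) else 0 else dyadic (odd k) k
      else dyadic ((\<not> c) \<noteq> odd k) k)"
    unfolding basis_coef_def * using assms(5) pos by (cases k) (auto simp: dyadic_def)
qed

abbreviation enc_term :: "rat \<times> nat list \<Rightarrow> tree" where
  "enc_term \<equiv> (\<lambda>(c, e). Pair (enc_rat c) (enc_list enc_unary e))"

text \<open>A bit and the unary number 0 or 1 are the same tree, so a list of bits already is the
  exponent vector of a squarefree monomial.\<close>

lemma enc_exponents: "enc_list enc_unary (map of_bool u) = enc_bools u"
proof (induction u)
  case (Cons b u)
  have "enc_unary (Suc 0) = Pair Atom Atom" by (simp add: enc_unary_simps)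
  then show ?case using Cons by (simp add: enc_bool_def enc_unary_simps)
qed simp

lemma fn_term:
  assumes "length S = n" "length T = n" "weight T \<le> weight S" "T \<noteq> S" "length u = n"
  shows "run d f_term [enc_bools u, enc_bools S, enc_bools T, enc_bool c, r]
    (if basis_coef S T c u \<noteq> 0 then Pair (Pair (enc_rat (basis_coef S T c u)) (enc_bools u)) r else r)
    (1500 * n + 3000)"
proof -
  let ?k = "weight S - weight u"
  have S: "run d f_sub [enc_bools u, enc_bools S] (enc_bool (sub u S)) (50 * n + 50)"
    and T: "run d f_sub [enc_bools u, enc_bools T] (enc_bool (sub u T)) (50 * n + 50)"
    using fn_sub[of S u d] fn_sub[of T u d] assms by simp_all
  show ?thesis
  proof (cases "sub u S \<or> sub u T")
    case True
    note coef = basis_coef_dyadic[OF assms(1-4) True]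
    have le_length: "weight v \<le> length v" for v by (induction v) auto
    have w: "run d f_weight [enc_bools v] (enc_unary (weight v)) (50 * n + 50)" if "length v = n" for v
      using fn_weight[of d v] that by simp
    have diff: "run d f_diff [enc_unary (weight u), enc_unary (weight S)] (enc_unary ?k) (20 * n + 20)"
      using le_length[of u] assms(5) by (intro fn_mono[OF fn_diff[OF coef(1)]]) auto
    have k: "?k \<le> n" using le_length[of S] assms(1) by simp
    have odd: "run d f_odd [enc_unary ?k] (enc_bool (odd ?k)) (20 * n + 20)"
      and rat: "run d f_rat [enc_bool s, enc_unary ?k] (enc_rat (dyadic s ?k)) (20 * n + 50)"
      and rat_tail: "run d f_rat [enc_bool s, tail (enc_unary ?k)] (enc_rat (dyadic s (?k - 1))) (20 * n + 50)" for s
      by (rule fn_mono[OF fn_odd] fn_mono[OF fn_rat] fn_mono[OF fn_rat_tail]; use k in simp)+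
    have nz: "dyadic s j \<noteq> 0" for s j by (simp add: dyadic_def)
    show ?thesis
      unfolding body_simps e_codegree_def
      by (rule ev_mono, (rule ev_Tail_gen ev_rules S T w assms diff odd rat rat_tail)+)
        (use True in \<open>auto simp: coef nz\<close>)
  next
    case False
    then have notST: "\<not> sub u S" "\<not> sub u T" by simp_all
    then have z: "basis_coef S T c u = 0" by (simp add: basis_coef_def)
    \<comment> \<open>Here \<open>u\<close> may have more elements than \<open>S\<close>, and the
      subtraction of cardinalities has no specification; \<open>ev_IfB_False\<close> passes over
      it.\<close>
    have "exec d [enc_bools u, enc_bools S, enc_bools T, enc_bool c, r] b_term r (100 * n + 150)"
      unfolding b_term_def
      by (rule ev_mono, (rule ev_IfB_False ev_rules S T notST)+) simp_all
    then show ?thesis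
      unfolding fn_program by (rule ev_mono) (simp_all add: z)
  qed
qed

section \<open>Cost of writing the basis\<close>

definition terms_time :: "nat \<Rightarrow> nat \<Rightarrow> nat" where
  "terms_time n m = m * (1500 * n + 3050) + 10"

lemma fn_terms:
  assumes "length S = n" "length T = n" "weight T \<le> weight S" "T \<noteq> S" "\<forall>u \<in> set us. length u = n"
  shows "run d f_terms [enc_vecs us, enc_bools S, enc_bools T, enc_bool c]
    (enc_terms (basis_terms us S T c)) (terms_time n (length us))"
  using assms(5)
proof (induction us)
  case Nil
  show ?case
    unfolding body_simps
    by (rule ev_mono, rule ev_If_Atom, (rule ev_rules)+, simp_all add: terms_time_def basis_terms_def enc_terms_def)
next
  case (Cons u us)
  have IH: "run d f_terms [enc_vecs us, enc_bools S, enc_bools T, enc_bool c]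
    (enc_terms (basis_terms us S T c)) (terms_time n (length us))"
    using Cons by simp
  have "length u = n" using Cons.prems by simp
  note t = fn_term[OF assms(1-4) this]
  show ?case
    unfolding body_simps
    by (rule ev_mono, rule ev_If_Pair, (rule ev_rules IH t)+)
      (simp_all add: terms_time_def basis_terms_def enc_terms_def enc_exponents)
qed

definition poly_time :: "nat \<Rightarrow> nat \<Rightarrow> nat \<Rightarrow> nat" where
  "poly_time n g m = minimal_time n g m + terms_time n m + first_match_time n g m + 100 * n + 300"

lemma fn_poly:
  assumes "S \<in> set ms" "\<forall>v \<in> set vs. length v = n" "vs \<noteq> []" "\<forall>T \<in> set ms. length T = n"
    and "set (removals S) \<subseteq> set ms" and "weight (first_match (set vs) S ms) \<le> weight S"
  shows "run d f_poly [enc_bools S, enc_vecs ms, enc_vecs vs, r]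
    (if minimal (set vs) ms S then Pair (enc_terms (let T = first_match (set vs) S ms in
       basis_terms ms S T (parity S (hd vs) \<noteq> parity T (hd vs)))) r else r)
    (poly_time n (length vs) (length ms))"
proof -
  let ?T = "first_match (set vs) S ms"
  have S: "length S = n" and T: "length ?T = n"
    using assms first_match_in_set[OF assms(1) matches_refl] by auto
  note min = fn_minimal[OF assms(1-5), of d]
  show ?thesis
  proof (cases "minimal (set vs) ms S")
    case True
    then have ne: "?T \<noteq> S" by (simp add: minimal_def)
    obtain v vs' where vs: "vs = v # vs'" using assms(3) by (cases vs) auto
    have par: "run d f_parity [enc_bools U, enc_bools v] (enc_bool (parity U v)) (50 * n + 50)"
      if "length U = n" for U
      using fn_parity[of v U d] assms(2) vs that by simp
    have poly: "run d f_poly_of [enc_bools S, enc_bools ?T, enc_vecs ms, enc_vecs vs]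
        (enc_terms (basis_terms ms S ?T (parity S v \<noteq> parity ?T v))) (terms_time n (length ms) + 100 * n + 150)"
      unfolding body_simps vs enc_list.simps
      by (rule ev_mono, (rule ev_rules fn_terms[OF S T assms(6) ne assms(4), unfolded vs] par S T[unfolded vs])+) simp_all
    show ?thesis
      unfolding body_simps
      by (rule ev_mono, (rule ev_rules min poly fn_first_match[OF S assms(2-4)])+)
        (use True in \<open>simp_all add: vs poly_time_def Let_def\<close>)
  next
    case False
    have "exec d [enc_bools S, enc_vecs ms, enc_vecs vs, r] b_poly r
        (minimal_time n (length vs) (length ms) + 10)"
      unfolding b_poly_def
      by (rule ev_mono, (rule ev_IfB_False ev_rules min False)+) simp_all
    then show ?thesis
      unfolding fn_program by (rule ev_mono) (use False in \<open>simp_all add: poly_time_def\<close>)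
  qed
qed

lemma fn_polys:
  assumes "\<forall>v \<in> set vs. length v = n" "vs \<noteq> []" "\<forall>T \<in> set ms. length T = n"
    and "\<forall>S \<in> set us. S \<in> set ms \<and> set (removals S) \<subseteq> set ms \<and> weight (first_match (set vs) S ms) \<le> weight S"
  shows "run d f_polys [enc_vecs us, enc_vecs ms, enc_vecs vs, enc_list enc_terms ps]
    (enc_list enc_terms (map (\<lambda>S. let T = first_match (set vs) S ms in
       basis_terms ms S T (parity S (hd vs) \<noteq> parity T (hd vs))) (filter (minimal (set vs) ms) us) @ ps))
    (length us * (poly_time n (length vs) (length ms) + 50) + 10)"
  using assms(4)
proof (induction us)
  case Nil
  show ?case
    unfolding body_simps
    by (rule ev_mono, rule ev_If_Atom, (rule ev_rules)+, simp_all)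
next
  case (Cons u us)
  have u: "u \<in> set ms" "set (removals u) \<subseteq> set ms" "weight (first_match (set vs) u ms) \<le> weight u"
    using Cons.prems by simp_all
  note p = fn_poly[OF u(1) assms(1-3) u(2,3)]
  have IH: "\<forall>S \<in> set us. S \<in> set ms \<and> set (removals S) \<subseteq> set ms \<and> weight (first_match (set vs) S ms) \<le> weight S"
    using Cons.prems by simp
  show ?case
    unfolding body_simps
    by (rule ev_mono, rule ev_If_Pair, (rule ev_rules p Cons.IH[OF IH])+) (simp_all add: Let_def)
qed

lemma fn_double:
  "run d f_double [enc_bools u] (enc_list enc_unary (map (\<lambda>b. 2 * of_bool b) u)) (50 * length u + 50)"
proof (induction u)
  case Nil
  show ?case
    unfolding body_simps
    by (rule ev_mono, rule ev_If_Atom, (rule ev_rules)+, simp_all)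
next
  case (Cons a u)
  have two: "enc_unary (2 * of_bool a) = (if a then Pair Atom (Pair Atom Atom) else Atom)"
    by (simp add: enc_unary_simps numeral_2_eq_2)
  show ?case
    unfolding body_simps
    by (rule ev_mono, rule ev_If_Pair, (rule ev_rules Cons)+) (simp_all only: list.map enc_list.simps two, simp_all)
qed

lemma fn_rat_unit:
  "run d f_rat [enc_bool s, Atom] (enc_rat (if s then -1 else 1)) 50"
  using fn_rat[of d s 0] by (simp add: enc_unary_simps dyadic_def)

lemma fn_square_of:
  "run d f_square_of [enc_bools u] (enc_terms (square_terms u)) (50 * length u + 300)"
  unfolding body_simps
  by (rule ev_mono, (rule ev_rules fn_double fn_rat_unit)+)
    (simp_all add: square_terms_def enc_terms_def enc_exponents)

definition square_time :: "nat \<Rightarrow> nat \<Rightarrow> nat \<Rightarrow> nat" where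
  "square_time n g m = standard_time n g m + 50 * n + 400"

lemma fn_squares:
  assumes "\<forall>v \<in> set vs. length v = n" "vs \<noteq> []" "\<forall>T \<in> set ms. length T = n" "set us \<subseteq> set ms"
  shows "run d f_squares [enc_vecs us, enc_vecs ms, enc_vecs vs]
    (enc_list enc_terms (map square_terms (filter (\<lambda>u. first_match (set vs) u ms = u) us)))
    (length us * (square_time n (length vs) (length ms) + 50) + 10)"
  using assms(4)
proof (induction us)
  case Nil
  show ?case
    unfolding body_simps
    by (rule ev_mono, rule ev_If_Atom, (rule ev_rules)+, simp_all)
next
  case (Cons u us)
  have u: "u \<in> set ms" and us: "set us \<subseteq> set ms" using Cons.prems by simp_all
  have "length u = n" using u assms by simp
  then have "run d f_square_of [enc_bools u] (enc_terms (square_terms u)) (50 * n + 300)"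
    using fn_square_of[of d u] by simp
  note rules = this fn_standard[OF u assms(1-3)]
  have s: "run d f_square [enc_bools u, enc_vecs ms, enc_vecs vs, r]
      (if first_match (set vs) u ms = u then Pair (enc_terms (square_terms u)) r else r)
      (square_time n (length vs) (length ms))" for r
    unfolding body_simps
    by (rule ev_mono, (rule ev_rules rules)+) (simp_all add: square_time_def)
  show ?case
    unfolding body_simps
    by (rule ev_mono, rule ev_If_Pair, (rule ev_rules s Cons.IH[OF us])+) simp_all
qed

definition output_time :: "nat \<Rightarrow> nat \<Rightarrow> nat \<Rightarrow> nat \<Rightarrow> nat" where
  "output_time n g m l = m * (poly_time n g m + 50) + l * (square_time n g m + 50) + 200"

lemma fn_output:
  assumes "\<forall>v \<in> set vs. length v = n" "\<forall>T \<in> set ms. length T = n" "set us \<subseteq> set ms"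
    and "\<forall>S \<in> set ms. set (removals S) \<subseteq> set ms \<and> weight (first_match (set vs) S ms) \<le> weight S"
  shows "run d f_output [enc_vecs vs, enc_vecs ms, enc_vecs us, enc_unary n]
    (enc_list enc_terms (basis_output n ms us vs)) (output_time n (length vs) (length ms) (length us))"
proof (cases vs)
  case Nil
  \<comment> \<open>A list of n zero exponents is the same tree as the unary number n, so the
    argument that holds n doubles as the exponent vector of the constant 1.\<close>
  have "enc_list enc_unary (replicate n 0) = enc_unary n"
    by (induction n) (simp_all add: enc_unary_simps)
  then show ?thesis
    unfolding body_simps Nil
    by - (rule ev_mono, rule ev_If_Atom, (rule ev_rules fn_rat_unit)+,
      simp_all add: basis_output_def enc_terms_def output_time_def)
next
  case (Cons v vs')
  then have ne: "vs \<noteq> []" by simp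
  have "\<forall>S \<in> set ms. S \<in> set ms \<and> set (removals S) \<subseteq> set ms \<and> weight (first_match (set vs) S ms) \<le> weight S"
    using assms(4) by blast
  note rules = fn_polys[OF assms(1) ne assms(2) this] fn_squares[OF assms(1) ne assms(2,3)]
  show ?thesis
    unfolding body_simps Cons enc_list.simps
    by (rule ev_mono, rule ev_If_Pair, (rule ev_rules rules[unfolded Cons enc_list.simps])+)
      (simp_all add: basis_output_def output_time_def)
qed

section \<open>The main function\<close>

lemma ev_unary: "ev P env (e_unary k) (enc_unary k) (2 * k + 1)"
proof (induction k)
  case 0
  show ?case unfolding e_unary.simps enc_unary_simps by (rule ev_mono, rule ev_Atom) simp_all
next
  case (Suc k)
  show ?case
    unfolding e_unary.simps enc_unary_simps
    by (rule ev_mono, (rule ev_Pair ev_Atom Suc)+) simp_all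
qed

lemma removals_sqfrees:
  assumes "S \<in> set (sqfrees n d)"
  shows "set (removals S) \<subseteq> set (sqfrees n d)"
proof -
  have "length R = n \<and> weight R \<le> d" if R: "R \<in> set (removals S)" for R
  proof -
    obtain i where "i < length S" "S ! i" "R = S[i := False]" using R by (auto simp: set_removals)
    then show ?thesis using assms weight_remove[of i S] by (auto simp: set_sqfrees)
  qed
  then show ?thesis by (auto simp: set_sqfrees)
qed

definition main_time :: "nat \<Rightarrow> nat \<Rightarrow> nat \<Rightarrow> nat \<Rightarrow> nat \<Rightarrow> nat" where
  "main_time d n m L k = sqfrees_time n 1 + k * (constrain_time n m L + 20) +
    sqfrees_time n d + combos_time n 1 + output_time n L (length (sqfrees n d)) (length (combos n 1)) + 2 * d + 100"

lemma output_time_mono: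
  "n \<le> n' \<Longrightarrow> g \<le> g' \<Longrightarrow> m \<le> m' \<Longrightarrow> l \<le> l' \<Longrightarrow> output_time n g m l \<le> output_time n' g' m' l'"
  unfolding output_time_def poly_time_def square_time_def minimal_time_def standard_time_def
    first_match_time_def matches_time_def terms_time_def
  by (intro add_mono mult_mono order_refl) auto

lemma length_solve: "length (solve cs vs) \<le> length vs + (\<Sum>c\<leftarrow>cs. length (fst c))"
proof (induction cs arbitrary: vs)
  case (Cons c cs)
  show ?case using Cons[of "constrain c vs"] length_constrain[of c vs] by simp
qed simp

lemma fn_main:
  fixes d n m :: nat
  assumes cs: "\<forall>(ts, xs) \<in> set cs. (\<forall>t \<in> set ts. length t = length xs) \<and> set xs \<subseteq> {..<n} \<and>
      (\<forall>p \<in> set ts. \<forall>q \<in> set ts. \<forall>r \<in> set ts. xor3 p q r \<in> set ts) \<and> length xs \<le> m"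
    and L: "length (sqfrees n 1) + (\<Sum>c\<leftarrow>cs. length (fst c)) \<le> L"
  defines "units \<equiv> (if 2 \<le> d then combos n 1 else [])"
  shows "run d f_main [Pair (enc_unary n) (enc_list enc_cstr cs)]
    (enc_list enc_terms (basis_output n (sqfrees n d) units (solve cs (sqfrees n 1)))) (main_time d n m L (length cs))"
proof -
  let ?vs = "solve cs (sqfrees n 1)"
  let ?ms = "sqfrees n d"
  have len1: "\<forall>v \<in> set (sqfrees n 1). length v = n" unfolding set_sqfrees by simp
  have lens: "\<forall>v \<in> set ?vs. length v = n"
    using affine_span_solve[OF len1, of cs] cs by blast
  have solve: "run d f_solve [enc_list enc_cstr cs, enc_vecs (sqfrees n 1)]
    (enc_vecs ?vs) (length cs * (constrain_time n m L + 20) + 10)"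
    by (rule fn_solve[OF len1 _ L]) (use cs in blast)
  have units: "set units \<subseteq> set ?ms" by (auto simp: units_def set_sqfrees set_combos)
  have "weight (first_match (set ?vs) S ?ms) \<le> weight S" if "S \<in> set ?ms" for S
    using that weight_first_match by (auto simp: set_sqfrees)
  then have out: "run d f_output [enc_vecs ?vs, enc_vecs ?ms, enc_vecs units, enc_unary n]
    (enc_list enc_terms (basis_output n ?ms units ?vs)) (output_time n (length ?vs) (length ?ms) (length units))"
    using removals_sqfrees units lens by (intro fn_output) (auto simp: set_sqfrees)
  have out: "run d f_output [enc_vecs ?vs, enc_vecs ?ms, enc_vecs units, enc_unary n]
    (enc_list enc_terms (basis_output n ?ms units ?vs)) (output_time n L (length ?ms) (length (combos n 1)))"
    by (rule fn_mono[OF out refl output_time_mono])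
      (use L length_solve[of cs "sqfrees n 1"] in \<open>auto simp: units_def\<close>)
  have sq: "run d f_sqfrees [enc_unary n, enc_unary k, Atom] (enc_vecs (sqfrees n k)) (sqfrees_time n k)" for k
    using fn_sqfrees[of d n k "[]"] by simp
  note rules = solve out sq fn_combos ev_unary
  show ?thesis
  proof (cases "2 \<le> d")
    case True
    then have "units = combos n 1" by (simp add: units_def)
    then show ?thesis
      unfolding fn_program b_main_def if_P[OF True]
      by - (rule ev_mono, (rule ev_rules rules[unfolded \<open>units = _\<close>])+, simp_all add: main_time_def)
  next
    case False
    then have "units = []" by (simp add: units_def)
    then show ?thesis
      unfolding fn_program b_main_def if_not_P[OF False]
      by - (rule ev_mono, (rule ev_rules rules[unfolded \<open>units = _\<close> enc_list.simps])+, simp_all add: main_time_def)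
  qed
qed

section \<open>Running time\<close>

text \<open>A crude bound on a binomial coefficient, chosen because it is compatible with Pascal's
  rule: (n+1)^(k+1) + (n+1)^k = (n+2) (n+1)^k.\<close>

lemma length_combos_le: "length (combos n k) \<le> (n + 1) ^ k"
proof (induction n k rule: combos.induct)
  case (4 n k)
  have "length (combos (Suc n) (Suc k)) \<le> (n + 1) ^ Suc k + (n + 1) ^ k"
    using 4 by (simp del: power_Suc)
  also have "\<dots> = (n + 2) * (n + 1) ^ k" by (simp add: algebra_simps)
  also have "\<dots> \<le> (n + 2) * (n + 2) ^ k" by (intro mult_le_mono2 power_mono) auto
  finally show ?case by simp
qed auto

lemma length_sqfrees_le: "length (sqfrees n d) \<le> (d + 1) * (n + 1) ^ d"
proof (induction d)
  case 0
  then show ?case using length_combos_le[of n 0] by simp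
next
  case (Suc d)
  have "length (sqfrees n (Suc d)) \<le> (d + 1) * (n + 1) ^ d + (n + 1) ^ Suc d"
    using Suc length_combos_le[of n "Suc d"] by (simp del: power_Suc)
  also have "\<dots> \<le> (d + 1) * (n + 1) ^ Suc d + (n + 1) ^ Suc d"
    by (intro add_right_mono mult_le_mono2 power_increasing) auto
  finally show ?case by (simp add: algebra_simps)
qed

lemma combos_time_le: "combos_time n k \<le> 60 * (n + 1) ^ Suc (Suc k)"
proof (induction n k rule: combos_time.induct)
  case (1 k)
  show ?case by simp
next
  case (2 n)
  then show ?case using length_combos_le[of n 0] by simp
next
  case (3 n k)
  define q where "q = (n + 1) ^ k"
  have q: "1 \<le> q" "q \<le> (n + 2) ^ k" unfolding q_def by (simp, intro power_mono) auto
  have "combos_time (Suc n) (Suc k) \<le>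
      60 * ((n + 1) * ((n + 1) * ((n + 1) * q))) + 60 * ((n + 1) * ((n + 1) * q)) + 20 * ((n + 1) * q) + 20 * q + 80"
    using 3 length_combos_le[of n "Suc k"] length_combos_le[of n k] by (simp add: q_def)
  also have "\<dots> \<le> q * (60 * ((n + 1) * ((n + 1) * (n + 1))) + 60 * ((n + 1) * (n + 1)) + 20 * (n + 1) + 100)"
    using q(1) by (simp add: algebra_simps)
  \<comment> \<open>With m = n + 1 this rests on 60 m^3 + 60 m^2 + 20 m + 100 <= 60 (m + 1)^3, valid
    for m >= 1.\<close>
  also have "\<dots> \<le> (n + 2) ^ k * (60 * ((n + 2) * ((n + 2) * (n + 2))))"
    by (intro mult_le_mono q(2)) (simp add: algebra_simps)
  also have "\<dots> = 60 * (n + 2) ^ Suc (Suc (Suc k))" by (simp only: power_Suc ac_simps)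
  also have "n + 2 = Suc n + 1" by simp
  finally show ?case .
qed

lemma sqfrees_time_le: "sqfrees_time n d \<le> (d + 1) * (120 * (n + 1) ^ Suc (Suc d))"
proof (induction d)
  case 0
  show ?case using combos_time_le[of n 0] length_combos_le[of n 0] by simp
next
  case (Suc d)
  let ?b = "(n + 1) ^ Suc (Suc (Suc d))"
  have "length (combos n (Suc d)) \<le> ?b"
    by (rule order_trans[OF length_combos_le power_increasing]) auto
  moreover have "1 \<le> ?b" by (rule one_le_power) simp
  moreover have "combos_time n (Suc d) \<le> 60 * ?b"
    by (rule combos_time_le)
  moreover have "(d + 1) * (120 * (n + 1) ^ Suc (Suc d)) \<le> (d + 1) * (120 * ?b)"
    by (intro mult_le_mono2 power_increasing) auto
  ultimately have "sqfrees_time n (Suc d) \<le> (d + 1) * (120 * ?b) + 120 * ?b"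
    using Suc unfolding sqfrees_time.simps by linarith
  then show ?case by (simp add: algebra_simps)
qed

lemma powers_le:
  assumes "1 \<le> (x :: nat)"
  shows "1 \<le> x ^ 5" "x \<le> x ^ 5" "x ^ 2 \<le> x ^ 5" "x ^ 3 \<le> x ^ 5" "x ^ 4 \<le> x ^ 5"
  using assms power_increasing[of 1 5 x] power_increasing[of 2 5 x] power_increasing[of 3 5 x]
    power_increasing[of 4 5 x] by simp_all

lemma power5_eq: "x ^ 5 = x * x * x * x * (x :: nat)"
  by (simp add: numeral_eq_Suc ac_simps)

text \<open>All parameters are replaced by one bound \<open>x\<close>. The leading term 100 x^5 of
  the output cost counts candidates, removals, sets compared, generators and coordinates; the factor
  100 stands for two parities at 50 steps per coordinate.\<close>

lemma time_polynomials:
  assumes "1 \<le> x"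
  shows "x * (constrain_time x x x + 20) \<le> 1500 * x ^ 5"
    and "output_time x x x x \<le> 20000 * x ^ 5"
proof -
  note powers = power2_eq_square power3_eq_cube power4_eq_xxxx power5_eq
  have "x * (constrain_time x x x + 20) = 160 * x ^ 4 + 800 * x ^ 3 + 260 * x ^ 2 + 220 * x"
    unfolding constrain_time_def powers by (simp add: algebra_simps)
  then show "x * (constrain_time x x x + 20) \<le> 1500 * x ^ 5"
    using powers_le[OF assms] by linarith
  have "output_time x x x x =
      100 * x ^ 5 + 750 * x ^ 4 + 3470 * x ^ 3 + 5210 * x ^ 2 + 1140 * x + 200"
    unfolding output_time_def poly_time_def square_time_def minimal_time_def standard_time_def
      first_match_time_def matches_time_def terms_time_def powers
    by (simp add: algebra_simps)
  then show "output_time x x x x \<le> 20000 * x ^ 5"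
    using powers_le[OF assms] by linarith
qed

lemma constrain_time_mono:
  "n \<le> n' \<Longrightarrow> m \<le> m' \<Longrightarrow> L \<le> L' \<Longrightarrow> constrain_time n m L \<le> constrain_time n' m' L'"
  unfolding constrain_time_def by (intro add_mono mult_mono order_refl) auto

text \<open>The constant is rounded up from 1500 + 20000 + 3 * 240 + 2 + 100.\<close>

lemma main_time_le:
  assumes "1 \<le> x" "n \<le> x" "m \<le> x" "L \<le> x" "k \<le> x" "d \<le> x" "length (sqfrees n d) \<le> x"
    "length (combos n 1) \<le> x" "sqfrees_time n 1 \<le> 240 * x ^ 2" "sqfrees_time n d \<le> 240 * x ^ 2"
    "combos_time n 1 \<le> 240 * x ^ 2"
  shows "main_time d n m L k \<le> 23000 * x ^ 5"
proof -
  have "k * (constrain_time n m L + 20) \<le> x * (constrain_time x x x + 20)"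
    using assms by (intro mult_mono add_mono constrain_time_mono) auto
  moreover have "output_time n L (length (sqfrees n d)) (length (combos n 1)) \<le> output_time x x x x"
    using assms by (intro output_time_mono)
  ultimately show ?thesis
    unfolding main_time_def using assms(6,9-11) time_polynomials[OF assms(1)] powers_le[OF assms(1)]
    by linarith
qed

section \<open>Size of the output\<close>

lemma tree_size_enc_list: "tree_size (enc_list f xs) = 1 + (\<Sum>x\<leftarrow>xs. 1 + tree_size (f x))"
  by (induction xs) auto

lemma tree_size_enc_list_le:
  "(\<And>x. x \<in> set xs \<Longrightarrow> tree_size (f x) \<le> b) \<Longrightarrow> tree_size (enc_list f xs) \<le> 1 + length xs * (1 + b)"
proof (induction xs)
  case (Cons x xs)
  then have "tree_size (f x) \<le> b" "tree_size (enc_list f xs) \<le> 1 + length xs * (1 + b)" by simp_all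
  then show ?case by simp
qed simp

lemma tree_size_pos: "1 \<le> tree_size t"
  by (cases t) auto

lemma length_le_tree_size: "length xs \<le> tree_size (enc_list f xs)"
  unfolding tree_size_enc_list by (induction xs) auto

lemma tree_size_mem_le: "x \<in> set xs \<Longrightarrow> tree_size (f x) \<le> tree_size (enc_list f xs)"
  unfolding tree_size_enc_list using member_le_sum_list[of "1 + tree_size (f x)" "map (\<lambda>x. 1 + tree_size (f x)) xs"]
  by force

lemma tree_size_enc_bool: "tree_size (enc_bool b) \<le> 3"
  by (simp add: enc_bool_def)

lemma tree_size_enc_unary: "tree_size (enc_unary n) = 2 * n + 1"
  by (induction n) (simp_all add: enc_unary_simps)

lemma tree_size_dyadic: "tree_size (enc_rat (dyadic s k)) \<le> 4 * k + 20"
proof -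
  have "tree_size (enc_binary (2 ^ k)) \<le> 1 + length (replicate k False @ [True]) * (1 + 3)"
    unfolding enc_binary_def bits_power by (rule tree_size_enc_list_le) (rule tree_size_enc_bool)
  then show ?thesis
    unfolding enc_rat_dyadic using tree_size_enc_bool[of s] tree_size_enc_bool[of True] by simp
qed

lemma tree_size_basis_terms:
  assumes "length S = n" "length T = n" "weight T \<le> weight S" "T \<noteq> S" "\<forall>u \<in> set us. length u = n"
  shows "tree_size (enc_terms (basis_terms us S T c)) \<le> 1 + length us * (8 * n + 30)"
proof -
  have le_length: "weight v \<le> length v" for v by (induction v) auto
  let ?xs = "basis_terms us S T c"
  have "tree_size (enc_terms ?xs) \<le> 1 + length ?xs * (1 + (8 * n + 29))"
    unfolding enc_terms_def
  proof (rule tree_size_enc_list_le)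
    fix x assume "x \<in> set ?xs"
    then obtain u where u: "u \<in> set us" "x = (basis_coef S T c u, map of_bool u)" "basis_coef S T c u \<noteq> 0"
      by (auto simp: basis_terms_def)
    then have sub: "sub u S \<or> sub u T" by (auto simp: basis_coef_def split: if_splits)
    let ?k = "weight S - weight u"
    have "basis_coef S T c u = dyadic (odd ?k) (?k - 1) \<or> basis_coef S T c u = dyadic (odd ?k) ?k \<or>
        basis_coef S T c u = dyadic ((\<not> c) \<noteq> odd ?k) ?k"
      using basis_coef_dyadic(2)[OF assms(1-4) sub, of c] u(3) by presburger
    moreover have "?k \<le> weight S" "?k - 1 \<le> weight S" by simp_all
    ultimately obtain s k where s_k: "basis_coef S T c u = dyadic s k" "k \<le> weight S" by blast
    then have "k \<le> n" using le_length[of S] assms(1) by simp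
    then have "tree_size (enc_rat (basis_coef S T c u)) \<le> 4 * n + 20"
      using tree_size_dyadic[of s k] s_k(1) by simp
    moreover have "tree_size (enc_bools u) \<le> 1 + length u * (1 + 3)"
      by (rule tree_size_enc_list_le) (rule tree_size_enc_bool)
    ultimately show "tree_size (enc_term x) \<le> 8 * n + 29"
      using u assms(5) by (simp add: enc_exponents)
  qed
  also have "\<dots> \<le> 1 + length us * (8 * n + 30)"
  proof -
    have "length ?xs \<le> length us" by (simp add: basis_terms_def)
    then show ?thesis by (intro add_left_mono mult_le_mono) auto
  qed
  finally show ?thesis .
qed

lemma tree_size_square_terms:
  assumes "length u = n"
  shows "tree_size (enc_terms (square_terms u)) \<le> 10 * n + 60"
proof -
  have unit: "tree_size (enc_rat (1)) \<le> 20" "tree_size (enc_rat (-1)) \<le> 20"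
    using tree_size_dyadic[of False 0] tree_size_dyadic[of True 0] by (simp_all add: dyadic_def)
  have "tree_size (enc_bools u) \<le> 1 + length u * (1 + 3)"
    by (rule tree_size_enc_list_le) (rule tree_size_enc_bool)
  moreover have "tree_size (enc_list enc_unary (map (\<lambda>b. 2 * of_bool b) u)) \<le>
      1 + length (map (\<lambda>b. 2 * of_bool b :: nat) u) * (1 + 5)"
    by (rule tree_size_enc_list_le) (auto simp: tree_size_enc_unary)
  ultimately show ?thesis
    using unit assms by (simp add: square_terms_def enc_terms_def enc_exponents)
qed

lemma tree_size_output:
  assumes "\<forall>T \<in> set ms. length T = n" "\<forall>u \<in> set us. length u = n"
    and "\<forall>S \<in> set ms. weight (first_match (set vs) S ms) \<le> weight S"
    and "1 \<le> x" "n \<le> x" "length ms \<le> x" "length us \<le> x"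
  shows "tree_size (enc_list enc_terms (basis_output n ms us vs)) \<le> 500 * x ^ 5"
proof (cases "vs = []")
  case True
  have "enc_list enc_unary (replicate n 0) = enc_unary n"
    by (induction n) (simp_all add: enc_unary_simps)
  moreover have "tree_size (enc_rat 1) \<le> 20"
    using tree_size_dyadic[of False 0] by (simp add: dyadic_def)
  ultimately have "tree_size (enc_list enc_terms (basis_output n ms us vs)) \<le> 2 * n + 40"
    by (simp add: basis_output_def True enc_terms_def tree_size_enc_unary)
  then show ?thesis using powers_le[OF assms(4)] assms(5) by linarith
next
  case False
  let ?out = "basis_output n ms us vs" and ?b = "x * (8 * x + 30) + 10 * x + 61"
  have "tree_size (enc_list enc_terms ?out) \<le> 1 + length ?out * (1 + ?b)"
  proof (rule tree_size_enc_list_le)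
    fix ts assume "ts \<in> set ?out"
    then consider S where "S \<in> set ms" "minimal (set vs) ms S" "ts = basis_terms ms S (first_match (set vs) S ms)
        (parity S (hd vs) \<noteq> parity (first_match (set vs) S ms) (hd vs))"
      | u where "u \<in> set us" "ts = square_terms u"
      using False by (auto simp: basis_output_def Let_def)
    then show "tree_size (enc_terms ts) \<le> ?b"
    proof cases
      case 1
      let ?T = "first_match (set vs) S ms"
      have T: "length ?T = n" "length S = n" "?T \<noteq> S"
        using assms(1) first_match_in_set[OF 1(1) matches_refl] 1(1,2) by (auto simp: minimal_def)
      have "tree_size (enc_terms ts) \<le> 1 + length ms * (8 * n + 30)"
        unfolding 1(3) by (rule tree_size_basis_terms) (use T assms(1,3) 1(1) in auto)
      also have "\<dots> \<le> 1 + x * (8 * x + 30)"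
        using assms by (intro add_mono mult_mono) auto
      finally show ?thesis by simp
    next
      case 2
      then show ?thesis using tree_size_square_terms[of u n] assms(2,5) by force
    qed
  qed
  also have "\<dots> \<le> 1 + (x + x) * (1 + ?b)"
  proof -
    have "length ?out \<le> x + x"
      using False add_mono[OF order_trans[OF length_filter_le[of "minimal (set vs) ms" ms] assms(6)]
        order_trans[OF length_filter_le[of "\<lambda>u. first_match (set vs) u ms = u" us] assms(7)]]
      by (simp add: basis_output_def)
    then show ?thesis by (intro add_left_mono mult_le_mono1)
  qed
  also have "\<dots> = 16 * x ^ 3 + 80 * x ^ 2 + 124 * x + 1"
    by (simp add: algebra_simps power2_eq_square power3_eq_cube)
  also have "\<dots> \<le> 500 * x ^ 5" using powers_le[OF assms(4)] by linarith
  finally show ?thesis .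
qed

section \<open>Instances\<close>

text \<open>Two of any three truth values agree, so the minority identities determine all eight
  values of \<open>f\<close>, and these are the sums modulo 2.\<close>

lemma minority_xor3:
  assumes "minority_operation f" "is_relation R" "polymorphism 3 f R"
    and "p \<in> snd R" "q \<in> snd R" "r \<in> snd R"
  shows "xor3 p q r \<in> snd R"
proof -
  have f: "f [a, b, c] = (a \<noteq> (b \<noteq> c))" for a b c
    using assms(1) unfolding minority_operation_def by (cases a; cases b; cases c) auto
  have len: "length p = fst R" "length q = fst R" "length r = fst R"
    using assms(2,4-6) by (auto simp: is_relation_def)
  have "map (\<lambda>j. f (map (\<lambda>t. t ! j) [p, q, r])) [0..<fst R] \<in> snd R"
    using assms(3-6) unfolding polymorphism_def by (elim allE[of _ "[p, q, r]"]) simp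
  moreover have "map (\<lambda>j. f (map (\<lambda>t. t ! j) [p, q, r])) [0..<fst R] = xor3 p q r"
    using len by (intro nth_equalityI) (auto simp: f nth_xor3)
  ultimately show ?thesis by simp
qed

text \<open>Replaces the encoded constraints by a list of pairs on which the program is specified.
  Distinctness of the tuples and the number of constraints are retained for the size estimate of
  finite languages.\<close>

lemma decode_instance:
  assumes "encodes_instance n C input"
  obtains cs where "input = Pair (enc_unary n) (enc_list enc_cstr cs)"
    and "\<forall>(ts, xs) \<in> set cs. \<exists>c \<in> C. distinct ts \<and> set ts = snd (fst c) \<and> xs = snd c"
    and "\<forall>c \<in> C. \<exists>(ts, xs) \<in> set cs. set ts = snd (fst c) \<and> xs = snd c"
    and "length cs = card C"
proof -
  obtain cs0 us where 0: "distinct cs0" "set cs0 = C" "list_all2 encodes_cstr cs0 us"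
      "input = Pair (enc_unary n) (enc_list id us)"
    using assms by (auto simp: encodes_instance_def)
  have "\<exists>cs. enc_list id us = enc_list enc_cstr cs \<and> length cs = length cs0 \<and>
      (\<forall>(ts, xs) \<in> set cs. \<exists>c \<in> set cs0. distinct ts \<and> set ts = snd (fst c) \<and> xs = snd c) \<and>
      (\<forall>c \<in> set cs0. \<exists>(ts, xs) \<in> set cs. set ts = snd (fst c) \<and> xs = snd c)"
    using 0(3)
  proof (induction rule: list_all2_induct)
    case Nil
    show ?case by (intro exI[of _ "[]"]) simp
  next
    case (Cons c cs0 u us)
    from Cons(1) obtain ts where ts: "distinct ts" "set ts = snd (fst c)" "u = enc_cstr (ts, snd c)"
      by (auto simp: encodes_cstr_def enc_cstr_def)
    from Cons obtain cs where "enc_list id us = enc_list enc_cstr cs" "length cs = length cs0"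
      "\<forall>(ts, xs) \<in> set cs. \<exists>c \<in> set cs0. distinct ts \<and> set ts = snd (fst c) \<and> xs = snd c"
      "\<forall>c \<in> set cs0. \<exists>(ts, xs) \<in> set cs. set ts = snd (fst c) \<and> xs = snd c" by blast
    then show ?case
      using ts by (intro exI[of _ "(ts, snd c) # cs"]) (auto simp: id_def)
  qed
  then obtain cs where cs: "enc_list id us = enc_list enc_cstr cs" "length cs = length cs0"
      "\<forall>(ts, xs) \<in> set cs. \<exists>c \<in> C. distinct ts \<and> set ts = snd (fst c) \<and> xs = snd c"
      "\<forall>c \<in> C. \<exists>(ts, xs) \<in> set cs. set ts = snd (fst c) \<and> xs = snd c"
    unfolding 0(2) by (elim exE conjE)
  show ?thesis
  proof (rule that)
    show "input = Pair (enc_unary n) (enc_list enc_cstr cs)" by (simp only: 0(4) cs(1))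
    show "length cs = card C" using cs(2) 0(1,2) distinct_card by fastforce
  qed (fact cs)+
qed

text \<open>All the list lengths in the algorithm are at most \<open>z\<close> to the power \<open>2 * max 1 d\<close>, where \<open>z\<close>
  is the size of the input, and its running time is a polynomial of degree 5 in that bound.\<close>

theorem program_correct:
  assumes \<Gamma>: "\<forall>R \<in> \<Gamma>. is_relation R" "minority_operation f" "\<forall>R \<in> \<Gamma>. polymorphism 3 f R"
    and inst: "csp_instance \<Gamma> n C" "encodes_instance n C input"
  shows "\<exists>G output k. reduced_groebner_basis n (combinatorial_ideal n (Sol n C)) G \<and>
    encodes_polys n (truncation n d G) output \<and> computes_in (program d) input output k \<and>
    k + tree_size output \<le> max 2 (tree_size input) ^ (20 * max 1 d)"
proof -
  obtain cs where cs: "input = Pair (enc_unary n) (enc_list enc_cstr cs)"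
    "\<forall>(ts, xs) \<in> set cs. \<exists>c \<in> C. distinct ts \<and> set ts = snd (fst c) \<and> xs = snd c"
    "\<forall>c \<in> C. \<exists>(ts, xs) \<in> set cs. set ts = snd (fst c) \<and> xs = snd c"
    by (rule decode_instance[OF inst(2)], rule that; assumption)
  define z where "z = tree_size input"
  have z: "z = 2 * n + 2 + tree_size (enc_list enc_cstr cs)"
    by (simp add: z_def cs(1) tree_size_enc_unary)
  have z3: "3 \<le> z" using z tree_size_pos[of "enc_list enc_cstr cs"] by linarith
  have C: "R \<in> \<Gamma> \<and> length xs = fst R \<and> set xs \<subseteq> {..<n}" if "(R, xs) \<in> C" for R xs
    using inst(1) that by (auto simp: csp_instance_def)
  have ok: "(\<forall>t \<in> set ts. length t = length xs) \<and> set xs \<subseteq> {..<n} \<and>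
      (\<forall>p \<in> set ts. \<forall>q \<in> set ts. \<forall>r \<in> set ts. xor3 p q r \<in> set ts) \<and> length xs \<le> z"
    if c_in: "(ts, xs) \<in> set cs" for ts xs
  proof -
    obtain c where c: "c \<in> C" "set ts = snd (fst c)" "xs = snd c" using bspec[OF cs(2) c_in] by auto
    then have R: "fst c \<in> \<Gamma>" "length xs = fst (fst c)" "set xs \<subseteq> {..<n}"
      using C[of "fst c" xs] by simp_all
    have "length xs \<le> tree_size (enc_list enc_unary xs)" by (rule length_le_tree_size)
    also have "\<dots> \<le> tree_size (enc_cstr (ts, xs))" by (simp add: enc_cstr_def)
    also have "\<dots> \<le> tree_size (enc_list enc_cstr cs)" by (rule tree_size_mem_le[OF c_in])
    finally have "length xs \<le> z" using z by simp
    then show ?thesis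
      using R c \<Gamma> minority_xor3[OF \<Gamma>(2)] by (auto simp: is_relation_def)
  qed
  define vs where "vs = solve cs (sqfrees n 1)"
  have len1: "\<forall>v \<in> set (sqfrees n 1). length v = n" unfolding set_sqfrees by simp
  have vs: "\<forall>v \<in> set vs. length v = n" "affine_span xor3 (set vs) = Sol n C"
  proof -
    have *: "(\<forall>v \<in> set vs. length v = n) \<and> affine_span xor3 (set vs) =
        {v \<in> vecs n. \<forall>(ts, xs) \<in> set cs. map ((!) v) xs \<in> set ts}"
      unfolding vs_def affine_span_sqfrees_1[symmetric]
      by (rule affine_span_solve[OF len1]) (use ok in blast)
    have "(\<forall>(ts, xs) \<in> set cs. map ((!) v) xs \<in> set ts) \<longleftrightarrow> (\<forall>(R, xs) \<in> C. map ((!) v) xs \<in> snd R)" for v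
      using cs(2,3) by fastforce
    then show "\<forall>v \<in> set vs. length v = n" "affine_span xor3 (set vs) = Sol n C"
      using * by (auto simp: Sol_def)
  qed
  have affine: "affine_set n (Sol n C)"
    unfolding affine_set_def vs(2)[symmetric]
    using affine_span_vecs[OF vs(1)] affine_span.closed by metis
  define units where "units = (if 2 \<le> d then combos n 1 else [])"
  define out where "out = enc_list enc_terms (basis_output n (sqfrees n d) units vs)"
  have enc: "encodes_polys n (truncation n d (reduced_basis n (Sol n C))) out"
    unfolding out_def by (rule encodes_basis_output[OF vs(1) vs(2)[symmetric] units_def])
  define D where "D = max 1 d"
  \<comment> \<open>In the bound on the number of squarefree monomials, one factor z^D pays for d +
    1 and one for (n + 1)^d.\<close>
  define x where "x = z ^ (2 * D)"
  have D: "1 \<le> D" "d \<le> D" by (simp_all add: D_def)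
  have pow: "z ^ a \<le> x" if "a \<le> 2 * D" for a
    unfolding x_def using that z3 by (intro power_increasing) auto
  have x1: "1 \<le> x" using z3 by (simp add: x_def)
  have zx: "z ^ 2 \<le> x" by (rule pow) (use D in simp)
  \<comment> \<open>Room for the starting points, bounded by 2 z, and for all listed tuples, bounded
    by z.\<close>
  have "3 * z \<le> z ^ 2" using z3 by (simp add: power2_eq_square)
  then have z_le: "3 * z \<le> x" using zx by simp
  \<comment> \<open>Absorbing d + 1 into a power of \<open>z\<close> keeps the constant of the final
    exponent independent of \<open>d\<close>.\<close>
  have d1: "d + 1 \<le> z ^ D"
  proof -
    have "d + 1 \<le> 2 ^ d" by (induction d) auto
    also have "\<dots> \<le> z ^ d" using z3 by (intro power_mono) auto
    also have "\<dots> \<le> z ^ D" using z3 D by (intro power_increasing) auto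
    finally show ?thesis .
  qed
  have n1: "n + 1 \<le> z" using z by simp
  have n_pow: "(n + 1) ^ a \<le> z ^ a" for a using n1 by (rule power_mono) simp
  have sq_len: "length (sqfrees n d) \<le> x"
  proof -
    have "length (sqfrees n d) \<le> (d + 1) * (n + 1) ^ d" by (rule length_sqfrees_le)
    also have "\<dots> \<le> z ^ D * z ^ D"
    proof (intro mult_le_mono d1)
      have "z ^ d \<le> z ^ D" using z3 D by (intro power_increasing) auto
      then show "(n + 1) ^ d \<le> z ^ D" using n_pow[of d] by simp
    qed
    finally show ?thesis by (simp add: x_def mult_2 power_add)
  qed
  have sq_time: "sqfrees_time n a \<le> 240 * x ^ 2" if a: "a + 1 \<le> z ^ D" "a \<le> D" for a
  proof -
    have "sqfrees_time n a \<le> (a + 1) * (120 * (n + 1) ^ Suc (Suc a))" by (rule sqfrees_time_le)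
    \<comment> \<open>Here a + 2 <= 3 D because a <= D and 1 <= D; the resulting power z^(4 D) is
      x^2.\<close>
    also have "\<dots> \<le> z ^ D * (120 * z ^ (3 * D))"
    proof (intro mult_le_mono a(1) order_refl)
      have "z ^ Suc (Suc a) \<le> z ^ (3 * D)" using z3 D a by (intro power_increasing) auto
      then show "(n + 1) ^ Suc (Suc a) \<le> z ^ (3 * D)" using n_pow[of "Suc (Suc a)"] by simp
    qed
    also have "\<dots> = 120 * x ^ 2"
      by (simp add: x_def flip: power_add power_mult)
    finally show ?thesis by simp
  qed
  have "z ^ 1 \<le> z ^ D" using z3 D by (intro power_increasing) auto
  then have z_D: "2 \<le> z ^ D" using z3 by simp
  have "(\<Sum>c\<leftarrow>cs. length (fst c)) \<le> tree_size (enc_list enc_cstr cs)"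
    unfolding tree_size_enc_list
  proof (induction cs)
    case (Cons c cs)
    have "length (fst c) \<le> tree_size (enc_cstr c)"
      using length_le_tree_size[of "fst c" enc_bools] by (simp add: enc_cstr_def)
    then show ?case using Cons by simp
  qed simp
  moreover have "length (sqfrees n 1) \<le> 2 * z"
    using length_sqfrees_le[of n 1] n1 by simp
  ultimately have L: "length (sqfrees n 1) + (\<Sum>c\<leftarrow>cs. length (fst c)) \<le> x"
    using z z_le by linarith
  have k: "length cs \<le> x"
    using length_le_tree_size[of cs enc_cstr] z z_le by linarith
  have combos_len: "length (combos n 1) \<le> x"
    using length_combos_le[of n 1] n1 z_le by simp
  have combos_time: "combos_time n 1 \<le> 240 * x ^ 2"
  proof -
    have "combos_time n 1 \<le> sqfrees_time n 1" by simp
    then show ?thesis using sq_time[of 1] z_D D by simp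
  qed
  have m: "z \<le> x" "n \<le> x" "d \<le> x" using z_le n1 sq_len d1 pow[of D] by simp_all
  have main: "run d f_main [input] out (main_time d n z x (length cs))"
    unfolding cs(1) out_def vs_def units_def by (rule fn_main) (use ok L in blast)+
  have time: "main_time d n z x (length cs) \<le> 23000 * x ^ 5"
    by (rule main_time_le) (use m k x1 sq_len combos_len combos_time sq_time[of 1] sq_time[of d] z_D D d1 in simp_all)
  have "exec d [input] (ECall 0 [EVar 0]) out (2 + main_time d n z x (length cs))"
    by (rule ev_mono, (rule ev_rules main)+) simp_all
  then obtain t where t: "eval (program d) [input] (ECall 0 [EVar 0]) out t" "t \<le> 2 + 23000 * x ^ 5"
    unfolding ev_def using time by force
  have size: "tree_size out \<le> 500 * x ^ 5"
    unfolding out_def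
  proof (rule tree_size_output)
    show "\<forall>S \<in> set (sqfrees n d). weight (first_match (set vs) S (sqfrees n d)) \<le> weight S"
      using weight_first_match by (auto simp: set_sqfrees)
    show "length units \<le> x" using combos_len by (simp add: units_def)
  qed (use x1 m sq_len in \<open>auto simp: set_sqfrees set_combos units_def\<close>)
  \<comment> \<open>3^10 = 59049 exceeds 2 + 23000 + 500, and z is at least 3. The exponents 10 D
    and 5 * 2 D then add up to 20 D.\<close>
  have "t + tree_size out \<le> 3 ^ 10 * x ^ 5"
    using t(2) size powers_le(1)[OF x1] by simp
  also have "\<dots> \<le> z ^ (10 * D) * x ^ 5"
  proof (rule mult_le_mono1)
    have "3 ^ 10 \<le> z ^ 10" using z3 by (rule power_mono) simp
    also have "\<dots> \<le> z ^ (10 * D)" using z3 D by (intro power_increasing) auto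
    finally show "3 ^ 10 \<le> z ^ (10 * D)" .
  qed
  also have "\<dots> = z ^ (20 * D)"
    by (simp add: x_def flip: power_add power_mult)
  also have "\<dots> = max 2 (tree_size input) ^ (20 * max 1 d)"
    using z3 by (simp add: z_def D_def)
  finally show ?thesis
    using reduced_groebner_basis_reduced_basis[OF affine] enc t(1) unfolding computes_in_def by blast
qed

text \<open>The number of constraints is polynomial in \<open>n\<close> because the instance lists no constraint twice.\<close>

lemma finite_language_size:
  assumes \<Gamma>: "finite \<Gamma>" "\<forall>R \<in> \<Gamma>. is_relation R"
  shows "\<exists>a \<ge> 1. \<forall>n C input. csp_instance \<Gamma> n C \<and> encodes_instance n C input \<longrightarrow>
    tree_size input \<le> max 2 n ^ a"
proof -
  define A where "A = Max (insert 0 (fst ` \<Gamma>))"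
  have A: "fst R \<le> A" if "R \<in> \<Gamma>" for R
    unfolding A_def using that \<Gamma>(1) by (intro Max_ge) auto
  \<comment> \<open>\<open>B\<close> times N bounds the tree of one constraint: at most 2^A tuples
    of at most 4 A + 1 nodes each, and at most A variable indices in unary.\<close>
  define B where "B = 2 + 2 ^ A * (4 * A + 2) + A * 4"
  \<comment> \<open>The factor that remains in front of N^(A + 1); since K <= 2^K <= N^K, it moves
    into the exponent.\<close>
  define K where "K = 6 + card \<Gamma> * (A + 1) * (B + 1)"
  have "tree_size input \<le> max 2 n ^ (K + A + 1)"
    if inst: "csp_instance \<Gamma> n C" "encodes_instance n C input" for n C input
  proof -
    define N where "N = max 2 n"
    have N: "2 \<le> N" "n \<le> N" by (simp_all add: N_def)
    obtain cs where cs: "input = Pair (enc_unary n) (enc_list enc_cstr cs)"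
      "\<forall>(ts, xs) \<in> set cs. \<exists>c \<in> C. distinct ts \<and> set ts = snd (fst c) \<and> xs = snd c"
      "length cs = card C"
      by (rule decode_instance[OF inst(2)], rule that; assumption)
    have C: "R \<in> \<Gamma> \<and> length xs = fst R \<and> set xs \<subseteq> {..<n}" if "(R, xs) \<in> C" for R xs
      using inst(1) that by (auto simp: csp_instance_def)
    let ?X = "{xs. set xs \<subseteq> {..<n} \<and> length xs \<le> A}"
    have "card ?X = (\<Sum>i\<le>A. n ^ i)"
      using card_lists_length_le[of "{..<n}" A] by simp
    also have "\<dots> \<le> (\<Sum>i\<le>A. N ^ A)"
    proof (rule sum_mono)
      fix i assume "i \<in> {..A}"
      have "n ^ i \<le> N ^ i" using N(2) by (rule power_mono) simp
      also have "\<dots> \<le> N ^ A" using N \<open>i \<in> {..A}\<close> by (intro power_increasing) auto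
      finally show "n ^ i \<le> N ^ A" .
    qed
    finally have X: "card ?X \<le> (A + 1) * N ^ A" by simp
    have "C \<subseteq> \<Gamma> \<times> ?X" using C A by fastforce
    moreover have "finite (\<Gamma> \<times> ?X)" using \<Gamma>(1) finite_lists_length_le[of "{..<n}" A] by simp
    ultimately have "card C \<le> card (\<Gamma> \<times> ?X)" by (intro card_mono)
    also have "\<dots> \<le> card \<Gamma> * ((A + 1) * N ^ A)"
      unfolding card_cartesian_product by (rule mult_le_mono2[OF X])
    finally have card: "length cs \<le> card \<Gamma> * ((A + 1) * N ^ A)" by (simp add: cs(3))
    have "tree_size (enc_cstr c) \<le> B * N" if c: "c \<in> set cs" for c
    proof -
      obtain ts xs where c_eq: "c = (ts, xs)" by fastforce
      obtain R where R: "(R, xs) \<in> C" "distinct ts" "set ts = snd R"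
        using bspec[OF cs(2) c[unfolded c_eq]] by auto
      have len: "length t \<le> A" if "t \<in> set ts" for t
        using that R C[OF R(1)] A[of R] \<Gamma>(2) by (auto simp: is_relation_def)
      have xs: "length xs \<le> A" "set xs \<subseteq> {..<n}" using C[OF R(1)] A by auto
      have "set ts \<subseteq> {t. set t \<subseteq> UNIV \<and> length t = fst R}"
        using R C[OF R(1)] \<Gamma>(2) by (auto simp: is_relation_def)
      then have "card (set ts) \<le> 2 ^ fst R"
        using card_mono[OF finite_lists_length_eq[of "UNIV :: bool set" "fst R"]]
          card_lists_length_eq[of "UNIV :: bool set" "fst R"] by simp
      also have "\<dots> \<le> 2 ^ A" using C[OF R(1)] A by (intro power_increasing) auto
      finally have lts: "length ts \<le> 2 ^ A" using distinct_card[OF R(2)] by simp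
      have "tree_size (enc_bools t) \<le> 4 * A + 1" if "t \<in> set ts" for t
      proof -
        have "tree_size (enc_bools t) \<le> 1 + length t * (1 + 3)"
          by (rule tree_size_enc_list_le) (rule tree_size_enc_bool)
        then show ?thesis using len[OF that] by simp
      qed
      then have "tree_size (enc_vecs ts) \<le> 1 + length ts * (1 + (4 * A + 1))"
        by (rule tree_size_enc_list_le)
      also have "\<dots> \<le> 1 + 2 ^ A * (1 + (4 * A + 1))" by (intro add_left_mono mult_le_mono1 lts)
      also have "\<dots> = 1 + 2 ^ A * (4 * A + 2)" by simp
      finally have 1: "tree_size (enc_vecs ts) \<le> 1 + 2 ^ A * (4 * A + 2)" .
      have "tree_size (enc_list enc_unary xs) \<le> 1 + length xs * (1 + 2 * N)"
        by (rule tree_size_enc_list_le) (use xs N in \<open>auto simp: tree_size_enc_unary\<close>)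
      also have "\<dots> \<le> 1 + A * (4 * N)"
        using xs N by (intro add_left_mono mult_le_mono) auto
      finally have 2: "tree_size (enc_cstr c) \<le> 2 + (1 + 2 ^ A * (4 * A + 2)) + A * 4 * N"
        using 1 by (simp add: enc_cstr_def c_eq)
      have "3 + 2 ^ A * (4 * A + 2) \<le> (2 + 2 ^ A * (4 * A + 2)) * 2" by simp
      also have "\<dots> \<le> (2 + 2 ^ A * (4 * A + 2)) * N" using N by (intro mult_le_mono2)
      finally show ?thesis using 2 unfolding B_def add_mult_distrib by linarith
    qed
    then have "tree_size (enc_list enc_cstr cs) \<le> 1 + length cs * (1 + B * N)"
      by (rule tree_size_enc_list_le)
    also have "\<dots> \<le> 1 + (card \<Gamma> * ((A + 1) * N ^ A)) * ((B + 1) * N)"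
      using card N by (intro add_left_mono mult_le_mono) auto
    also have "\<dots> = 1 + (card \<Gamma> * (A + 1) * (B + 1)) * N ^ (A + 1)"
      by (simp add: algebra_simps)
    finally have "tree_size input \<le> 2 * N + 3 + (card \<Gamma> * (A + 1) * (B + 1)) * N ^ (A + 1)"
      using N by (simp add: cs(1) tree_size_enc_unary)
    moreover have "N \<le> N ^ (A + 1)" using N by (intro self_le_power) auto
    ultimately have "tree_size input \<le> 6 * N ^ (A + 1) + (card \<Gamma> * (A + 1) * (B + 1)) * N ^ (A + 1)"
      using N by linarith
    also have "\<dots> = K * N ^ (A + 1)" by (simp add: K_def add_mult_distrib)
    also have "\<dots> \<le> N ^ K * N ^ (A + 1)"
    proof (rule mult_le_mono1)
      have "K \<le> 2 ^ K" by (simp add: less_imp_le)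
      also have "\<dots> \<le> N ^ K" using N by (intro power_mono) auto
      finally show "K \<le> N ^ K" .
    qed
    finally show ?thesis by (simp add: N_def power_add ac_simps)
  qed
  then show ?thesis by (intro exI[of _ "K + A + 1"]) auto
qed

theorem mainTheorem1:
  fixes \<Gamma> :: "bool rel set" and f :: "bool list \<Rightarrow> bool"
  assumes "\<forall>R \<in> \<Gamma>. is_relation R"
    and "minority_operation f"
    and "\<forall>R \<in> \<Gamma>. polymorphism 3 f R"
  shows "(\<exists>c. \<forall>d. \<exists>P. computes_truncated_basis P \<Gamma> d
            (\<lambda>n size. max 2 size ^ (c * max 1 d))) \<and>
         (finite \<Gamma> \<longrightarrow>
           (\<exists>c. \<forall>d. \<exists>P. computes_truncated_basis P \<Gamma> d
              (\<lambda>n size. max 2 n ^ (c * max 1 d))))"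
proof (intro conjI impI)
  show "\<exists>c. \<forall>d. \<exists>P. computes_truncated_basis P \<Gamma> d (\<lambda>n size. max 2 size ^ (c * max 1 d))"
    unfolding computes_truncated_basis_def using program_correct[OF assms] by blast
next
  assume "finite \<Gamma>"
  then obtain a where a: "1 \<le> a" "\<And>n C input. csp_instance \<Gamma> n C \<Longrightarrow> encodes_instance n C input \<Longrightarrow>
      tree_size input \<le> max 2 n ^ a"
    using finite_language_size assms(1) by metis
  \<comment> \<open>The constant is 20 a, where \<open>a\<close> depends on the language but not on
    \<open>d\<close>.\<close>
  have "computes_truncated_basis (program d) \<Gamma> d (\<lambda>n size. max 2 n ^ (a * 20 * max 1 d))" for d
    unfolding computes_truncated_basis_def
  proof (intro allI impI, elim conjE)
    fix n C input assume inst: "csp_instance \<Gamma> n C" "encodes_instance n C input"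
    obtain G out k where *: "reduced_groebner_basis n (combinatorial_ideal n (Sol n C)) G"
      "encodes_polys n (truncation n d G) out" "computes_in (program d) input out k"
      "k + tree_size out \<le> max 2 (tree_size input) ^ (20 * max 1 d)"
      using program_correct[OF assms inst] by blast
    have "max 2 n ^ 1 \<le> max 2 n ^ a" using a(1) by (intro power_increasing) auto
    then have "max 2 (tree_size input) \<le> max 2 n ^ a" using a(2)[OF inst] by simp
    then have "max 2 (tree_size input) ^ (20 * max 1 d) \<le> (max 2 n ^ a) ^ (20 * max 1 d)"
      by (rule power_mono) simp
    also have "\<dots> = max 2 n ^ (a * 20 * max 1 d)" by (simp add: mult.assoc flip: power_mult)
    finally show "\<exists>G output k. reduced_groebner_basis n (combinatorial_ideal n (Sol n C)) G \<and>
        encodes_polys n (truncation n d G) output \<and> computes_in (program d) input output k \<and>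
        k + tree_size output \<le> max 2 n ^ (a * 20 * max 1 d)"
      using * order_trans by blast
  qed
  then show "\<exists>c. \<forall>d. \<exists>P. computes_truncated_basis P \<Gamma> d (\<lambda>n size. max 2 n ^ (c * max 1 d))"
    by blast
qed

end
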